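(* Let $A$ be a unital superalgebra over $\Bbbk$ whose graded codimension sequence $c_n^{gr}(A)$ has cubic growth, and let $\mathbb{M}$ be its associated $3$-admissible sequence. There are exactly $59$ distinct graded codimension sequences arising from such superalgebras $A$, and they are the ones listed below (for a positive integer $m$, $[m]=\{1,2,\dots,m\}$): (1) If $\mathbb{M}=(M_3)$ is a $3$-admissible singleton, with $M_3$ a proper submodule of $\Gamma_3^{gr}$, then $$c_n^{gr}(A)= 1+\binom{n}{1}+5\binom{n}{2}+u\binom{n}{3},\qquad u \in [29].$$ (2) If $\mathbb{M}=(M_2,M_3)$ is a $3$-admissible pair, then one of the following holds: (i) $c_n^{gr}(A)= 1+\binom{n}{1}+4\binom{n}{2}+a\binom{n}{3}$, where $a \in [15]$; (ii) $c_n^{gr}(A)= 1+\binom{n}{1}+3\binom{n}{2}+b\binom{n}{3}$, where $b \in [11]\setminus\{7,10\}$; (iii) $c_n^{gr}(A)= 1+\binom{n}{1}+2\binom{n}{2}+c\binom{n}{3}$, where $c \in [3]$; (iv) $c_n^{gr}(A)= 1+\binom{n}{1}+\binom{n}{2}+d\binom{n}{3}$, where $d \in [2]$. (3) If $\mathbb{M}=(M_1,M_2,M_3)$ is a $3$-admissible triple, then $$c_n^{gr}(A)= 1+\binom{n}{2}+2\binom{n}{3}.$$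
   Context: $\Bbbk$ is a field of characteristic zero; all algebras are associative and unital over $\Bbbk$. A superalgebra is a pair $(A,\varphi)$ with $\varphi$ an algebra automorphism of $A$ satisfying $\varphi^2=\mathrm{id}_A$; put $A^{+}=\{a:\varphi(a)=a\}$ and $A^{-}=\{a:\varphi(a)=-a\}$. The free superalgebra is the free unital associative algebra $\Bbbk\langle Y,Z\rangle$ on $Y=\{y_1,y_2,\dots\}$, $Z=\{z_1,z_2,\dots\}$ with the automorphism $\varphi$ determined by $\varphi(y_i)=y_i$, $\varphi(z_i)=-z_i$. A polynomial $f\in\Bbbk\langle Y,Z\rangle$ is a graded identity of $A$ if it vanishes under every substitution of the $y_i$ by elements of $A^{+}$ and the $z_i$ by elements of $A^{-}$; $\mathrm{Id}^{gr}(A)$ is the set of all graded identities. It is a $\mathrm{T}_2$-ideal, i.e. an ideal of $\Bbbk\langle Y,Z\rangle$ invariant under all algebra endomorphisms commuting with $\varphi$. For a set $S$, $\langle S\rangle_{\mathrm{T}_2}$ is the $\mathrm{T}_2$-ideal generated by $S$. $V_n^{gr}$ is the span of the monomials $v_{\sigma(1)}\cdots v_{\sigma(n)}$ with $\sigma\in\mathbb{S}_n$ and $v_i\in\{y_i,z_i\}$ for each $i$. The graded codimension sequence is $c_n^{gr}(A)=\dim_\Bbbk V_n^{gr}/(V_n^{gr}\cap \mathrm{Id}^{gr}(A))$, $n\ge1$. It has polynomial growth $n^k$ if $c_n^{gr}(A)=qn^k+O(n^{k-1})$ as $n\to\infty$ for some constant $q>0$; cubic growth means $k=3$. Let $B(Y)$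 be the subalgebra of $\Bbbk\langle Y,Z\rangle$ generated by the variables in $Z$ and all (iterated) commutators of elements of $Y\cup Z$; $\Gamma_n^{gr}=B(Y)\cap V_n^{gr}$ ($Y$-proper multilinear polynomials of degree $n$), $\Gamma_0^{gr}=\Bbbk$. The hyperoctahedral group $\mathbb{H}_n=\mathbb{Z}_2\wr\mathbb{S}_n$, with elements $(a_1,\dots,a_n;\sigma)$, $a_i\in\{1,-1\}$, $\sigma\in\mathbb{S}_n$, acts on $V_n^{gr}$ by $y_i\mapsto y_{\sigma(i)}$, $z_i\mapsto a_{\sigma(i)}z_{\sigma(i)}$, and $\Gamma_n^{gr}$ is a submodule. For $1\le s\le k$, a sequence $\mathbb{M}=(M_s,\dots,M_k)$, with each $M_i$ a left $\Bbbk\mathbb{H}_i$-submodule of $\Gamma_i^{gr}$ satisfying $\varphi(M_i)\subset M_i$, is called $k$-admissible if: (1) if $s<k$ then $M_s\ne0$; (2) $M_k$ is a proper submodule of $\Gamma_k^{gr}$; (3) for every $s+1\le j\le k$, $(\langle M_s\rangle_{\mathrm{T}_2}+\dots+\langle M_{j-1}\rangle_{\mathrm{T}_2})\cap\Gamma_j^{gr}\subset M_j$. It is called a $k$-admissible singleton, pair, triple if it has the form $(M_k)$, $(M_{k-1},M_k)$, $(M_{k-2},M_{k-1},M_k)$ respectively. A superalgebra $A$ is associated with $\mathbb{M}$ if $\Gamma_i^{gr}\cap\mathrm{Id}^{gr}(A)=0$ for $1\le i<s$, $=M_i$ for $s\le i\le k$, and $=\Gamma_i^{gr}$ for $i>k$.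 *)

theory Defs
  imports
    "HOL-Algebra.Algebraic_Closure_Type"
    "HOL-Combinatorics.Permutations"
    "HOL-Library.FuncSet"
    "HOL-Library.Landau_Symbols"
    "HOL-Library.Poly_Mapping"
begin

section \<open>The free superalgebra\<close>

text \<open>
  Variables are indexed from 0: \<open>Y i\<close> and \<open>Z i\<close> stand for \<open>y\<^sub>i\<^sub>+\<^sub>1\<close> and \<open>z\<^sub>i\<^sub>+\<^sub>1\<close>, and
  \<open>{..<n}\<close> replaces the index set \<open>{1, \<dots>, n}\<close>.
\<close>

datatype letter = Y nat | Z nat

datatype word = Word (letters: "letter list")

text \<open>
  The free monoid, written additively because the product of \<^typ>\<open>'a \<Rightarrow>\<^sub>0 'k\<close> is convolution
  with respect to the addition of \<^typ>\<open>'a\<close>. Thus \<^typ>\<open>word \<Rightarrow>\<^sub>0 'k\<close> is the monoid algebra of the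
  free monoid, i.e. the free unital associative algebra on the letters.
\<close>

instantiation word :: monoid_add
begin

definition zero_word :: word where "zero_word = Word []"

definition plus_word :: "word \<Rightarrow> word \<Rightarrow> word"
  where "plus_word u v = Word (letters u @ letters v)"

instance by standard (simp_all add: zero_word_def plus_word_def)

end

type_synonym 'k free_alg = "word \<Rightarrow>\<^sub>0 'k"

definition scale :: "'k::field \<Rightarrow> 'k free_alg \<Rightarrow> 'k free_alg"
  where "scale c f = Poly_Mapping.map (\<lambda>x. c * x) f"

lemma lookup_scale: "Poly_Mapping.lookup (scale c f) w = c * Poly_Mapping.lookup f w"
  by (simp add: scale_def Poly_Mapping.map.rep_eq when_def)

global_interpretation free_alg: vector_space "scale :: 'k::field \<Rightarrow> 'k free_alg \<Rightarrow> 'k free_alg"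
  by standard (rule poly_mapping_eqI; simp add: lookup_scale lookup_add algebra_simps)+

definition mono_of :: "letter list \<Rightarrow> 'k::field free_alg"
  where "mono_of w = Poly_Mapping.single (Word w) 1"

definition var :: "letter \<Rightarrow> 'k::field free_alg"
  where "var x = mono_of [x]"

text \<open>The algebra endomorphism of the free algebra sending every letter \<open>x\<close> to \<open>\<rho> x\<close>.\<close>

definition subst_alg :: "(letter \<Rightarrow> 'k::field free_alg) \<Rightarrow> 'k free_alg \<Rightarrow> 'k free_alg"
  where "subst_alg \<rho> f =
    (\<Sum>w\<in>Poly_Mapping.keys f. scale (Poly_Mapping.lookup f w) (prod_list (map \<rho> (letters w))))"

definition free_aut :: "'k::field free_alg \<Rightarrow> 'k free_alg"
  where "free_aut = subst_alg (\<lambda>x. case x of Y i \<Rightarrow> var (Y i) | Z i \<Rightarrow> - var (Z i))"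

definition graded_endo :: "('k::field free_alg \<Rightarrow> 'k free_alg) \<Rightarrow> bool"
  where "graded_endo \<theta> \<longleftrightarrow>
    Vector_Spaces.linear scale scale \<theta> \<and> \<theta> 1 = 1 \<and> (\<forall>f g. \<theta> (f * g) = \<theta> f * \<theta> g) \<and>
    (\<forall>f. \<theta> (free_aut f) = free_aut (\<theta> f))"

definition T2_ideal :: "'k::field free_alg set \<Rightarrow> bool"
  where "T2_ideal I \<longleftrightarrow>
    free_alg.subspace I \<and> (\<forall>f\<in>I. \<forall>g. g * f \<in> I \<and> f * g \<in> I) \<and>
    (\<forall>\<theta>. graded_endo \<theta> \<longrightarrow> \<theta> ` I \<subseteq> I)"

definition T2_gen :: "'k::field free_alg set \<Rightarrow> 'k free_alg set"
  where "T2_gen S = \<Inter> {I. T2_ideal I \<and> S \<subseteq> I}"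

definition multilin :: "nat \<Rightarrow> 'k::field free_alg set"
  where "multilin n = free_alg.span
    {mono_of (map (\<lambda>i. v (\<sigma> i)) [0..<n]) | \<sigma> v.
      \<sigma> permutes {..<n} \<and> (\<forall>i<n. v i \<in> {Y i, Z i})}"

text \<open>Arbitrarily nested commutators of variables, the variables themselves included.\<close>

inductive_set brackets :: "'k::field free_alg set" where
  letter: "var x \<in> brackets"
| bracket: "f \<in> brackets \<Longrightarrow> g \<in> brackets \<Longrightarrow> f * g - g * f \<in> brackets"

inductive_set subalg_gen :: "'k::field free_alg set \<Rightarrow> 'k free_alg set"
  for S :: "'k free_alg set" where
  gen: "f \<in> S \<Longrightarrow> f \<in> subalg_gen S"
| one: "1 \<in> subalg_gen S"
| add: "f \<in> subalg_gen S \<Longrightarrow> g \<in> subalg_gen S \<Longrightarrow> f + g \<in> subalg_gen S"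
| mult: "f \<in> subalg_gen S \<Longrightarrow> g \<in> subalg_gen S \<Longrightarrow> f * g \<in> subalg_gen S"
| scale: "f \<in> subalg_gen S \<Longrightarrow> scale c f \<in> subalg_gen S"

definition Y_proper :: "'k::field free_alg set"
  where "Y_proper = subalg_gen
    ({var (Z i) | i. True} \<union> {f * g - g * f | f g. f \<in> brackets \<and> g \<in> brackets})"

definition Gam :: "nat \<Rightarrow> 'k::field free_alg set"
  where "Gam n = Y_proper \<inter> multilin n"

text \<open>The action of \<open>(a\<^sub>1, \<dots>, a\<^sub>n; \<sigma>)\<close> in the hyperoctahedral group.\<close>

definition hyperoct_act ::
    "(nat \<Rightarrow> 'k::field) \<Rightarrow> (nat \<Rightarrow> nat) \<Rightarrow> 'k free_alg \<Rightarrow> 'k free_alg"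
  where "hyperoct_act a \<sigma> = subst_alg (\<lambda>x. case x of
      Y i \<Rightarrow> var (Y (\<sigma> i))
    | Z i \<Rightarrow> scale (a (\<sigma> i)) (var (Z (\<sigma> i))))"

definition hyperoct_submodule :: "nat \<Rightarrow> 'k::field free_alg set \<Rightarrow> bool"
  where "hyperoct_submodule n M \<longleftrightarrow>
    free_alg.subspace M \<and> M \<subseteq> Gam n \<and>
    (\<forall>a \<sigma>. (\<forall>i<n. a i \<in> {1, -1}) \<and> \<sigma> permutes {..<n} \<longrightarrow> hyperoct_act a \<sigma> ` M \<subseteq> M)"

text \<open>Only the values \<open>M s, \<dots>, M k\<close> of the function \<open>M\<close> are part of the sequence.\<close>

definition k_admissible :: "nat \<Rightarrow> nat \<Rightarrow> (nat \<Rightarrow> 'k::field free_alg set) \<Rightarrow> bool"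
  where "k_admissible s k M \<longleftrightarrow>
    1 \<le> s \<and> s \<le> k \<and>
    (\<forall>i\<in>{s..k}. hyperoct_submodule i (M i) \<and> free_aut ` M i \<subseteq> M i) \<and>
    (s < k \<longrightarrow> M s \<noteq> {0}) \<and>
    M k \<noteq> Gam k \<and>
    (\<forall>j\<in>{s+1..k}.
      {\<Sum>i=s..<j. f i | f. \<forall>i\<in>{s..<j}. f i \<in> T2_gen (M i)} \<inter> Gam j \<subseteq> M j)"

section \<open>Superalgebras and graded codimensions\<close>

text \<open>
  Unital associative algebras, possibly noncommutative (the locale \<^locale>\<open>algebra\<close> of the library
  is restricted to commutative ones), with an automorphism of order at most two.
\<close>

locale superalgebra =
  module "ring_of_type_algebra :: 'k::field_char_0 ring" A + ring A
  for A :: "('k::field_char_0, 'a) module" +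
  fixes \<phi> :: "'a \<Rightarrow> 'a"
  assumes smult_mult_left: "\<lbrakk>x \<in> carrier A; y \<in> carrier A\<rbrakk> \<Longrightarrow>
      (c \<odot>\<^bsub>A\<^esub> x) \<otimes>\<^bsub>A\<^esub> y = c \<odot>\<^bsub>A\<^esub> (x \<otimes>\<^bsub>A\<^esub> y)"
    and smult_mult_right: "\<lbrakk>x \<in> carrier A; y \<in> carrier A\<rbrakk> \<Longrightarrow>
      x \<otimes>\<^bsub>A\<^esub> (c \<odot>\<^bsub>A\<^esub> y) = c \<odot>\<^bsub>A\<^esub> (x \<otimes>\<^bsub>A\<^esub> y)"
    and aut_ring_iso: "\<phi> \<in> ring_iso A A"
    and aut_smult: "x \<in> carrier A \<Longrightarrow> \<phi> (c \<odot>\<^bsub>A\<^esub> x) = c \<odot>\<^bsub>A\<^esub> \<phi> x"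
    and aut_aut: "x \<in> carrier A \<Longrightarrow> \<phi> (\<phi> x) = x"

definition even_part :: "('k, 'a) module \<Rightarrow> ('a \<Rightarrow> 'a) \<Rightarrow> 'a set"
  where "even_part A \<phi> = {x \<in> carrier A. \<phi> x = x}"

definition odd_part :: "('k, 'a) module \<Rightarrow> ('a \<Rightarrow> 'a) \<Rightarrow> 'a set"
  where "odd_part A \<phi> = {x \<in> carrier A. \<phi> x = \<ominus>\<^bsub>A\<^esub> x}"

definition eval_in :: "('k::field, 'a) module \<Rightarrow> (letter \<Rightarrow> 'a) \<Rightarrow> 'k free_alg \<Rightarrow> 'a"
  where "eval_in A \<rho> f =
    (\<Oplus>\<^bsub>A\<^esub>w\<in>Poly_Mapping.keys f. Poly_Mapping.lookup f w \<odot>\<^bsub>A\<^esub>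
      foldr (\<lambda>x r. \<rho> x \<otimes>\<^bsub>A\<^esub> r) (letters w) \<one>\<^bsub>A\<^esub>)"

definition graded_ids :: "('k::field, 'a) module \<Rightarrow> ('a \<Rightarrow> 'a) \<Rightarrow> 'k free_alg set"
  where "graded_ids A \<phi> = {f. \<forall>\<rho>.
    (\<forall>i. \<rho> (Y i) \<in> even_part A \<phi>) \<and> (\<forall>i. \<rho> (Z i) \<in> odd_part A \<phi>) \<longrightarrow>
    eval_in A \<rho> f = \<zero>\<^bsub>A\<^esub>}"

text \<open>
  The cosets \<open>b + W\<close> for \<open>b \<in> B\<close> are pairwise distinct and form a finite basis of
  \<open>V / W\<close>. It is used only for the finite-dimensional spaces of multilinear polynomials.
\<close>

definition quotient_basis ::
    "'k::field free_alg set \<Rightarrow> 'k free_alg set \<Rightarrow> 'k free_alg set \<Rightarrow> bool"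
  where "quotient_basis V W B \<longleftrightarrow>
    finite B \<and> B \<subseteq> V \<and>
    (\<forall>c. (\<Sum>b\<in>B. scale (c b) b) \<in> W \<longrightarrow> (\<forall>b\<in>B. c b = 0)) \<and>
    (\<forall>v\<in>V. \<exists>c. v - (\<Sum>b\<in>B. scale (c b) b) \<in> W)"

definition quotient_dim :: "'k::field free_alg set \<Rightarrow> 'k free_alg set \<Rightarrow> nat"
  where "quotient_dim V W = (THE d. \<exists>B. quotient_basis V W B \<and> card B = d)"

text \<open>The sequence is indexed by \<open>n \<ge> 1\<close>; its value at \<open>0\<close> is \<^const>\<open>undefined\<close>.\<close>

definition graded_codim :: "('k::field, 'a) module \<Rightarrow> ('a \<Rightarrow> 'a) \<Rightarrow> nat \<Rightarrow> nat"
  where "graded_codim A \<phi> =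
    (\<lambda>n\<in>{1..}. quotient_dim (multilin n) (multilin n \<inter> graded_ids A \<phi>))"

definition poly_growth :: "(nat \<Rightarrow> nat) \<Rightarrow> nat \<Rightarrow> bool"
  where "poly_growth c k \<longleftrightarrow>
    (\<exists>q>0. (\<lambda>n. real (c n) - q * real n ^ k) \<in> O(\<lambda>n. real n powi (int k - 1)))"

text \<open>
  The carrier type \<open>'a\<close> is arbitrary. Where a set of algebras over a fixed type is needed,
  \<open>'a = 'k free_alg set\<close>, the type of cosets in the free algebra, is large enough: \<open>A\<close> has the
  same graded identities as the quotient of the free superalgebra by \<open>graded_ids A \<phi>\<close>.
\<close>

definition cubic_superalgebra :: "('k::field_char_0, 'a) module \<Rightarrow> ('a \<Rightarrow> 'a) \<Rightarrow> bool"
  where "cubic_superalgebra A \<phi> \<longleftrightarrow> superalgebra A \<phi> \<and> poly_growth (graded_codim A \<phi>) 3"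

definition associated_with ::
    "('k::field, 'a) module \<Rightarrow> ('a \<Rightarrow> 'a) \<Rightarrow> nat \<Rightarrow> nat \<Rightarrow> (nat \<Rightarrow> 'k free_alg set) \<Rightarrow> bool"
  where "associated_with A \<phi> s k M \<longleftrightarrow>
    (\<forall>i. 1 \<le> i \<and> i < s \<longrightarrow> Gam i \<inter> graded_ids A \<phi> = {0}) \<and>
    (\<forall>i\<in>{s..k}. Gam i \<inter> graded_ids A \<phi> = M i) \<and>
    (\<forall>i>k. Gam i \<inter> graded_ids A \<phi> = Gam i)"

definition binom_seq :: "nat \<Rightarrow> nat \<Rightarrow> nat \<Rightarrow> nat \<Rightarrow> nat"
  where "binom_seq p q r =
    (\<lambda>n\<in>{1..}. 1 + p * (n choose 1) + q * (n choose 2) + r * (n choose 3))"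

end

theory Submission
  imports Defs
begin

text \<open>
  The proof reduces codimension sequences to the dimensions of a few spaces of polynomials of degree
  at most three, bounds these dimensions by computing the consequences of identities of degree two,
  and realizes every remaining possibility.

  \<^emph>\<open>Reduction.\<close> Let \<open>I\<close> be a T2-ideal. In a multilinear polynomial the even variables that occur
  outside commutators can be moved to the front, which writes it uniquely as a sum of products
  \<open>y\<^sub>S g\<^sub>S\<close> with \<open>g\<^sub>S\<close> proper. The substitution \<open>y\<^sub>j := 1\<close> recovers the factors \<open>g\<^sub>S\<close>, and it preserves
  \<open>I\<close>; hence the \<open>n\<close>-th codimension of \<open>I\<close> is the sum of \<open>(n choose k) * gamma I k\<close> over \<open>k \<le> n\<close>,
  where \<open>gamma I k\<close> is the codimension of \<open>I\<close> in the proper multilinear polynomials of degree \<open>k\<close>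
  (\<open>codim_multilin_gamma\<close>). Cubic growth means that \<open>gamma I k\<close> vanishes for \<open>k > 3\<close> but not for
  \<open>k = 3\<close>, so the sequence is determined by \<open>gamma I 1\<close>, \<open>gamma I 2\<close>, \<open>gamma I 3\<close>. Up to renaming, the
  proper polynomials of degree \<open>k\<close> depend on the number \<open>r\<close> of odd variables only, and
  \<open>gamma I k\<close> is the sum of \<open>(k choose r) * proper_codim I (k - r) r\<close>.

  \<^emph>\<open>Upper bounds.\<close> The proper polynomials of degree two in a T2-ideal are determined by which of the
  polynomials \<open>[y\<^sub>0, y\<^sub>1]\<close>, \<open>[y\<^sub>0, z\<^sub>0]\<close>, \<open>z\<^sub>0 z\<^sub>1 + z\<^sub>1 z\<^sub>0\<close>, \<open>[z\<^sub>0, z\<^sub>1]\<close> it contains. Substituting products such as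
  \<open>y z\<close> for odd and \<open>z z'\<close> for even variables shows what each of them forces in degree three, and
  a finite case analysis yields the listed ranges (\<open>possible_gammas\<close>). The values 7 and 10 are
  missing for \<open>gamma I 2 = 3\<close> because values above 4 require the products of odd elements to
  vanish; then \<open>gamma I 3\<close> equals \<open>proper_codim I 3 0 + 3 * proper_codim I 2 1\<close>, the second
  summand is a multiple of 3 not exceeding 9, and the first is 0 or 2 since the proper polynomials
  in three even variables form an irreducible module.

  \<^emph>\<open>Realization.\<close> A linear functional on words determines the largest T2-ideal in its kernel
  (\<open>core_ideal\<close>). Twelve functionals supported on words of length three detect one irreducible
  component of the proper polynomials of degree three each, and five functionals of smaller degree supply
  components of degree one and two; these functionals are called atoms. In degree three, the codimension of
  the intersection of the ideals of a set of atoms is the total dimension of the components that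
  they detect, and suitable sets of atoms give all 59 sequences. Finally, each
  T2-ideal is the ideal of graded identities of the corresponding relatively free superalgebra
  (\<open>rel_free_graded_ids\<close>).
\<close>

section \<open>Linear algebra modulo a subspace\<close>

definition fin_space :: "'k::field free_alg set \<Rightarrow> bool"
  where "fin_space V \<longleftrightarrow> free_alg.subspace V \<and> (\<exists>S. finite S \<and> V \<subseteq> free_alg.span S)"

text \<open>
  For a T2-ideal \<open>W\<close> and a space \<open>V\<close> of multilinear polynomials this is the dimension of the image of
  \<open>V\<close> in the relatively free algebra. The space \<open>W\<close> is not required to lie in \<open>V\<close>.
\<close>

definition codim :: "'k::field free_alg set \<Rightarrow> 'k free_alg set \<Rightarrow> nat"
  where "codim V W = quotient_dim V (V \<inter> W)"

lemma fin_space_Int: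
  assumes "fin_space V" "free_alg.subspace W"
  shows "fin_space (V \<inter> W)"
  using assms unfolding fin_space_def by (meson free_alg.subspace_inter inf.coboundedI1)

lemma fin_space_subset:
  assumes "fin_space V" "free_alg.subspace W" "W \<subseteq> V"
  shows "fin_space W"
  using assms unfolding fin_space_def by blast

lemma fin_space_basis:
  assumes "fin_space V"
  obtains C where "C \<subseteq> V" "free_alg.independent C" "V \<subseteq> free_alg.span C" "finite C"
    "card C = free_alg.dim V"
proof -
  obtain C where C: "C \<subseteq> V" "free_alg.independent C" "V \<subseteq> free_alg.span C" "card C = free_alg.dim V"
    using free_alg.basis_exists by blast
  obtain S where "finite S" "V \<subseteq> free_alg.span S" using assms unfolding fin_space_def by blast
  then have "finite C" using C free_alg.independent_span_bound by blast
  with C that show thesis by blast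
qed

text \<open>
  Representatives of a basis of the quotient together with a basis of the subspace form a basis of the
  whole space. Hence all bases of the quotient have the same size.
\<close>

lemma quotient_basis_union_independent:
  assumes qb: "quotient_basis V W B" and W: "free_alg.subspace W"
    and C: "C \<subseteq> W" "free_alg.independent C" "finite C"
  shows "free_alg.independent (B \<union> C)" and "B \<inter> C = {}"
proof -
  have finB: "finite B" and ind: "\<And>c. (\<Sum>b\<in>B. scale (c b) b) \<in> W \<Longrightarrow> \<forall>b\<in>B. c b = 0"
    using qb unfolding quotient_basis_def by auto
  show disj: "B \<inter> C = {}"
  proof (rule ccontr)
    assume "B \<inter> C \<noteq> {}"
    then obtain b where b: "b \<in> B" "b \<in> W" using C by blast
    have "(\<Sum>x\<in>B. scale (if x = b then 1 else 0) x) = b"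
      using b finB by (simp add: if_distrib[of "\<lambda>t. scale t _"] sum.delta' cong: if_cong)
    then show False using ind[of "\<lambda>x. if x = b then 1 else 0"] b by auto
  qed
  show "free_alg.independent (B \<union> C)"
  proof (rule free_alg.independent_if_scalars_zero)
    show "finite (B \<union> C)" using finB C by simp
    fix f x assume z: "(\<Sum>x\<in>B \<union> C. scale (f x) x) = 0" and x: "x \<in> B \<union> C"
    have split: "(\<Sum>x\<in>B. scale (f x) x) + (\<Sum>x\<in>C. scale (f x) x) = 0"
      using z disj finB C by (simp add: sum.union_disjoint)
    have CW: "(\<Sum>x\<in>C. scale (f x) x) \<in> W"
      using C W by (auto intro!: free_alg.subspace_sum free_alg.subspace_scale)
    have "(\<Sum>x\<in>B. scale (f x) x) = - (\<Sum>x\<in>C. scale (f x) x)"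
      using split by (simp add: eq_neg_iff_add_eq_0)
    then have "(\<Sum>x\<in>B. scale (f x) x) \<in> W" using CW W by (simp add: free_alg.subspace_neg)
    then have B0: "\<forall>b\<in>B. f b = 0" by (rule ind)
    then have "(\<Sum>x\<in>C. scale (f x) x) = 0" using split by simp
    then have "\<forall>c\<in>C. f c = 0" using C free_alg.independentD[of C C f] by blast
    with B0 x show "f x = 0" by blast
  qed
qed

lemma quotient_basis_card:
  assumes V: "fin_space V" and W: "free_alg.subspace W" and qb: "quotient_basis V (V \<inter> W) B"
  shows "card B + free_alg.dim (V \<inter> W) = free_alg.dim V"
proof -
  have sub: "free_alg.subspace V" using V unfolding fin_space_def by blast
  have subW: "free_alg.subspace (V \<inter> W)" using sub W by (rule free_alg.subspace_inter)
  obtain C where C: "C \<subseteq> V \<inter> W" "free_alg.independent C" "V \<inter> W \<subseteq> free_alg.span C" "finite C"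
    "card C = free_alg.dim (V \<inter> W)"
    by (rule fin_space_basis[OF fin_space_Int[OF V W]])
  have finB: "finite B" and BV: "B \<subseteq> V"
    and sp: "\<And>v. v \<in> V \<Longrightarrow> \<exists>c. v - (\<Sum>b\<in>B. scale (c b) b) \<in> V \<inter> W"
    using qb unfolding quotient_basis_def by auto
  note u = quotient_basis_union_independent[OF qb subW C(1,2,4)]
  have "V \<subseteq> free_alg.span (B \<union> C)"
  proof
    fix v assume "v \<in> V"
    then obtain c where c: "v - (\<Sum>b\<in>B. scale (c b) b) \<in> V \<inter> W" using sp by blast
    have "v - (\<Sum>b\<in>B. scale (c b) b) \<in> free_alg.span (B \<union> C)"
      using c C free_alg.span_mono[of C "B \<union> C"] by blast
    moreover have "(\<Sum>b\<in>B. scale (c b) b) \<in> free_alg.span (B \<union> C)"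
      by (intro free_alg.span_sum free_alg.span_scale free_alg.span_base) blast
    ultimately show "v \<in> free_alg.span (B \<union> C)" using free_alg.span_add by fastforce
  qed
  then have "card (B \<union> C) = free_alg.dim V"
    using u(1) BV C(1) by (intro free_alg.basis_card_eq_dim) auto
  then show ?thesis using u(2) finB C by (simp add: card_Un_disjoint)
qed

text \<open>
  A basis of \<open>V \<inter> W\<close> extends to a basis of \<open>V\<close>; the new vectors represent a basis of the quotient.
\<close>

lemma quotient_basis_exists:
  assumes V: "fin_space V" and W: "free_alg.subspace W"
  obtains B where "quotient_basis V (V \<inter> W) B"
proof -
  have sub: "free_alg.subspace V" using V unfolding fin_space_def by blast
  have subW: "free_alg.subspace (V \<inter> W)" using sub W by (rule free_alg.subspace_inter)
  obtain C where C: "C \<subseteq> V \<inter> W" "free_alg.independent C" "V \<inter> W \<subseteq> free_alg.span C" "finite C"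
    "card C = free_alg.dim (V \<inter> W)"
    by (rule fin_space_basis[OF fin_space_Int[OF V W]])
  have CV: "C \<subseteq> V" using C(1) by blast
  obtain D where D: "C \<subseteq> D" "D \<subseteq> V" "free_alg.independent D" "V \<subseteq> free_alg.span D"
    by (rule free_alg.maximal_independent_subset_extend[OF CV C(2)])
  obtain S where "finite S" "V \<subseteq> free_alg.span S" using V unfolding fin_space_def by blast
  then have finD: "finite D" using D free_alg.independent_span_bound by blast
  define B where "B = D - C"
  have CD: "(\<Sum>x\<in>D. g x) = (\<Sum>x\<in>B. g x) + (\<Sum>x\<in>C. g x)" for g :: "'a free_alg \<Rightarrow> 'a free_alg"
    using sum.subset_diff[of C D g] D finD unfolding B_def by simp
  have "quotient_basis V (V \<inter> W) B"
    unfolding quotient_basis_def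
  proof (intro conjI allI impI ballI)
    show "finite B" "B \<subseteq> V" using finD D unfolding B_def by auto
  next
    fix c b assume h: "(\<Sum>b\<in>B. scale (c b) b) \<in> V \<inter> W" and b: "b \<in> B"
    obtain e where e: "(\<Sum>b\<in>B. scale (c b) b) = (\<Sum>x\<in>C. scale (e x) x)"
      using h C(3,4) free_alg.span_finite[of C] by blast
    define k where "k x = (if x \<in> C then - e x else c x)" for x
    have "(\<Sum>x\<in>D. scale (k x) x) = (\<Sum>b\<in>B. scale (c b) b) + (\<Sum>x\<in>C. scale (- e x) x)"
      unfolding CD by (intro arg_cong2[where f="(+)"] sum.cong) (auto simp: k_def B_def)
    also have "\<dots> = 0" using e by (simp add: sum_negf)
    finally have "\<forall>x\<in>D. k x = 0" using free_alg.independentD[OF D(3) finD subset_refl] by blast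
    then show "c b = 0" using b unfolding k_def B_def by auto
  next
    fix v assume v: "v \<in> V"
    then obtain c where c: "v = (\<Sum>x\<in>D. scale (c x) x)"
      using D(4) free_alg.span_finite[OF finD] by blast
    have "v - (\<Sum>b\<in>B. scale (c b) b) = (\<Sum>x\<in>C. scale (c x) x)" unfolding c CD by simp
    also have "\<dots> \<in> V \<inter> W"
      using C(1) by (intro free_alg.subspace_sum[OF subW] free_alg.subspace_scale[OF subW]) auto
    finally show "\<exists>c. v - (\<Sum>b\<in>B. scale (c b) b) \<in> V \<inter> W" by blast
  qed
  then show thesis by (rule that)
qed

lemma codim_eq_card:
  assumes V: "fin_space V" and W: "free_alg.subspace W" and qb: "quotient_basis V (V \<inter> W) B"
  shows "codim V W = card B"
  unfolding codim_def quotient_dim_def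
proof (rule the_equality)
  show "\<exists>B'. quotient_basis V (V \<inter> W) B' \<and> card B' = card B" using qb by blast
  fix d assume "\<exists>B'. quotient_basis V (V \<inter> W) B' \<and> card B' = d"
  then obtain B' where "quotient_basis V (V \<inter> W) B'" "card B' = d" by blast
  then show "d = card B"
    using quotient_basis_card[OF V W qb] quotient_basis_card[OF V W, of B'] by linarith
qed

lemma codim_dim:
  assumes V: "fin_space V" and W: "free_alg.subspace W"
  shows "codim V W + free_alg.dim (V \<inter> W) = free_alg.dim V"
proof -
  obtain B where "quotient_basis V (V \<inter> W) B" using quotient_basis_exists[OF assms] .
  then show ?thesis using quotient_basis_card[OF assms] codim_eq_card[OF assms] by simp
qed

lemma codim_le:
  assumes V: "fin_space V" and W: "free_alg.subspace W" and S: "finite S" "S \<subseteq> V"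
    and sp: "\<And>v. v \<in> V \<Longrightarrow> \<exists>s\<in>free_alg.span S. v - s \<in> W"
  shows "codim V W \<le> card S"
proof -
  have sub: "free_alg.subspace V" using V unfolding fin_space_def by blast
  obtain C where C: "C \<subseteq> V \<inter> W" "free_alg.independent C" "V \<inter> W \<subseteq> free_alg.span C" "finite C"
    "card C = free_alg.dim (V \<inter> W)"
    by (rule fin_space_basis[OF fin_space_Int[OF V W]])
  have "V \<subseteq> free_alg.span (S \<union> C)"
  proof
    fix v assume v: "v \<in> V"
    then obtain s where s: "s \<in> free_alg.span S" "v - s \<in> W" using sp by blast
    have "s \<in> V" using s(1) S(2) sub by (meson free_alg.span_minimal subsetD)
    then have "v - s \<in> free_alg.span C" using s v sub C(3) by (auto intro: free_alg.subspace_diff)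
    then have "v - s \<in> free_alg.span (S \<union> C)" using free_alg.span_mono[of C "S \<union> C"] by blast
    moreover have "s \<in> free_alg.span (S \<union> C)" using s free_alg.span_mono[of S "S \<union> C"] by blast
    ultimately show "v \<in> free_alg.span (S \<union> C)" using free_alg.span_add by fastforce
  qed
  then have "free_alg.dim V \<le> card (S \<union> C)" using S C by (intro free_alg.dim_le_card) auto
  also have "\<dots> \<le> card S + card C" by (rule card_Un_le)
  finally show ?thesis using codim_dim[OF V W] C(5) by simp
qed

lemma codim_eq_0:
  assumes V: "fin_space V" and W: "free_alg.subspace W"
  shows "codim V W = 0 \<longleftrightarrow> V \<subseteq> W"
proof
  assume "codim V W = 0"
  moreover obtain B where B: "quotient_basis V (V \<inter> W) B" using quotient_basis_exists[OF assms] .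
  ultimately have "B = {}" using codim_eq_card[OF assms B] B unfolding quotient_basis_def by simp
  then show "V \<subseteq> W" using B unfolding quotient_basis_def by auto
next
  assume "V \<subseteq> W"
  then have "codim V W \<le> card ({} :: 'a free_alg set)"
    by (intro codim_le[OF assms]) (auto intro!: bexI[of _ 0] free_alg.span_zero)
  then show "codim V W = 0" by simp
qed

text \<open>
  The map \<open>d\<close> splits off \<open>V2\<close> as a direct summand of \<open>V\<close> with complement its kernel \<open>V1\<close>, and it
  does so compatibly with \<open>W\<close>. Renamings, the removal of a variable and the
  projection to a multidegree are all of this form.
\<close>

lemma codim_split:
  assumes V: "fin_space V" and V2: "fin_space V2" and W: "free_alg.subspace W"
    and d: "Vector_Spaces.linear scale scale d" and s: "Vector_Spaces.linear scale scale s"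
    and dV: "\<And>v. v \<in> V \<Longrightarrow> d v \<in> V2" and sV: "\<And>v. v \<in> V2 \<Longrightarrow> s v \<in> V"
    and ds: "\<And>v. v \<in> V2 \<Longrightarrow> d (s v) = v"
    and dW: "\<And>v. v \<in> V \<Longrightarrow> v \<in> W \<Longrightarrow> d v \<in> W" and sW: "\<And>v. v \<in> V2 \<Longrightarrow> v \<in> W \<Longrightarrow> s v \<in> W"
    and V1: "V1 = {v \<in> V. d v = 0}"
  shows "codim V W = codim V1 W + codim V2 W"
proof -
  interpret d: Vector_Spaces.linear scale scale d by (rule d)
  interpret s: Vector_Spaces.linear scale scale s by (rule s)
  have sub: "free_alg.subspace V" and sub2: "free_alg.subspace V2"
    using V V2 unfolding fin_space_def by auto
  have sub1: "free_alg.subspace V1"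
    using sub unfolding V1 free_alg.subspace_def by (auto simp: d.add d.scale)
  have fin1: "fin_space V1" using fin_space_subset[OF V sub1] V1 by blast
  obtain B1 where B1: "quotient_basis V1 (V1 \<inter> W) B1" using quotient_basis_exists[OF fin1 W] .
  obtain B2 where B2: "quotient_basis V2 (V2 \<inter> W) B2" using quotient_basis_exists[OF V2 W] .
  have fB1: "finite B1" "B1 \<subseteq> V1"
    and i1: "\<And>c. (\<Sum>b\<in>B1. scale (c b) b) \<in> V1 \<inter> W \<Longrightarrow> \<forall>b\<in>B1. c b = 0"
    and s1: "\<And>v. v \<in> V1 \<Longrightarrow> \<exists>c. v - (\<Sum>b\<in>B1. scale (c b) b) \<in> V1 \<inter> W"
    using B1 unfolding quotient_basis_def by auto
  have fB2: "finite B2" "B2 \<subseteq> V2"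
    and i2: "\<And>c. (\<Sum>b\<in>B2. scale (c b) b) \<in> V2 \<inter> W \<Longrightarrow> \<forall>b\<in>B2. c b = 0"
    and s2: "\<And>v. v \<in> V2 \<Longrightarrow> \<exists>c. v - (\<Sum>b\<in>B2. scale (c b) b) \<in> V2 \<inter> W"
    using B2 unfolding quotient_basis_def by auto
  have inj: "inj_on s B2" using ds fB2 by (intro inj_onI) (metis subsetD)
  have nz: "b \<noteq> 0" if "b \<in> B2" for b
  proof
    assume "b = 0"
    have "(\<Sum>x\<in>B2. scale (if x = b then 1 else 0) x) = b"
      using that fB2 by (simp add: if_distrib[of "\<lambda>t. scale t _"] sum.delta' cong: if_cong)
    then have "(\<Sum>x\<in>B2. scale (if x = b then 1 else 0) x) \<in> V2 \<inter> W"
      using \<open>b = 0\<close> sub2 W by (simp add: free_alg.subspace_0)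
    from i2[OF this] that show False by auto
  qed
  have disj: "B1 \<inter> s ` B2 = {}"
  proof -
    have "d (s b) \<noteq> 0" if "b \<in> B2" for b using nz that ds fB2 by auto
    then show ?thesis using fB1 unfolding V1 by auto
  qed
  have sum_un: "(\<Sum>b\<in>B1 \<union> s ` B2. scale (c b) b)
      = (\<Sum>b\<in>B1. scale (c b) b) + s (\<Sum>b\<in>B2. scale (c (s b)) b)" for c
    using fB1 fB2 disj inj by (simp add: sum.union_disjoint sum.reindex s.sum s.scale)
  have in1: "(\<Sum>b\<in>B1. scale (c b) b) \<in> V1" for c
    using fB1 by (intro free_alg.subspace_sum[OF sub1] free_alg.subspace_scale[OF sub1]) auto
  have in2: "(\<Sum>b\<in>B2. scale (c b) b) \<in> V2" for c
    using fB2 by (intro free_alg.subspace_sum[OF sub2] free_alg.subspace_scale[OF sub2]) auto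
  have "quotient_basis V (V \<inter> W) (B1 \<union> s ` B2)"
    unfolding quotient_basis_def
  proof (intro conjI allI impI)
    show "finite (B1 \<union> s ` B2)" using fB1 fB2 by simp
    show "B1 \<union> s ` B2 \<subseteq> V" using fB1 fB2 sV unfolding V1 by auto
  next
    fix c assume h: "(\<Sum>b\<in>B1 \<union> s ` B2. scale (c b) b) \<in> V \<inter> W"
    have "d (\<Sum>b\<in>B1 \<union> s ` B2. scale (c b) b) = (\<Sum>b\<in>B2. scale (c (s b)) b)"
      unfolding sum_un d.add ds[OF in2] using in1[of c] unfolding V1 by simp
    then have "(\<Sum>b\<in>B2. scale (c (s b)) b) \<in> V2 \<inter> W" using h dV dW by fastforce
    then have c2: "\<forall>b\<in>B2. c (s b) = 0" by (rule i2)
    then have "(\<Sum>b\<in>B1. scale (c b) b) \<in> V1 \<inter> W" using h in1[of c] unfolding sum_un by simp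
    then have "\<forall>b\<in>B1. c b = 0" by (rule i1)
    with c2 show "\<forall>b\<in>B1 \<union> s ` B2. c b = 0" by blast
  next
    show "\<forall>v\<in>V. \<exists>c. v - (\<Sum>b\<in>B1 \<union> s ` B2. scale (c b) b) \<in> V \<inter> W"
    proof
    fix v assume v: "v \<in> V"
    have "v - s (d v) \<in> V1"
      using v sub dV sV ds unfolding V1 by (auto simp: d.diff free_alg.subspace_diff)
    from s1[OF this] obtain c1 where c1: "v - s (d v) - (\<Sum>b\<in>B1. scale (c1 b) b) \<in> V1 \<inter> W" ..
    obtain c2 where c2: "d v - (\<Sum>b\<in>B2. scale (c2 b) b) \<in> V2 \<inter> W" using s2[OF dV[OF v]] ..
    define c where "c x = (if x \<in> B1 then c1 x else c2 (d x))" for x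
    have e1: "(\<Sum>b\<in>B1. scale (c b) b) = (\<Sum>b\<in>B1. scale (c1 b) b)"
      by (rule sum.cong) (auto simp: c_def)
    have e2: "(\<Sum>b\<in>B2. scale (c (s b)) b) = (\<Sum>b\<in>B2. scale (c2 b) b)"
      using disj ds fB2 by (intro sum.cong) (auto simp: c_def)
    have "s (d v - (\<Sum>b\<in>B2. scale (c2 b) b)) \<in> V \<inter> W" using c2 sV sW by auto
    moreover have "v - s (d v) - (\<Sum>b\<in>B1. scale (c1 b) b) \<in> V \<inter> W" using c1 unfolding V1 by blast
    moreover have "v - (\<Sum>b\<in>B1 \<union> s ` B2. scale (c b) b)
        = (v - s (d v) - (\<Sum>b\<in>B1. scale (c1 b) b)) + s (d v - (\<Sum>b\<in>B2. scale (c2 b) b))"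
    proof -
      have "v - (a + b) = (v - x - a) + (x - b)" for a b x :: "'a free_alg"
        by (simp add: algebra_simps)
      then show ?thesis unfolding sum_un e1 e2 s.diff .
    qed
    ultimately have "v - (\<Sum>b\<in>B1 \<union> s ` B2. scale (c b) b) \<in> V \<inter> W"
      by (simp only: free_alg.subspace_add[OF free_alg.subspace_inter[OF sub W]])
    then show "\<exists>c. v - (\<Sum>b\<in>B1 \<union> s ` B2. scale (c b) b) \<in> V \<inter> W" by (rule exI[where x = c])
    qed
  qed
  then have "codim V W = card (B1 \<union> s ` B2)" by (rule codim_eq_card[OF V W])
  also have "\<dots> = card B1 + card B2"
    using fB1 fB2 disj inj by (simp add: card_Un_disjoint card_image)
  finally show ?thesis using codim_eq_card[OF fin1 W B1] codim_eq_card[OF V2 W B2] by simp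
qed

text \<open>
  The vectors \<open>b k\<close> with \<open>k \<notin> S\<close> lie in \<open>W\<close>, and those with \<open>k \<in> S\<close> are independent modulo \<open>W\<close>. The
  dimensions of all concrete spaces below are computed in this way.
\<close>

lemma codim_by_coordinates:
  assumes V: "fin_space V" and W: "free_alg.subspace W" and T: "finite T" "S \<subseteq> T"
    and b: "\<And>k. k \<in> T \<Longrightarrow> b k \<in> V" and sp: "\<And>v. v \<in> V \<Longrightarrow> \<exists>c. v = (\<Sum>k\<in>T. scale (c k) (b k))"
    and co: "\<And>c. (\<Sum>k\<in>T. scale (c k) (b k)) \<in> W \<longleftrightarrow> (\<forall>k\<in>S. c k = 0)"
  shows "codim V W = card S"
proof -
  have sub: "free_alg.subspace V" using V unfolding fin_space_def by blast
  have finS: "finite S" using T finite_subset by blast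
  have inj: "inj_on b S"
  proof (rule inj_onI, rule ccontr)
    fix x y assume h: "x \<in> S" "y \<in> S" "b x = b y" "x \<noteq> y"
    define c :: "_ \<Rightarrow> 'a" where "c k = (if k = x then 1 else 0) - (if k = y then 1 else 0)" for k
    have "(\<Sum>k\<in>T. scale (c k) (b k)) = b x - b y"
      using T h unfolding c_def
      by (simp add: free_alg.scale_left_diff_distrib sum_subtractf if_distrib[of "\<lambda>t. scale t _"]
          sum.delta' subsetD cong: if_cong)
    then have "(\<Sum>k\<in>T. scale (c k) (b k)) \<in> W" using h W by (simp add: free_alg.subspace_0)
    then have "c x = 0" using co h by blast
    then show False using h unfolding c_def by simp
  qed
  have ext: "(\<Sum>k\<in>T. scale (if k \<in> S then c k else 0) (b k)) = (\<Sum>k\<in>S. scale (c k) (b k))" for c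
  proof -
    have "(\<Sum>k\<in>S. scale (c k) (b k)) = (\<Sum>k\<in>S. scale (if k \<in> S then c k else 0) (b k))"
      by (rule sum.cong) auto
    also have "\<dots> = (\<Sum>k\<in>T. scale (if k \<in> S then c k else 0) (b k))"
      using T by (intro sum.mono_neutral_left) auto
    finally show ?thesis ..
  qed
  have "quotient_basis V (V \<inter> W) (b ` S)"
    unfolding quotient_basis_def
  proof (intro conjI allI impI)
    show "finite (b ` S)" "b ` S \<subseteq> V" using finS b T by auto
  next
    fix c assume "(\<Sum>v\<in>b ` S. scale (c v) v) \<in> V \<inter> W"
    then have "(\<Sum>k\<in>S. scale (c (b k)) (b k)) \<in> W" using inj by (simp add: sum.reindex)
    then have "\<forall>k\<in>S. c (b k) = 0"
      using co[of "\<lambda>k. if k \<in> S then c (b k) else 0"] unfolding ext by auto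
    then show "\<forall>v\<in>b ` S. c v = 0" by blast
  next
    show "\<forall>v\<in>V. \<exists>c. v - (\<Sum>x\<in>b ` S. scale (c x) x) \<in> V \<inter> W"
    proof
      fix v assume v: "v \<in> V"
      then obtain c where c: "v = (\<Sum>k\<in>T. scale (c k) (b k))" using sp by blast
      define e where "e x = c (inv_into S b x)" for x
      have e: "(\<Sum>x\<in>b ` S. scale (e x) x) = (\<Sum>k\<in>S. scale (c k) (b k))"
        using inj unfolding e_def by (simp add: sum.reindex)
      have eV: "(\<Sum>x\<in>b ` S. scale (e x) x) \<in> V"
        using b T by (intro free_alg.subspace_sum[OF sub] free_alg.subspace_scale[OF sub]) auto
      have "v - (\<Sum>x\<in>b ` S. scale (e x) x) = (\<Sum>k\<in>T. scale (if k \<in> S then 0 else c k) (b k))"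
        unfolding e c ext[symmetric] sum_subtractf[symmetric] by (rule sum.cong) auto
      also have "\<dots> \<in> W" using co[of "\<lambda>k. if k \<in> S then 0 else c k"] by simp
      finally show "\<exists>c. v - (\<Sum>x\<in>b ` S. scale (c x) x) \<in> V \<inter> W"
        using eV v sub by (auto intro: free_alg.subspace_diff)
    qed
  qed
  then have "codim V W = card (b ` S)" by (rule codim_eq_card[OF V W])
  then show ?thesis using inj by (simp add: card_image)
qed

section \<open>The free superalgebra and its T2-ideals\<close>

abbreviation lookup where "lookup \<equiv> Poly_Mapping.lookup"
abbreviation keys where "keys \<equiv> Poly_Mapping.keys"

lemma scale_conv_mult: "scale c f = Poly_Mapping.single 0 c * f"
  unfolding scale_def by (simp add: mult_map_scale_conv_mult)

lemma scale_mult_left [simp]: "scale c f * g = scale c (f * g)"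
  by (simp add: scale_conv_mult mult.assoc)

lemma mono_of_Nil [simp]: "mono_of [] = 1"
  by (simp add: mono_of_def zero_word_def[symmetric])

lemma mono_of_append: "mono_of (xs @ ys) = mono_of xs * mono_of ys"
  by (simp add: mono_of_def mult_single plus_word_def)

lemma mono_of_Cons: "mono_of (x # xs) = var x * mono_of xs"
  using mono_of_append[of "[x]" xs] by (simp add: var_def)

lemma lookup_mono_of: "lookup (mono_of xs) (Word ys) = (if xs = ys then 1 else 0)"
  by (simp add: mono_of_def lookup_single when_def)

lemma keys_mono_of [simp]: "keys (mono_of xs :: 'k::field free_alg) = {Word xs}"
  by (simp add: mono_of_def)

lemma free_alg_expand:
  "f = (\<Sum>w\<in>keys f. scale (lookup f w) (mono_of (letters w)))"
proof (rule poly_mapping_eqI)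
  fix k
  have "lookup (\<Sum>w\<in>keys f. scale (lookup f w) (mono_of (letters w))) k
     = (\<Sum>w\<in>keys f. if w = k then lookup f w else 0)"
    unfolding lookup_sum
    by (rule sum.cong) (auto simp: lookup_scale mono_of_def lookup_single when_def)
  also have "\<dots> = lookup f k" by (simp add: sum.delta' in_keys_iff)
  finally show "lookup f k
    = lookup (\<Sum>w\<in>keys f. scale (lookup f w) (mono_of (letters w))) k" ..
qed

lemma free_alg_induct [case_names zero add mono]:
  assumes "P 0" "\<And>f g. P f \<Longrightarrow> P g \<Longrightarrow> P (f + g)" "\<And>c xs. P (scale c (mono_of xs))"
  shows "P f"
proof -
  have "P (\<Sum>w\<in>A. scale (lookup f w) (mono_of (letters w)))" if "finite A" for A
    using that by (induction A rule: finite_induct) (auto intro: assms)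
  from this[OF finite_keys[of f]] show ?thesis using free_alg_expand[of f] by simp
qed

lemma scale_mono_of: "scale c (mono_of xs) = Poly_Mapping.single (Word xs) c"
  by (rule poly_mapping_eqI) (simp add: lookup_scale mono_of_def lookup_single when_def)

lemma scale_mult_right [simp]: "f * scale c g = scale c (f * g)"
proof -
  have "f * Poly_Mapping.single 0 c = Poly_Mapping.single 0 c * f"
  proof (induction f rule: free_alg_induct)
    case (mono d xs)
    then show ?case by (simp add: scale_mono_of mult_single mult.commute)
  qed (simp_all add: algebra_simps)
  then show ?thesis by (simp add: scale_conv_mult mult.assoc[symmetric])
qed

lemma subst_alg_superset:
  assumes "finite A" "keys f \<subseteq> A"
  shows "subst_alg \<rho> f = (\<Sum>w\<in>A. scale (lookup f w) (prod_list (map \<rho> (letters w))))"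
  unfolding subst_alg_def using assms by (intro sum.mono_neutral_left) (auto simp: in_keys_iff)

lemma subst_alg_add: "subst_alg \<rho> (f + g) = subst_alg \<rho> f + subst_alg \<rho> g"
proof -
  have fin: "finite (keys f \<union> keys g)" by simp
  note sup = subst_alg_superset[OF fin, of _ \<rho>]
  show ?thesis
    unfolding sup[OF keys_add] sup[OF Un_upper1] sup[OF Un_upper2]
    by (simp add: lookup_add free_alg.scale_left_distrib sum.distrib)
qed

lemma subst_alg_scale: "subst_alg \<rho> (scale c f) = scale c (subst_alg \<rho> f)"
proof -
  have "keys (scale c f) \<subseteq> keys f" by (auto simp: in_keys_iff lookup_scale)
  then show ?thesis
    using subst_alg_superset[of "keys f" "scale c f"]
    by (simp add: lookup_scale subst_alg_def free_alg.scale_sum_right)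
qed

lemma linear_subst_alg: "Vector_Spaces.linear scale scale (subst_alg \<rho>)"
  by (rule Vector_Spaces.linear.intro)
    (unfold_locales, simp_all add: subst_alg_add subst_alg_scale)

lemmas linear_module_hom = module_hom_iff_linear[THEN iffD2]

lemmas subst_alg_zero [simp] = module_hom.zero[OF linear_module_hom[OF linear_subst_alg]]
  and subst_alg_diff = module_hom.diff[OF linear_module_hom[OF linear_subst_alg]]
  and subst_alg_uminus = module_hom.neg[OF linear_module_hom[OF linear_subst_alg]]
  and subst_alg_sum = module_hom.sum[OF linear_module_hom[OF linear_subst_alg]]

lemma subst_alg_mono: "subst_alg \<rho> (mono_of xs) = prod_list (map \<rho> xs)"
  by (simp add: subst_alg_def) (simp add: mono_of_def)

lemma subst_alg_var [simp]: "subst_alg \<rho> (var x) = \<rho> x"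
  by (simp add: var_def subst_alg_mono)

lemma subst_alg_one [simp]: "subst_alg \<rho> 1 = 1"
  using subst_alg_mono[of \<rho> "[]"] by simp

lemma subst_alg_mult: "subst_alg \<rho> (f * g) = subst_alg \<rho> f * subst_alg \<rho> g"
proof (induction f rule: free_alg_induct)
  case (mono c xs)
  show ?case
  proof (induction g rule: free_alg_induct)
    case (mono d ys)
    show ?case by (simp add: mono_of_append[symmetric] subst_alg_scale subst_alg_mono)
  qed (simp_all add: subst_alg_add algebra_simps del: scale_mult_left)
qed (simp_all add: subst_alg_add algebra_simps)

lemmas subst_alg_simps = subst_alg_add subst_alg_diff subst_alg_scale subst_alg_mult subst_alg_uminus

text \<open>
  The letters generate the free algebra, so an endomorphism is the substitution of its values on them.
\<close>

lemma subst_alg_unique: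
  assumes lin: "Vector_Spaces.linear scale scale \<theta>" and one: "\<theta> 1 = 1"
    and mult: "\<And>f g. \<theta> (f * g) = \<theta> f * \<theta> g"
  shows "\<theta> f = subst_alg (\<lambda>x. \<theta> (var x)) f"
proof (induction f rule: free_alg_induct)
  case zero
  show ?case using module_hom.zero[OF linear_module_hom[OF lin]] by simp
next
  case (add f g)
  then show ?case using module_hom.add[OF linear_module_hom[OF lin]] by (simp add: subst_alg_add)
next
  case (mono c xs)
  have "\<theta> (mono_of xs) = subst_alg (\<lambda>x. \<theta> (var x)) (mono_of xs)"
    by (induction xs) (simp_all add: one mono_of_Cons mult subst_alg_mult)
  then show ?case using module_hom.scale[OF linear_module_hom[OF lin]] by (simp add: subst_alg_scale)
qed

lemma subst_alg_comp: "subst_alg \<rho> (subst_alg \<rho>' f) = subst_alg (\<lambda>x. subst_alg \<rho> (\<rho>' x)) f"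
proof -
  have "Vector_Spaces.linear scale scale (subst_alg \<rho> \<circ> subst_alg \<rho>')"
    by (rule Vector_Spaces.linear_compose[OF linear_subst_alg linear_subst_alg])
  from subst_alg_unique[OF this] show ?thesis by (simp add: subst_alg_mult)
qed

lemma subst_alg_id: "subst_alg var f = f"
proof -
  have "Vector_Spaces.linear scale scale (\<lambda>f::'a free_alg. f)"
    by (rule free_alg.linear_ident)
  from subst_alg_unique[OF this] show ?thesis by simp
qed

lemma subst_alg_cong:
  assumes "\<And>w x. w \<in> keys f \<Longrightarrow> x \<in> set (letters w) \<Longrightarrow> \<rho> x = \<rho>' x"
  shows "subst_alg \<rho> f = subst_alg \<rho>' f"
  unfolding subst_alg_def using assms by (auto intro!: sum.cong arg_cong[of _ _ prod_list])

subsection \<open>Parity\<close>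

definition even_poly :: "'k::field free_alg \<Rightarrow> bool" where "even_poly f \<longleftrightarrow> free_aut f = f"
definition odd_poly :: "'k::field free_alg \<Rightarrow> bool" where "odd_poly f \<longleftrightarrow> free_aut f = - f"

text \<open>
  Commuting with the automorphism of the free superalgebra amounts to sending each variable to a
  homogeneous element of its own parity, so T2-ideals are the ideals that are closed under these
  substitutions.
\<close>

definition graded_subst :: "(letter \<Rightarrow> 'k::field free_alg) \<Rightarrow> bool"
  where "graded_subst \<rho> \<longleftrightarrow> (\<forall>i. even_poly (\<rho> (Y i)) \<and> odd_poly (\<rho> (Z i)))"

lemma linear_free_aut: "Vector_Spaces.linear scale scale free_aut"
  unfolding free_aut_def by (rule linear_subst_alg)

lemmas free_aut_zero [simp] = module_hom.zero[OF linear_module_hom[OF linear_free_aut]]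
  and free_aut_diff = module_hom.diff[OF linear_module_hom[OF linear_free_aut]]
  and free_aut_uminus = module_hom.neg[OF linear_module_hom[OF linear_free_aut]]
  and free_aut_add = module_hom.add[OF linear_module_hom[OF linear_free_aut]]
  and free_aut_scale = module_hom.scale[OF linear_module_hom[OF linear_free_aut]]
  and free_aut_sum = module_hom.sum[OF linear_module_hom[OF linear_free_aut]]

lemma free_aut_mult: "free_aut (f * g) = free_aut f * free_aut g"
  unfolding free_aut_def by (rule subst_alg_mult)

lemma free_aut_one [simp]: "free_aut 1 = 1"
  unfolding free_aut_def by simp

lemma free_aut_Y [simp]: "free_aut (var (Y i)) = var (Y i)"
  and free_aut_Z [simp]: "free_aut (var (Z i)) = - var (Z i)"
  unfolding free_aut_def by simp_all

lemma free_aut_free_aut [simp]: "free_aut (free_aut f) = f"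
proof -
  have "(\<lambda>x. subst_alg (\<lambda>x. case x of Y i \<Rightarrow> var (Y i) | Z i \<Rightarrow> - var (Z i))
      (case x of Y i \<Rightarrow> var (Y i) | Z i \<Rightarrow> - var (Z i)))
    = (var :: letter \<Rightarrow> 'a free_alg)"
    by (auto simp: subst_alg_uminus split: letter.split)
  then show ?thesis unfolding free_aut_def subst_alg_comp by (simp add: subst_alg_id)
qed

lemma even_var_Y [simp]: "even_poly (var (Y i))" and odd_var_Z [simp]: "odd_poly (var (Z i))"
  and even_one [simp]: "even_poly 1" and even_zero [simp]: "even_poly 0" and odd_zero [simp]: "odd_poly 0"
  by (simp_all add: even_poly_def odd_poly_def)

lemma parity_add: "even_poly f \<Longrightarrow> even_poly g \<Longrightarrow> even_poly (f + g)"
  "odd_poly f \<Longrightarrow> odd_poly g \<Longrightarrow> odd_poly (f + g)"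
  by (simp_all add: even_poly_def odd_poly_def free_aut_add)

lemma parity_scale: "even_poly f \<Longrightarrow> even_poly (scale c f)" "odd_poly f \<Longrightarrow> odd_poly (scale c f)"
  by (simp_all add: even_poly_def odd_poly_def free_aut_scale)

lemma parity_mult [simp]: "even_poly f \<Longrightarrow> even_poly g \<Longrightarrow> even_poly (f * g)"
  "odd_poly f \<Longrightarrow> odd_poly g \<Longrightarrow> even_poly (f * g)"
  "even_poly f \<Longrightarrow> odd_poly g \<Longrightarrow> odd_poly (f * g)" "odd_poly f \<Longrightarrow> even_poly g \<Longrightarrow> odd_poly (f * g)"
  by (simp_all add: even_poly_def odd_poly_def free_aut_mult)

lemma free_aut_subst_alg:
  assumes "graded_subst \<rho>"
  shows "free_aut (subst_alg \<rho> f) = subst_alg \<rho> (free_aut f)"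
proof -
  have "free_aut (\<rho> x) = subst_alg \<rho> (case x of Y i \<Rightarrow> var (Y i) | Z i \<Rightarrow> - var (Z i))" for x
    using assms by (cases x) (simp_all add: graded_subst_def even_poly_def odd_poly_def subst_alg_uminus)
  from this[unfolded free_aut_def] show ?thesis unfolding free_aut_def subst_alg_comp by simp
qed

lemma graded_endo_subst_alg:
  assumes "graded_subst \<rho>"
  shows "graded_endo (subst_alg \<rho>)"
  unfolding graded_endo_def
  using linear_subst_alg subst_alg_mult free_aut_subst_alg[OF assms] by auto

lemma graded_endo_imp_subst_alg:
  assumes "graded_endo \<theta>"
  obtains \<rho> where "graded_subst \<rho>" "\<theta> = subst_alg \<rho>"
proof
  show "\<theta> = subst_alg (\<lambda>x. \<theta> (var x))"
    using assms subst_alg_unique unfolding graded_endo_def by blast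
  have "\<theta> (- var x) = - \<theta> (var x)" for x
    using assms module_hom.neg[OF linear_module_hom] unfolding graded_endo_def by blast
  moreover have "free_aut (\<theta> f) = \<theta> (free_aut f)" for f
    using assms unfolding graded_endo_def by simp
  ultimately show "graded_subst (\<lambda>x. \<theta> (var x))"
    unfolding graded_subst_def even_poly_def odd_poly_def by simp
qed

subsection \<open>Closure properties of T2-ideals\<close>

lemma T2_idealI:
  assumes "free_alg.subspace I" "\<And>f g. f \<in> I \<Longrightarrow> g * f \<in> I" "\<And>f g. f \<in> I \<Longrightarrow> f * g \<in> I"
    "\<And>f \<rho>. f \<in> I \<Longrightarrow> graded_subst \<rho> \<Longrightarrow> subst_alg \<rho> f \<in> I"
  shows "T2_ideal I"
  unfolding T2_ideal_def using assms by (auto elim!: graded_endo_imp_subst_alg)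

context
  fixes I :: "'k::field free_alg set"
  assumes I: "T2_ideal I"
begin

lemma T2_subspace: "free_alg.subspace I" using I unfolding T2_ideal_def by blast

lemmas T2_zero = free_alg.subspace_0[OF T2_subspace]
  and T2_add = free_alg.subspace_add[OF T2_subspace]
  and T2_diff = free_alg.subspace_diff[OF T2_subspace]
  and T2_neg = free_alg.subspace_neg[OF T2_subspace]
  and T2_scale = free_alg.subspace_scale[OF T2_subspace]
  and T2_sum = free_alg.subspace_sum[OF T2_subspace]

lemma T2_mult: "f \<in> I \<Longrightarrow> g * f \<in> I" "f \<in> I \<Longrightarrow> f * g \<in> I"
  using I unfolding T2_ideal_def by blast+

lemma T2_subst: "f \<in> I \<Longrightarrow> graded_subst \<rho> \<Longrightarrow> subst_alg \<rho> f \<in> I"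
  using I graded_endo_subst_alg unfolding T2_ideal_def by blast

lemma T2_free_aut: "f \<in> I \<Longrightarrow> free_aut f \<in> I"
  unfolding free_aut_def by (rule T2_subst)
    (auto simp: graded_subst_def even_poly_def odd_poly_def free_aut_uminus)

lemma T2_gen_subset: "S \<subseteq> I \<Longrightarrow> T2_gen S \<subseteq> I"
  unfolding T2_gen_def using I by blast

lemma T2_scale_cancel: "c \<noteq> 0 \<Longrightarrow> scale c f \<in> I \<longleftrightarrow> f \<in> I"
  using T2_scale[of "scale c f" "inverse c"] T2_scale[of f c] by auto

end

section \<open>Graded identities form a T2-ideal\<close>

context superalgebra
begin

lemma scalar_closed [simp]: "(c::'k) \<in> carrier ring_of_type_algebra"
  by (simp add: ring_of_type_algebra_def)

lemma scalar_ops [simp]: "(c::'k) \<oplus>\<^bsub>ring_of_type_algebra\<^esub> d = c + d"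
  "(c::'k) \<otimes>\<^bsub>ring_of_type_algebra\<^esub> d = c * d"
  "\<zero>\<^bsub>ring_of_type_algebra\<^esub> = (0::'k)" "\<one>\<^bsub>ring_of_type_algebra\<^esub> = (1::'k)"
  by (simp_all add: ring_of_type_algebra_def)

definition respects_parity :: "(letter \<Rightarrow> 'a) \<Rightarrow> bool"
  where "respects_parity \<rho> \<longleftrightarrow> (\<forall>i. \<rho> (Y i) \<in> even_part A \<phi>) \<and> (\<forall>i. \<rho> (Z i) \<in> odd_part A \<phi>)"

abbreviation word_prod :: "(letter \<Rightarrow> 'a) \<Rightarrow> letter list \<Rightarrow> 'a"
  where "word_prod \<rho> xs \<equiv> foldr (\<lambda>x r. \<rho> x \<otimes>\<^bsub>A\<^esub> r) xs \<one>\<^bsub>A\<^esub>"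

lemma respects_parity_closed: "respects_parity \<rho> \<Longrightarrow> \<rho> x \<in> carrier A"
  unfolding respects_parity_def even_part_def odd_part_def by (cases x) auto

context
  fixes \<rho> :: "letter \<Rightarrow> 'a"
  assumes \<rho>: "\<And>x. \<rho> x \<in> carrier A"
begin

lemma word_prod_closed [simp]: "word_prod \<rho> xs \<in> carrier A"
  by (induction xs) (auto simp: \<rho>)

lemma word_prod_append: "word_prod \<rho> (xs @ ys) = word_prod \<rho> xs \<otimes>\<^bsub>A\<^esub> word_prod \<rho> ys"
  by (induction xs) (auto simp: \<rho> m_assoc)

lemma eval_in_superset:
  assumes "finite S" "keys f \<subseteq> S"
  shows "eval_in A \<rho> f = (\<Oplus>\<^bsub>A\<^esub>w\<in>S. lookup f w \<odot>\<^bsub>A\<^esub> word_prod \<rho> (letters w))"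
  unfolding eval_in_def using assms
  by (intro add.finprod_mono_neutral_cong_left) (auto simp: in_keys_iff smult_l_null[simplified])

lemma eval_in_closed [simp]: "eval_in A \<rho> f \<in> carrier A"
  unfolding eval_in_def by (intro finsum_closed) auto

lemma eval_in_add: "eval_in A \<rho> (f + g) = eval_in A \<rho> f \<oplus>\<^bsub>A\<^esub> eval_in A \<rho> g"
proof -
  have fin: "finite (keys f \<union> keys g)" by simp
  note sup = eval_in_superset[OF fin]
  show ?thesis
    unfolding sup[OF keys_add] sup[OF Un_upper1] sup[OF Un_upper2]
    by (subst finsum_addf[symmetric]) (auto simp: lookup_add smult_l_distr[simplified])
qed

lemma eval_in_scale: "eval_in A \<rho> (scale c f) = c \<odot>\<^bsub>A\<^esub> eval_in A \<rho> f"
proof -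
  have "keys (scale c f) \<subseteq> keys f" by (auto simp: in_keys_iff lookup_scale)
  note sup = eval_in_superset[OF finite_keys[of f] this] eval_in_superset[OF finite_keys[of f] subset_refl]
  show ?thesis
    unfolding sup
    by (simp add: finsum_smult_ldistr Pi_def lookup_scale smult_assoc1[simplified])
qed

lemma eval_in_zero [simp]: "eval_in A \<rho> 0 = \<zero>\<^bsub>A\<^esub>"
  by (simp add: eval_in_def)

lemma eval_in_mono: "eval_in A \<rho> (mono_of xs) = word_prod \<rho> xs"
  by (simp add: eval_in_def) (simp add: mono_of_def smult_one[simplified])

lemma eval_in_one [simp]: "eval_in A \<rho> 1 = \<one>\<^bsub>A\<^esub>"
  using eval_in_mono[of "[]"] by simp

lemma eval_in_var [simp]: "eval_in A \<rho> (var x) = \<rho> x"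
  using eval_in_mono[of "[x]"] \<rho> by (simp add: var_def)

lemma eval_in_mult: "eval_in A \<rho> (f * g) = eval_in A \<rho> f \<otimes>\<^bsub>A\<^esub> eval_in A \<rho> g"
proof (induction f rule: free_alg_induct)
  case (mono c xs)
  show ?case
  proof (induction g rule: free_alg_induct)
    case (mono d ys)
    show ?case
      by (simp add: mono_of_append[symmetric] eval_in_scale eval_in_mono word_prod_append
          smult_mult_left smult_mult_right smult_assoc1[simplified, symmetric] mult.commute del: foldr_append)
  qed (simp_all add: eval_in_add algebra_simps r_distr del: scale_mult_left)
qed (simp_all add: eval_in_add algebra_simps l_distr)

lemma eval_in_uminus: "eval_in A \<rho> (- f) = \<ominus>\<^bsub>A\<^esub> eval_in A \<rho> f"
  using eval_in_add[of "- f" f] by (simp add: minus_equality)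

end

lemma \<phi>_closed [simp]: "x \<in> carrier A \<Longrightarrow> \<phi> x \<in> carrier A"
  and \<phi>_add: "x \<in> carrier A \<Longrightarrow> y \<in> carrier A \<Longrightarrow> \<phi> (x \<oplus>\<^bsub>A\<^esub> y) = \<phi> x \<oplus>\<^bsub>A\<^esub> \<phi> y"
  and \<phi>_mult: "x \<in> carrier A \<Longrightarrow> y \<in> carrier A \<Longrightarrow> \<phi> (x \<otimes>\<^bsub>A\<^esub> y) = \<phi> x \<otimes>\<^bsub>A\<^esub> \<phi> y"
  and \<phi>_one [simp]: "\<phi> \<one>\<^bsub>A\<^esub> = \<one>\<^bsub>A\<^esub>"
  using aut_ring_iso by (auto simp: ring_iso_def ring_hom_def)

lemma \<phi>_zero [simp]: "\<phi> \<zero>\<^bsub>A\<^esub> = \<zero>\<^bsub>A\<^esub>"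
  using aut_smult[of "\<zero>\<^bsub>A\<^esub>" 0] smult_l_null[of "\<zero>\<^bsub>A\<^esub>"] smult_l_null[of "\<phi> \<zero>\<^bsub>A\<^esub>"] by simp

lemma \<phi>_eval_in:
  assumes \<rho>: "respects_parity \<rho>"
  shows "\<phi> (eval_in A \<rho> f) = eval_in A \<rho> (free_aut f)"
proof (induction f rule: free_alg_induct)
  case zero
  show ?case by (simp add: eval_in_def)
next
  case (add f g)
  then show ?case
    by (simp add: free_aut_add eval_in_add respects_parity_closed[OF \<rho>] \<phi>_add)
next
  case (mono c xs)
  note [simp] = respects_parity_closed[OF \<rho>]
  have var: "\<phi> (\<rho> x) = eval_in A \<rho> (free_aut (var x))" for x
    using \<rho> by (cases x) (auto simp: respects_parity_def even_part_def odd_part_def eval_in_uminus)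
  have "\<phi> (eval_in A \<rho> (mono_of xs)) = eval_in A \<rho> (free_aut (mono_of xs))"
    by (induction xs) (auto simp: mono_of_Cons free_aut_mult eval_in_mult \<phi>_mult var)
  then show ?case by (simp add: free_aut_scale eval_in_scale aut_smult)
qed

lemma eval_in_subst:
  assumes \<rho>: "\<And>x. \<rho> x \<in> carrier A"
  shows "eval_in A \<rho> (subst_alg \<tau> f) = eval_in A (\<lambda>x. eval_in A \<rho> (\<tau> x)) f"
proof (induction f rule: free_alg_induct)
  case (mono c xs)
  have "eval_in A \<rho> (subst_alg \<tau> (mono_of xs)) = eval_in A (\<lambda>x. eval_in A \<rho> (\<tau> x)) (mono_of xs)"
    by (induction xs) (auto simp: \<rho> mono_of_Cons subst_alg_mult eval_in_mult)
  then show ?case by (simp add: subst_alg_scale eval_in_scale \<rho>)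
qed (simp_all add: \<rho> subst_alg_add eval_in_add)

lemma graded_ids_iff:
  "f \<in> graded_ids A \<phi> \<longleftrightarrow> (\<forall>\<rho>. respects_parity \<rho> \<longrightarrow> eval_in A \<rho> f = \<zero>\<^bsub>A\<^esub>)"
  unfolding graded_ids_def respects_parity_def by simp

text \<open>
  Evaluating a graded substitution at homogeneous elements again assigns homogeneous elements of the
  right parity to the variables.
\<close>

theorem T2_ideal_graded_ids: "T2_ideal (graded_ids A \<phi>)"
proof (rule T2_idealI)
  note cl = respects_parity_closed
  show "free_alg.subspace (graded_ids A \<phi>)"
    unfolding free_alg.subspace_def
    by (auto simp: graded_ids_iff eval_in_add eval_in_scale cl smult_r_null[simplified])
  fix f g :: "'k free_alg" and \<rho>
  assume f: "f \<in> graded_ids A \<phi>"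
  show "g * f \<in> graded_ids A \<phi>" "f * g \<in> graded_ids A \<phi>"
    using f by (auto simp: graded_ids_iff eval_in_mult cl)
  fix \<tau> :: "letter \<Rightarrow> 'k free_alg"
  assume \<tau>: "graded_subst \<tau>"
  have "respects_parity (\<lambda>x. eval_in A \<rho> (\<tau> x))" if "respects_parity \<rho>" for \<rho>
    unfolding respects_parity_def even_part_def odd_part_def
    using \<tau> by (auto simp: cl[OF that] \<phi>_eval_in[OF that] graded_subst_def even_poly_def odd_poly_def
        eval_in_uminus)
  then show "subst_alg \<tau> f \<in> graded_ids A \<phi>"
    using f by (auto simp: graded_ids_iff eval_in_subst cl)
qed

end

section \<open>Every T2-ideal is the ideal of graded identities of a superalgebra\<close>

definition coset :: "'k::field free_alg set \<Rightarrow> 'k free_alg \<Rightarrow> 'k free_alg set"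
  where "coset I f = {g. g - f \<in> I}"

definition coset_rep :: "'k::field free_alg set \<Rightarrow> 'k free_alg"
  where "coset_rep U = (SOME f. f \<in> U)"

text \<open>
  The relatively free superalgebra of a T2-ideal. Its elements are the cosets themselves, and the
  operations work on arbitrary representatives; they are well defined because \<open>I\<close> is an ideal.
\<close>

definition rel_free :: "'k::field free_alg set \<Rightarrow> ('k, 'k free_alg set) module"
  where "rel_free I =
    \<lparr>carrier = range (coset I), monoid.mult = (\<lambda>U V. coset I (coset_rep U * coset_rep V)),
     monoid.one = coset I 1, ring.zero = coset I 0, ring.add = (\<lambda>U V. coset I (coset_rep U + coset_rep V)),
     module.smult = (\<lambda>c U. coset I (scale c (coset_rep U)))\<rparr>"

definition rel_free_aut :: "'k::field free_alg set \<Rightarrow> 'k free_alg set \<Rightarrow> 'k free_alg set"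
  where "rel_free_aut I U = coset I (free_aut (coset_rep U))"

context
  fixes I :: "'k::field_char_0 free_alg set"
  assumes I: "T2_ideal I"
begin

lemma coset_eq_iff: "coset I f = coset I g \<longleftrightarrow> f - g \<in> I"
proof
  assume "coset I f = coset I g"
  moreover have "f \<in> coset I f" using T2_zero[OF I] by (simp add: coset_def)
  ultimately show "f - g \<in> I" by (auto simp: coset_def)
next
  assume h: "f - g \<in> I"
  have "h - f \<in> I \<longleftrightarrow> h - g \<in> I" for h
    using T2_add[OF I, of "h - f" "f - g"] T2_diff[OF I, of "h - g" "f - g"] h by auto
  then show "coset I f = coset I g" by (auto simp: coset_def)
qed

lemma coset_rep_diff: "coset_rep (coset I f) - f \<in> I"
proof -
  have "f \<in> coset I f" using T2_zero[OF I] by (simp add: coset_def)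
  then have "coset_rep (coset I f) \<in> coset I f" unfolding coset_rep_def by (rule someI)
  then show ?thesis by (simp add: coset_def)
qed

lemma rel_free_carrier: "carrier (rel_free I) = range (coset I)"
  and rel_free_one: "\<one>\<^bsub>rel_free I\<^esub> = coset I 1"
  and rel_free_zero: "\<zero>\<^bsub>rel_free I\<^esub> = coset I 0"
  by (simp_all add: rel_free_def)

lemma rel_free_add: "coset I f \<oplus>\<^bsub>rel_free I\<^esub> coset I g = coset I (f + g)"
  using T2_add[OF I coset_rep_diff[of f] coset_rep_diff[of g]]
  by (simp add: rel_free_def coset_eq_iff algebra_simps)

lemma rel_free_mult: "coset I f \<otimes>\<^bsub>rel_free I\<^esub> coset I g = coset I (f * g)"
proof -
  let ?f = "coset_rep (coset I f)" and ?g = "coset_rep (coset I g)"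
  have "(?f - f) * ?g + f * (?g - g) \<in> I"
    using coset_rep_diff I by (intro T2_add T2_mult)
  then show ?thesis by (simp add: rel_free_def coset_eq_iff algebra_simps)
qed

lemma rel_free_smult: "c \<odot>\<^bsub>rel_free I\<^esub> coset I f = coset I (scale c f)"
  using T2_scale[OF I coset_rep_diff[of f], of c]
  by (simp add: rel_free_def coset_eq_iff free_alg.scale_right_diff_distrib)

lemma rel_free_aut: "rel_free_aut I (coset I f) = coset I (free_aut f)"
  using T2_free_aut[OF I coset_rep_diff[of f]]
  by (simp add: rel_free_aut_def coset_eq_iff free_aut_diff)

lemmas rel_free_ops = rel_free_carrier rel_free_one rel_free_zero rel_free_add rel_free_mult
  rel_free_smult rel_free_aut

lemma rel_free_superalgebra: "superalgebra (rel_free I) (rel_free_aut I)"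
proof -
  have ring: "ring (rel_free I)"
  proof (rule ringI)
    show "abelian_group (rel_free I)"
    proof (rule abelian_groupI)
      fix x assume "x \<in> carrier (rel_free I)"
      then obtain f where f: "x = coset I f" by (auto simp: rel_free_ops)
      show "\<exists>y\<in>carrier (rel_free I). y \<oplus>\<^bsub>rel_free I\<^esub> x = \<zero>\<^bsub>rel_free I\<^esub>"
        by (rule bexI[of _ "coset I (- f)"]) (auto simp: f rel_free_ops)
    qed (auto simp: rel_free_ops algebra_simps)
    show "monoid (rel_free I)"
      by (rule monoidI) (auto simp: rel_free_ops algebra_simps)
  qed (auto simp: rel_free_ops algebra_simps)
  interpret ring "rel_free I" by (rule ring)
  have mod: "module (ring_of_type_algebra :: 'k ring) (rel_free I)"
    by (rule moduleI)
      (auto simp: rel_free_ops ring_of_type_algebra_def free_alg.scale_left_distrib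
         free_alg.scale_right_distrib abelian_group_axioms
         intro: cring_from_type_algebra[unfolded ring_of_type_algebra_def])
  have inv: "rel_free_aut I (rel_free_aut I x) = x" if "x \<in> carrier (rel_free I)" for x
    using that by (auto simp: rel_free_ops)
  have cl: "rel_free_aut I x \<in> carrier (rel_free I)" if "x \<in> carrier (rel_free I)" for x
    using that by (auto simp: rel_free_ops)
  have "rel_free_aut I \<in> ring_iso (rel_free I) (rel_free I)"
  proof (rule ring_iso_memI)
    show "bij_betw (rel_free_aut I) (carrier (rel_free I)) (carrier (rel_free I))"
      using inv cl by (intro bij_betw_byWitness[where f' = "rel_free_aut I"]) auto
  qed (auto simp: rel_free_ops free_aut_mult free_aut_add)
  then show ?thesis
    using mod ring inv
    by (intro superalgebra.intro superalgebra_axioms.intro) (auto simp: rel_free_ops free_aut_scale)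
qed

text \<open>
  An assignment of homogeneous cosets lifts to a graded substitution, and evaluating a polynomial of \<open>I\<close>
  yields the coset of its image under this substitution. Conversely, a polynomial is recovered up to
  \<open>I\<close> by evaluating it at the cosets of the variables.
\<close>

lemma rel_free_graded_ids: "graded_ids (rel_free I) (rel_free_aut I) = I"
proof -
  interpret superalgebra "rel_free I" "rel_free_aut I" by (rule rel_free_superalgebra)
  have neg: "\<ominus>\<^bsub>rel_free I\<^esub> coset I f = coset I (- f)" for f
    by (rule minus_equality) (auto simp: rel_free_ops)
  have eval: "eval_in (rel_free I) (\<lambda>x. coset I (\<tau> x)) f = coset I (subst_alg \<tau> f)" for \<tau> f
  proof -
    have cl: "coset I (\<tau> x) \<in> carrier (rel_free I)" for x by (simp add: rel_free_ops)
    show ?thesis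
    proof (induction f rule: free_alg_induct)
      case (mono c xs)
      have "eval_in (rel_free I) (\<lambda>x. coset I (\<tau> x)) (mono_of xs) = coset I (subst_alg \<tau> (mono_of xs))"
        by (induction xs) (auto simp: cl mono_of_Cons subst_alg_mult eval_in_mult rel_free_ops)
      then show ?case by (simp add: subst_alg_scale eval_in_scale cl rel_free_ops)
    qed (auto simp: cl subst_alg_add eval_in_add rel_free_ops)
  qed
  show ?thesis
  proof (intro subset_antisym subsetI)
    fix f assume f: "f \<in> graded_ids (rel_free I) (rel_free_aut I)"
    have "respects_parity (\<lambda>x. coset I (var x))"
      unfolding respects_parity_def even_part_def odd_part_def
      by (auto simp: rel_free_ops neg)
    then have "coset I (subst_alg var f) = \<zero>\<^bsub>rel_free I\<^esub>"
      using f eval[of var f] by (simp add: graded_ids_iff)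
    then show "f \<in> I" by (simp add: subst_alg_id rel_free_ops coset_eq_iff)
  next
    fix f assume f: "f \<in> I"
    show "f \<in> graded_ids (rel_free I) (rel_free_aut I)"
      unfolding graded_ids_iff
    proof (intro allI impI)
      fix \<rho> assume \<rho>: "respects_parity \<rho>"
      \<comment> \<open>Symmetrizing an arbitrary representative of a homogeneous coset gives a homogeneous one.\<close>
      define \<tau> where "\<tau> x = (let h = coset_rep (\<rho> x) in
        case x of Y i \<Rightarrow> scale (1/2) (h + free_aut h) | Z i \<Rightarrow> scale (1/2) (h - free_aut h))" for x
      have rep: "\<rho> x = coset I (coset_rep (\<rho> x))" for x
      proof -
        obtain h where h: "\<rho> x = coset I h" using respects_parity_closed[OF \<rho>, of x] by (auto simp: rel_free_ops)
        then show ?thesis using coset_rep_diff[of h] by (simp add: coset_eq_iff T2_neg[OF I, of "_ - _", simplified])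
      qed
      have "\<rho> x = coset I (\<tau> x)" for x
      proof (cases x)
        case (Y i)
        define h where "h = coset_rep (\<rho> (Y i))"
        have "coset I (free_aut h) = coset I h"
          using \<rho> rep[of "Y i"] rel_free_aut[of h]
          by (auto simp: respects_parity_def even_part_def h_def)
        then have "free_aut h - h \<in> I" by (simp add: coset_eq_iff)
        then have "scale (1/2) (free_aut h - h) \<in> I" by (rule T2_scale[OF I])
        moreover have "\<tau> x - h = scale (1/2) (free_aut h - h)"
          unfolding \<tau>_def Y Let_def h_def[symmetric]
          by (rule poly_mapping_eqI) (simp add: lookup_scale lookup_add lookup_minus algebra_simps)
        ultimately have "coset I (\<tau> x) = coset I h" by (simp add: coset_eq_iff)
        then show ?thesis using rep[of x] by (simp add: h_def Y)
      next
        case (Z i)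
        define h where "h = coset_rep (\<rho> (Z i))"
        have "coset I (free_aut h) = coset I (- h)"
          using \<rho> rep[of "Z i"] rel_free_aut[of h] neg[of h]
          by (auto simp: respects_parity_def odd_part_def h_def)
        then have "free_aut h + h \<in> I" by (simp add: coset_eq_iff)
        then have "scale (-1/2) (free_aut h + h) \<in> I" by (rule T2_scale[OF I])
        moreover have "\<tau> x - h = scale (-1/2) (free_aut h + h)"
          unfolding \<tau>_def Z Let_def letter.case h_def[symmetric]
          by (rule poly_mapping_eqI) (simp add: lookup_scale lookup_add lookup_minus algebra_simps)
        ultimately have "coset I (\<tau> x) = coset I h" by (simp add: coset_eq_iff)
        then show ?thesis using rep[of x] by (simp add: h_def Z)
      qed
      then have "\<rho> = (\<lambda>x. coset I (\<tau> x))" by blast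
      moreover have "graded_subst \<tau>"
        unfolding graded_subst_def even_poly_def odd_poly_def \<tau>_def Let_def
        by (simp add: free_aut_scale free_aut_add free_aut_diff add.commute
            free_alg.scale_minus_right[symmetric] del: free_alg.scale_minus_right)
      then have "subst_alg \<tau> f \<in> I" using f by (intro T2_subst[OF I])
      ultimately show "eval_in (rel_free I) \<rho> f = \<zero>\<^bsub>rel_free I\<^esub>"
        by (simp add: eval rel_free_ops coset_eq_iff)
    qed
  qed
qed

end

section \<open>Codimensions from proper multilinear polynomials\<close>

text \<open>
  A multidegree is given by the finite set \<open>L\<close> of the letters that occur, each exactly once.
\<close>

definition ml_words :: "letter set \<Rightarrow> word set"
  where "ml_words L = {Word xs | xs. distinct xs \<and> set xs = L}"

definition mlin :: "letter set \<Rightarrow> 'k::field free_alg set"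
  where "mlin L = {f. keys f \<subseteq> ml_words L}"

definition restr :: "letter set \<Rightarrow> 'k::field free_alg \<Rightarrow> 'k free_alg"
  where "restr L = subst_alg (\<lambda>x. if x \<in> L then var x else 0)"

definition erase_Y :: "nat \<Rightarrow> 'k::field free_alg \<Rightarrow> 'k free_alg"
  where "erase_Y j = subst_alg (\<lambda>x. if x = Y j then 1 else var x)"

text \<open>
  A multilinear polynomial is Y-proper if and only if it vanishes whenever one of its even variables
  is replaced by 1. This description is easier to compute with than the one by generators. The index set
  \<open>R\<close> of the variables for which the condition is imposed grows in the induction that
  splits off the variables one at a time.
\<close>

definition proper_on :: "nat set \<Rightarrow> letter set \<Rightarrow> 'k::field free_alg set"
  where "proper_on R L = {f \<in> mlin L. \<forall>j\<in>R. erase_Y j f = 0}"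

definition proper :: "letter set \<Rightarrow> 'k::field free_alg set"
  where "proper L = proper_on {j. Y j \<in> L} L"

lemma subspace_keys: "free_alg.subspace {f :: 'k::field free_alg. keys f \<subseteq> W}"
proof -
  have "keys (f + g) \<subseteq> W" if "keys f \<subseteq> W" "keys g \<subseteq> W"
    for f g :: "'k free_alg" using keys_add[of f g] that by blast
  moreover have "keys (scale c f) \<subseteq> W" if "keys f \<subseteq> W" for c :: 'k and f
    using that by (auto simp: in_keys_iff lookup_scale)
  ultimately show ?thesis unfolding free_alg.subspace_def by simp
qed

lemma fin_space_keys:
  assumes "finite W"
  shows "fin_space {f :: 'k::field free_alg. keys f \<subseteq> W}"
  unfolding fin_space_def
proof (intro conjI subspace_keys exI subsetI)
  show "finite ((\<lambda>w. mono_of (letters w) :: 'k free_alg) ` W)" using assms by simp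
  fix f :: "'k free_alg" assume "f \<in> {f. keys f \<subseteq> W}"
  then have "(\<Sum>w\<in>keys f. scale (lookup f w) (mono_of (letters w)))
      \<in> free_alg.span ((\<lambda>w. mono_of (letters w)) ` W)"
    by (intro free_alg.span_sum free_alg.span_scale free_alg.span_base) auto
  then show "f \<in> free_alg.span ((\<lambda>w. mono_of (letters w)) ` W)" using free_alg_expand[of f] by simp
qed

lemma finite_ml_words: "finite L \<Longrightarrow> finite (ml_words L)"
proof -
  assume "finite L"
  then have "finite (Word ` {xs. set xs \<subseteq> L \<and> distinct xs})"
    by (intro finite_imageI finite_subset_distinct)
  then show ?thesis by (rule rev_finite_subset) (auto simp: ml_words_def)
qed

lemma subspace_mlin: "free_alg.subspace (mlin L)"
  unfolding mlin_def by (rule subspace_keys)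

lemma fin_space_mlin: "finite L \<Longrightarrow> fin_space (mlin L)"
  unfolding mlin_def by (intro fin_space_keys finite_ml_words)

lemma mono_of_in_mlin: "distinct xs \<Longrightarrow> set xs = L \<Longrightarrow> mono_of xs \<in> mlin L"
  by (auto simp: mlin_def ml_words_def)

lemma mlin_linear_image:
  assumes f: "f \<in> mlin L" and lin: "Vector_Spaces.linear scale scale d" and S: "free_alg.subspace S"
    and mono: "\<And>xs. distinct xs \<Longrightarrow> set xs = L \<Longrightarrow> d (mono_of xs) \<in> S"
  shows "d f \<in> S"
proof -
  note hom = linear_module_hom[OF lin]
  have "d f = (\<Sum>w\<in>keys f. scale (lookup f w) (d (mono_of (letters w))))"
    by (subst free_alg_expand[of f]) (simp add: module_hom.sum[OF hom] module_hom.scale[OF hom])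
  also have "\<dots> \<in> S"
  proof (intro free_alg.subspace_sum[OF S] free_alg.subspace_scale[OF S])
    fix w assume "w \<in> keys f"
    then obtain xs where "w = Word xs" "distinct xs" "set xs = L"
      using f by (auto simp: mlin_def ml_words_def)
    then show "d (mono_of (letters w)) \<in> S" by (simp add: mono)
  qed
  finally show ?thesis .
qed

subsection \<open>Decomposition by multidegree\<close>

lemma restr_mono: "restr L (mono_of xs) = (if set xs \<subseteq> L then mono_of xs else 0)"
  unfolding restr_def by (induction xs) (auto simp: mono_of_Cons subst_alg_mult)

lemma linear_restr: "Vector_Spaces.linear scale scale (restr L)"
  unfolding restr_def by (rule linear_subst_alg)

lemma lookup_restr:
  "lookup (restr L f) w = (if set (letters w) \<subseteq> L then lookup f w else 0)"
proof (induction f rule: free_alg_induct)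
  case (mono c xs)
  then show ?case
    by (cases w) (simp add: restr_def subst_alg_scale lookup_scale restr_mono[unfolded restr_def] lookup_mono_of)
qed (simp_all add: restr_def subst_alg_add lookup_add)

lemma graded_subst_restr: "graded_subst (\<lambda>x. if x \<in> L then var x else 0)"
  by (simp add: graded_subst_def)

text \<open>
  Replacing all letters outside \<open>L\<close> by zero is a graded substitution that extracts the component
  of multidegree \<open>L\<close>; no other component survives, because the multidegrees are incomparable. Hence a
  T2-ideal contains the components of its elements.
\<close>

lemma codim_multidegrees:
  fixes I :: "'k::field free_alg set"
  assumes I: "T2_ideal I" and fin: "finite \<L>" "\<And>L. L \<in> \<L> \<Longrightarrow> finite L"
    and anti: "\<And>L L'. L \<in> \<L> \<Longrightarrow> L' \<in> \<L> \<Longrightarrow> L \<subseteq> L' \<Longrightarrow> L = L'"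
  shows "codim {f. keys f \<subseteq> (\<Union>L\<in>\<L>. ml_words L)} I = (\<Sum>L\<in>\<L>. codim (mlin L) I)"
  using assms(2-)
proof (induction \<L> rule: finite_induct)
  case empty
  have "codim {f. keys f \<subseteq> {}} I = 0"
    by (subst codim_eq_0[OF fin_space_keys T2_subspace[OF I]]) (auto intro: T2_zero[OF I])
  then show ?case by simp
next
  case (insert L \<L>)
  let ?V = "\<lambda>\<L>. {f :: 'k free_alg. keys f \<subseteq> (\<Union>L\<in>\<L>. ml_words L)}"
  have IH: "codim (?V \<L>) I = (\<Sum>L\<in>\<L>. codim (mlin L) I)"
    by (rule insert.IH) (use insert.prems in blast)+
  have letters: "set (letters w) = L'" if "w \<in> ml_words L'" for w L'
    using that by (auto simp: ml_words_def)
  have "codim (?V (insert L \<L>)) I = codim (?V \<L>) I + codim (mlin L) I"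
  proof (rule codim_split[where d = "restr L" and s = "\<lambda>f. f"])
    show "fin_space (?V (insert L \<L>))" "fin_space (mlin L)"
      using insert by (auto intro!: fin_space_keys fin_space_mlin finite_ml_words)
    show "free_alg.subspace I" by (rule T2_subspace[OF I])
    show "Vector_Spaces.linear scale scale (restr L)" by (rule linear_restr)
    show "Vector_Spaces.linear scale scale (\<lambda>f. f)" by (rule free_alg.linear_ident)
    show "restr L f \<in> I" if "f \<in> I" for f
      unfolding restr_def by (rule T2_subst[OF I that graded_subst_restr])
    show "restr L f \<in> mlin L" if "f \<in> ?V (insert L \<L>)" for f
    proof -
      have "w \<in> ml_words L" if w: "w \<in> keys (restr L f)" for w
      proof -
        have "set (letters w) \<subseteq> L" "w \<in> keys f"
          using w by (auto simp: in_keys_iff lookup_restr split: if_splits)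
        then obtain L' where "L' \<in> insert L \<L>" "w \<in> ml_words L'" "L' \<subseteq> L"
          using \<open>f \<in> ?V (insert L \<L>)\<close> letters by blast
        then show ?thesis using insert.prems(2)[of L' L] by auto
      qed
      then show ?thesis by (auto simp: mlin_def)
    qed
    show "restr L f = f" if "f \<in> mlin L" for f
      using that letters[of _ L] by (intro poly_mapping_eqI) (auto simp: lookup_restr mlin_def in_keys_iff)
    then show "f \<in> ?V (insert L \<L>)" if "f \<in> mlin L" for f
      using that by (auto simp: mlin_def)
    show "?V \<L> = {f \<in> ?V (insert L \<L>). restr L f = 0}"
    proof (intro subset_antisym subsetI)
      fix f assume f: "f \<in> ?V \<L>"
      have "restr L f = 0"
      proof (rule poly_mapping_eqI)
        fix w show "lookup (restr L f) w = lookup 0 w"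
          unfolding lookup_restr
        proof (cases "set (letters w) \<subseteq> L \<and> w \<in> keys f")
          case True
          then obtain L' where "L' \<in> \<L>" "w \<in> ml_words L'" using f by blast
          then have "L' = L" using insert.prems(2)[of L' L] letters True by auto
          then show "(if set (letters w) \<subseteq> L then lookup f w else 0) = lookup 0 w"
            using \<open>L' \<in> \<L>\<close> insert.hyps by blast
        qed (auto simp: in_keys_iff)
      qed
      then show "f \<in> {f \<in> ?V (insert L \<L>). restr L f = 0}" using f by auto
    next
      fix f assume f: "f \<in> {f \<in> ?V (insert L \<L>). restr L f = 0}"
      have "w \<notin> ml_words L" if "w \<in> keys f" for w
      proof
        assume "w \<in> ml_words L"
        then have "lookup (restr L f) w = lookup f w"
          using letters by (simp add: lookup_restr)
        then show False using f that by (simp add: in_keys_iff)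
      qed
      then show "f \<in> ?V \<L>" using f by blast
    qed
  qed
  then show ?case using insert.hyps IH by simp
qed

text \<open>
  The letters with indices below \<open>n\<close>, where \<open>T\<close> is the set of indices of the odd variables.
\<close>

definition multideg :: "nat \<Rightarrow> nat set \<Rightarrow> letter set"
  where "multideg n T = Y ` ({..<n} - T) \<union> Z ` T"

lemma multilin_keys:
  "multilin n = {f. keys f \<subseteq> (\<Union>T\<in>Pow {..<n}. ml_words (multideg n T))}" (is "_ = ?V")
proof
  show "multilin n \<subseteq> ?V"
    unfolding multilin_def
  proof (rule free_alg.span_minimal[OF _ subspace_keys], rule subsetI)
    fix f :: "'a free_alg"
    assume "f \<in> {mono_of (map (\<lambda>i. v (\<sigma> i)) [0..<n]) | \<sigma> v.
      \<sigma> permutes {..<n} \<and> (\<forall>i<n. v i \<in> {Y i, Z i})}"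
    then obtain p v where f: "f = mono_of (map (\<lambda>i. v (p i)) [0..<n])" and p: "p permutes {..<n}"
      and v: "\<forall>i<n. v i \<in> {Y i, Z i}" by blast
    define T where "T = {i. i < n \<and> v i = Z i}"
    have img: "p ` {..<n} = {..<n}" using p by (rule permutes_image)
    have "set (map (\<lambda>i. v (p i)) [0..<n]) = v ` p ` {..<n}" by (auto simp: image_image)
    also have "\<dots> = multideg n T" unfolding img multideg_def using v by (force simp: T_def)
    finally have set: "set (map (\<lambda>i. v (p i)) [0..<n]) = multideg n T" .
    have "inj_on v {..<n}" using v by (intro inj_onI) (metis insertE letter.distinct(1) letter.inject lessThan_iff singletonD)
    then have "inj_on (v \<circ> p) {..<n}" using img permutes_inj_on[OF p] by (intro comp_inj_on) auto
    then have "distinct (map (\<lambda>i. v (p i)) [0..<n])"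
      by (simp add: distinct_map o_def atLeast0LessThan)
    then have "Word (map (\<lambda>i. v (p i)) [0..<n]) \<in> ml_words (multideg n T)"
      using set unfolding ml_words_def by blast
    moreover have "T \<in> Pow {..<n}" by (auto simp: T_def)
    ultimately show "f \<in> ?V" unfolding f by auto
  qed
next
  show "?V \<subseteq> multilin n"
  proof
    fix f :: "'a free_alg" assume f: "f \<in> ?V"
    have "(\<Sum>w\<in>keys f. scale (lookup f w) (mono_of (letters w))) \<in> multilin n"
      unfolding multilin_def
    proof (intro free_alg.span_sum free_alg.span_scale free_alg.span_base)
      fix w assume "w \<in> keys f"
      then obtain T xs where T: "T \<subseteq> {..<n}" and w: "w = Word xs" and xs: "distinct xs" "set xs = multideg n T"
        using f by (auto simp: ml_words_def)
      define v where "v i = (if i \<in> T then Z i else Y i)" for i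
      define ix where "ix x = (case x of Y i \<Rightarrow> i | Z i \<Rightarrow> i)" for x
      have vix: "v (ix x) = x" if "x \<in> multideg n T" for x
        using that by (auto simp: multideg_def v_def ix_def)
      have ixset: "ix ` multideg n T = {..<n}"
        using T by (force simp: multideg_def ix_def image_Un image_image)
      define js where "js = map ix xs"
      have js: "set js = {..<n}" "distinct js"
        using xs ixset vix by (auto simp: js_def distinct_map intro: inj_on_inverseI)
      have len: "length js = n" using js distinct_card by fastforce
      define p where "p i = (if i < n then js ! i else i)" for i
      have "bij_betw ((!) js) {..<n} {..<n}"
        using js len by (intro bij_betw_nth) simp_all
      then have "bij_betw p {..<n} {..<n}"
        by (rule bij_betw_cong[THEN iffD1, rotated]) (simp add: p_def)
      then have p: "p permutes {..<n}"
        by (rule bij_imp_permutes) (auto simp: p_def)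
      have "map (\<lambda>i. v (p i)) [0..<n] = map v js"
        using len by (intro nth_equalityI) (auto simp: p_def)
      also have "\<dots> = xs" using vix xs unfolding js_def by (auto intro: map_idI)
      finally have "mono_of (letters w) = mono_of (map (\<lambda>i. v (p i)) [0..<n])" by (simp add: w)
      then show "mono_of (letters w) \<in> {mono_of (map (\<lambda>i. v (\<sigma> i)) [0..<n]) | \<sigma> v.
          \<sigma> permutes {..<n} \<and> (\<forall>i<n. v i \<in> {Y i, Z i})}"
        using p by (intro CollectI exI[of _ p] exI[of _ v]) (auto simp: v_def)
    qed
    then show "f \<in> multilin n" using free_alg_expand[of f] by simp
  qed
qed

lemma multideg_subset_iff:
  "T \<subseteq> {..<n} \<Longrightarrow> T' \<subseteq> {..<n} \<Longrightarrow> multideg n T \<subseteq> multideg n T' \<longleftrightarrow> T = T'"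
  unfolding multideg_def by blast

lemma codim_multilin:
  assumes I: "T2_ideal I"
  shows "codim (multilin n) I = (\<Sum>T\<in>Pow {..<n}. codim (mlin (multideg n T)) I)"
proof -
  have inj: "inj_on (multideg n) (Pow {..<n})"
    by (rule inj_onI) (metis PowD multideg_subset_iff subset_refl)
  have "(\<Union>T\<in>Pow {..<n}. ml_words (multideg n T)) = (\<Union>L\<in>multideg n ` Pow {..<n}. ml_words L)" by simp
  then have "codim (multilin n) I = (\<Sum>L\<in>multideg n ` Pow {..<n}. codim (mlin L) I)"
    unfolding multilin_keys
  proof (simp only:, intro codim_multidegrees[OF I])
    show "finite L" if "L \<in> multideg n ` Pow {..<n}" for L
      using that by (auto simp: multideg_def intro: finite_subset[of _ "{..<n}"])
    show "L = L'" if "L \<in> multideg n ` Pow {..<n}" "L' \<in> multideg n ` Pow {..<n}" "L \<subseteq> L'" for L L'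
    proof -
      note h = that
      obtain T T' where T: "T \<subseteq> {..<n}" "T' \<subseteq> {..<n}" and L: "L = multideg n T" "L' = multideg n T'"
        using h(1,2) by blast
      then have "T = T'" using h(3) multideg_subset_iff[OF T] by simp
      then show ?thesis using L by simp
    qed
    show "finite (multideg n ` Pow {..<n})" by (intro finite_imageI) simp
  qed
  then show ?thesis using inj by (simp add: sum.reindex)
qed

subsection \<open>Splitting off the variables that occur outside commutators\<close>

lemma erase_Y_mono: "erase_Y j (mono_of xs) = mono_of (filter (\<lambda>x. x \<noteq> Y j) xs)"
  unfolding erase_Y_def by (induction xs) (auto simp: mono_of_Cons subst_alg_mult)

lemma linear_erase_Y: "Vector_Spaces.linear scale scale (erase_Y j)"
  unfolding erase_Y_def by (rule linear_subst_alg)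

lemma graded_subst_erase_Y: "graded_subst (\<lambda>x. if x = Y j then 1 else var x)"
  by (simp add: graded_subst_def)

lemma erase_Y_mult: "erase_Y j (f * g) = erase_Y j f * erase_Y j g"
  and erase_Y_var: "erase_Y j (var x) = (if x = Y j then 1 else var x)"
  by (simp_all add: erase_Y_def subst_alg_mult)

lemma erase_Y_commute: "erase_Y i (erase_Y j f) = erase_Y j (erase_Y i f)"
  unfolding erase_Y_def subst_alg_comp by (rule subst_alg_cong) simp

lemma erase_Y_id: "f \<in> mlin L \<Longrightarrow> Y j \<notin> L \<Longrightarrow> erase_Y j f = f"
  unfolding erase_Y_def
  by (subst subst_alg_cong[where \<rho>' = var]) (auto simp: subst_alg_id mlin_def ml_words_def)

lemma erase_Y_mlin: "f \<in> mlin L \<Longrightarrow> erase_Y j f \<in> mlin (L - {Y j})"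
  by (rule mlin_linear_image[OF _ linear_erase_Y subspace_mlin])
    (auto simp: erase_Y_mono intro!: mono_of_in_mlin)

lemma linear_mult_left: "Vector_Spaces.linear scale scale (\<lambda>f. g * f)"
  by (rule Vector_Spaces.linear_iff[THEN iffD2])
    (auto simp: algebra_simps free_alg.vector_space_axioms)

lemma mult_var_mlin: "f \<in> mlin L \<Longrightarrow> x \<notin> L \<Longrightarrow> var x * f \<in> mlin (insert x L)"
  by (rule mlin_linear_image[OF _ linear_mult_left subspace_mlin])
    (auto simp: mono_of_Cons[symmetric] intro!: mono_of_in_mlin)

lemma subspace_proper_on: "free_alg.subspace (proper_on R L)"
  using subspace_mlin[of L] unfolding proper_on_def free_alg.subspace_def
  by (auto simp: erase_Y_def subst_alg_add subst_alg_scale)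

lemma fin_space_proper_on: "finite L \<Longrightarrow> fin_space (proper_on R L)"
  by (rule fin_space_subset[OF fin_space_mlin subspace_proper_on]) (auto simp: proper_on_def)

lemma fin_space_proper: "finite L \<Longrightarrow> fin_space (proper L)"
  unfolding proper_def by (rule fin_space_proper_on)

lemma proper_iff: "f \<in> proper L \<longleftrightarrow> f \<in> mlin L \<and> (\<forall>j. Y j \<in> L \<longrightarrow> erase_Y j f = 0)"
  by (auto simp: proper_def proper_on_def)

text \<open>
  Every \<open>f\<close> is the sum of \<open>y\<^sub>j g\<close> and \<open>f - y\<^sub>j g\<close> where \<open>g\<close> is the result of erasing \<open>y\<^sub>j\<close> in \<open>f\<close>, and
  erasing \<open>y\<^sub>j\<close> in the second summand gives zero.
\<close>

lemma codim_proper_on_step: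
  assumes I: "T2_ideal I" and fin: "finite L" and j: "Y j \<in> L" "j \<notin> R"
  shows "codim (proper_on R L) I
    = codim (proper_on (insert j R) L) I + codim (proper_on R (L - {Y j})) I"
proof (rule codim_split[where d = "erase_Y j" and s = "\<lambda>f. var (Y j) * f"])
  show "fin_space (proper_on R L)" "fin_space (proper_on R (L - {Y j}))"
    using fin by (auto intro: fin_space_proper_on)
  show "free_alg.subspace I" by (rule T2_subspace[OF I])
  show "Vector_Spaces.linear scale scale (erase_Y j)" by (rule linear_erase_Y)
  show "Vector_Spaces.linear scale scale (\<lambda>f. var (Y j) * f)" by (rule linear_mult_left)
  show "erase_Y j f \<in> I" if "f \<in> I" for f
    unfolding erase_Y_def by (rule T2_subst[OF I that graded_subst_erase_Y])
  show "var (Y j) * f \<in> I" if "f \<in> I" for f by (rule T2_mult[OF I that])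
  show "erase_Y j f \<in> proper_on R (L - {Y j})" if "f \<in> proper_on R L" for f
    using that erase_Y_commute[of _ j f] linear_erase_Y[of j]
    by (auto simp: proper_on_def erase_Y_mlin) (simp add: erase_Y_def)
  show "erase_Y j (var (Y j) * f) = f" if "f \<in> proper_on R (L - {Y j})" for f
    using that by (simp add: erase_Y_mult erase_Y_var proper_on_def erase_Y_id[of f "L - {Y j}"])
  show "var (Y j) * f \<in> proper_on R L" if "f \<in> proper_on R (L - {Y j})" for f
    using that j mult_var_mlin[of f "L - {Y j}" "Y j"] by (auto simp: proper_on_def erase_Y_mult erase_Y_var insert_absorb)
  show "proper_on (insert j R) L = {f \<in> proper_on R L. erase_Y j f = 0}"
    by (auto simp: proper_on_def)
qed

lemma sum_Pow_insert:
  assumes "finite D" "j \<notin> D"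
  shows "(\<Sum>S\<in>Pow (insert j D). g S) = (\<Sum>S\<in>Pow D. g S) + (\<Sum>S\<in>Pow D. g (insert j S))"
proof -
  have "inj_on (insert j) (Pow D)" using assms by (intro inj_onI) (metis PowD insert_ident subsetD)
  moreover have "Pow D \<inter> insert j ` Pow D = {}" using assms by auto
  ultimately show ?thesis using assms by (simp add: Pow_insert sum.union_disjoint sum.reindex)
qed

lemma codim_proper_on:
  assumes I: "T2_ideal I" and "finite L" "R \<subseteq> {j. Y j \<in> L}"
  shows "codim (proper_on R L) I = (\<Sum>S\<in>Pow ({j. Y j \<in> L} - R). codim (proper (L - Y ` S)) I)"
  using assms(2-)
proof (induction "card ({j. Y j \<in> L} - R)" arbitrary: R L)
  case 0
  have "finite {j. Y j \<in> L}"
    using finite_vimageI[OF 0(2), of Y] by (simp add: vimage_def inj_on_def)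
  then have "R = {j. Y j \<in> L}" using 0 by auto
  then show ?case by (simp add: proper_def)
next
  case (Suc m)
  let ?D = "{j. Y j \<in> L} - R"
  have finY: "finite {j. Y j \<in> L}"
    using finite_vimageI[OF Suc.prems(1), of Y] by (simp add: vimage_def inj_on_def)
  obtain j where j: "j \<in> ?D" using Suc.hyps(2) by (metis card.empty nat.simps(3) equals0I)
  let ?E = "?D - {j}"
  have E: "finite ?E" "j \<notin> ?E" "?D = insert j ?E" "m = card ?E"
    using finY j Suc.hyps(2) by (auto simp: card_Diff_singleton)
  have E1: "{i. Y i \<in> L} - insert j R = ?E" and E2: "{i. Y i \<in> L - {Y j}} - R = ?E" by auto
  have "codim (proper_on R L) I
      = codim (proper_on (insert j R) L) I + codim (proper_on R (L - {Y j})) I"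
    using j by (intro codim_proper_on_step[OF I Suc.prems(1)]) auto
  also have "codim (proper_on (insert j R) L) I = (\<Sum>S\<in>Pow ?E. codim (proper (L - Y ` S)) I)"
    using Suc.hyps(1)[of L "insert j R"] Suc.prems j E E1 by simp
  also have "codim (proper_on R (L - {Y j})) I = (\<Sum>S\<in>Pow ?E. codim (proper (L - {Y j} - Y ` S)) I)"
    using Suc.hyps(1)[of "L - {Y j}" R] Suc.prems j E E2 by auto
  also have "\<dots> = (\<Sum>S\<in>Pow ?E. codim (proper (L - Y ` insert j S)) I)"
    by (intro sum.cong refl arg_cong[where f = "\<lambda>L. codim (proper L) I"]) auto
  finally show ?case by (subst E(3)) (subst sum_Pow_insert[OF E(1,2)])
qed

subsection \<open>Renaming variables\<close>

definition std_letters :: "nat \<Rightarrow> nat \<Rightarrow> letter set"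
  where "std_letters r s = Y ` {..<r} \<union> Z ` {..<s}"

definition proper_codim :: "'k::field free_alg set \<Rightarrow> nat \<Rightarrow> nat \<Rightarrow> nat"
  where "proper_codim I r s = codim (proper (std_letters r s)) I"

definition rename :: "(letter \<Rightarrow> letter) \<Rightarrow> 'k::field free_alg \<Rightarrow> 'k free_alg"
  where "rename p = subst_alg (\<lambda>x. var (p x))"

definition keeps_parity :: "(letter \<Rightarrow> letter) \<Rightarrow> bool"
  where "keeps_parity p \<longleftrightarrow> (\<forall>i. p (Y i) \<in> range Y \<and> p (Z i) \<in> range Z)"

lemma rename_mono: "rename p (mono_of xs) = mono_of (map p xs)"
  unfolding rename_def by (induction xs) (simp_all add: mono_of_Cons subst_alg_mult)

lemma graded_subst_rename: "keeps_parity p \<Longrightarrow> graded_subst (\<lambda>x. var (p x))"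
  unfolding keeps_parity_def graded_subst_def by (metis even_var_Y odd_var_Z rangeE)

lemma rename_proper:
  assumes p: "keeps_parity p" "inj_on p L" and f: "f \<in> proper L"
  shows "rename p f \<in> proper (p ` L)"
  unfolding proper_iff
proof (intro conjI allI impI)
  have m: "f \<in> mlin L" using f by (simp add: proper_iff)
  show "rename p f \<in> mlin (p ` L)"
    unfolding rename_def
    by (rule mlin_linear_image[OF m linear_subst_alg subspace_mlin], fold rename_def)
      (auto simp: rename_mono distinct_map intro!: mono_of_in_mlin inj_on_subset[OF p(2)])
  fix i assume "Y i \<in> p ` L"
  then obtain x where x: "x \<in> L" "p x = Y i" by auto
  then obtain j where j: "x = Y j" using p(1) by (cases x) (auto simp: keeps_parity_def, metis letter.distinct(1) rangeE)
  have "erase_Y i (rename p f) = rename p (erase_Y j f)"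
    unfolding erase_Y_def rename_def subst_alg_comp
  proof (rule subst_alg_cong)
    fix w x' assume "w \<in> keys f" "x' \<in> set (letters w)"
    then have "x' \<in> L" using m by (auto simp: mlin_def ml_words_def)
    then show "subst_alg (\<lambda>x. if x = Y i then 1 else var x) (var (p x'))
        = subst_alg (\<lambda>x. var (p x)) (if x' = Y j then 1 else var x')"
      using x j p(2) by (auto dest!: inj_onD[of p L x' "Y j"])
  qed
  also have "\<dots> = 0" using f x j by (simp add: proper_iff rename_def)
  finally show "erase_Y i (rename p f) = 0" .
qed

lemma rename_inverse:
  assumes "f \<in> mlin L" "\<And>x. x \<in> L \<Longrightarrow> q (p x) = x"
  shows "rename q (rename p f) = f"
proof -
  have "rename q (rename p f) = subst_alg var f"
    unfolding rename_def subst_alg_comp using assms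
    by (intro subst_alg_cong) (auto simp: mlin_def ml_words_def)
  then show ?thesis by (simp add: subst_alg_id)
qed

lemma letter_renaming:
  assumes "finite P" "finite Q"
  obtains p q where "keeps_parity p" "keeps_parity q" "p ` (Y ` P \<union> Z ` Q) = std_letters (card P) (card Q)"
    "\<And>x. x \<in> Y ` P \<union> Z ` Q \<Longrightarrow> q (p x) = x"
    "\<And>x. x \<in> std_letters (card P) (card Q) \<Longrightarrow> p (q x) = x"
proof -
  obtain a where a: "bij_betw a P {..<card P}" using assms(1) ex_bij_betw_finite_nat[of P] by (auto simp: atLeast0LessThan)
  obtain b where b: "bij_betw b Q {..<card Q}" using assms(2) ex_bij_betw_finite_nat[of Q] by (auto simp: atLeast0LessThan)
  define p where "p x = (case x of Y i \<Rightarrow> Y (a i) | Z i \<Rightarrow> Z (b i))" for x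
  define q where "q x = (case x of Y i \<Rightarrow> Y (inv_into P a i) | Z i \<Rightarrow> Z (inv_into Q b i))" for x
  show thesis
  proof
    show "keeps_parity p" "keeps_parity q" by (auto simp: keeps_parity_def p_def q_def)
    show "p ` (Y ` P \<union> Z ` Q) = std_letters (card P) (card Q)"
      using a b by (auto simp: std_letters_def p_def image_Un image_image bij_betw_def)
    show "q (p x) = x" if "x \<in> Y ` P \<union> Z ` Q" for x
      using that a b by (auto simp: p_def q_def bij_betw_inv_into_left)
    show "p (q x) = x" if "x \<in> std_letters (card P) (card Q)" for x
      using that a b by (auto simp: p_def q_def std_letters_def bij_betw_inv_into_right)
  qed
qed

text \<open>
  Renaming variables within their parity and the inverse renaming are both graded substitutions.
\<close>

lemma codim_proper_rename:
  assumes I: "T2_ideal I" and fin: "finite P" "finite Q"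
  shows "codim (proper (Y ` P \<union> Z ` Q)) I = proper_codim I (card P) (card Q)"
proof -
  let ?L = "Y ` P \<union> Z ` Q" and ?L' = "std_letters (card P) (card Q)"
  obtain p q where p: "keeps_parity p" "keeps_parity q" "p ` ?L = ?L'"
    and inv: "\<And>x. x \<in> ?L \<Longrightarrow> q (p x) = x" "\<And>x. x \<in> ?L' \<Longrightarrow> p (q x) = x"
    using letter_renaming[OF fin] by metis
  have q: "q ` ?L' = ?L" using inv(1) by (force simp: p(3)[symmetric])
  have inj: "inj_on p ?L" "inj_on q ?L'" using inv by (metis inj_on_inverseI)+
  note rp = rename_proper[OF p(1) inj(1), unfolded p(3)]
  note rq = rename_proper[OF p(2) inj(2), unfolded q]
  have finL: "finite ?L" "finite ?L'" using fin by (auto simp: std_letters_def)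
  have "codim (proper ?L) I = codim {0} I + codim (proper ?L') I"
  proof (rule codim_split[where d = "rename p" and s = "rename q"])
    show "fin_space (proper ?L)" "fin_space (proper ?L')" using finL by (auto intro: fin_space_proper)
    show "free_alg.subspace I" by (rule T2_subspace[OF I])
    show "Vector_Spaces.linear scale scale (rename p)" "Vector_Spaces.linear scale scale (rename q)"
      unfolding rename_def by (rule linear_subst_alg)+
    show "rename p f \<in> I" "rename q f \<in> I" if "f \<in> I" for f
      unfolding rename_def using p that by (auto intro: T2_subst[OF I] graded_subst_rename)
    have unrename: "rename q (rename p f) = f" if "f \<in> proper ?L" for f
      using that inv(1) by (intro rename_inverse[of _ ?L]) (auto simp: proper_iff)
    show "{0} = {f \<in> proper ?L. rename p f = 0}"
    proof -
      have "f = 0" if "f \<in> proper ?L" "rename p f = 0" for f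
        using unrename[OF that(1)] that(2) by (simp add: rename_def)
      moreover have "0 \<in> proper ?L" using subspace_proper_on free_alg.subspace_0 unfolding proper_def by blast
      ultimately show ?thesis by (auto simp: rename_def)
    qed
    show "rename p (rename q f) = f" if "f \<in> proper ?L'" for f
      using that inv(2) by (intro rename_inverse[of _ ?L']) (auto simp: proper_iff)
  qed (use rp rq in auto)
  moreover have "codim {0} I = 0"
    using codim_eq_0[of "{0}" I] T2_subspace[OF I] T2_zero[OF I]
    by (simp add: fin_space_def free_alg.subspace_single_0) (metis finite.emptyI free_alg.span_zero)
  ultimately show ?thesis by (simp add: proper_codim_def)
qed

subsection \<open>The codimension formula\<close>

definition gamma :: "'k::field free_alg set \<Rightarrow> nat \<Rightarrow> nat"
  where "gamma I k = (\<Sum>r\<le>k. (k choose r) * proper_codim I (k - r) r)"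

lemma sum_Pow_card:
  fixes h :: "nat \<Rightarrow> nat"
  assumes "finite N"
  shows "(\<Sum>S\<in>Pow N. h (card S)) = (\<Sum>k\<le>card N. (card N choose k) * h k)"
proof -
  have "(\<Sum>S\<in>Pow N. h (card S)) = (\<Sum>k\<le>card N. \<Sum>S\<in>{S \<in> Pow N. card S = k}. h (card S))"
    using assms by (intro sum.group[symmetric]) (auto intro: card_mono)
  also have "\<dots> = (\<Sum>k\<le>card N. (card N choose k) * h k)"
  proof (rule sum.cong[OF refl])
    fix k
    have "card {S \<in> Pow N. card S = k} = card N choose k" using n_subsets[OF assms, of k] by simp
    then show "(\<Sum>S\<in>{S \<in> Pow N. card S = k}. h (card S)) = (card N choose k) * h k" by simp
  qed
  finally show ?thesis .
qed

text \<open>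
  Each term of the decomposition is given by the set \<open>T\<close> of indices of odd variables and the set of
  indices of the variables in front. The complement \<open>U\<close> of the latter contains \<open>T\<close>, and
  its size is the degree of the proper factor; the formula follows by summing over \<open>U\<close> first.
\<close>

theorem codim_multilin_gamma:
  assumes I: "T2_ideal I"
  shows "codim (multilin n) I = (\<Sum>k\<le>n. (n choose k) * gamma I k)"
proof -
  let ?N = "{..<n}"
  have "codim (mlin (multideg n T)) I = (\<Sum>U\<in>{U. T \<subseteq> U \<and> U \<subseteq> ?N}. proper_codim I (card U - card T) (card T))"
    if T: "T \<subseteq> ?N" for T
  proof -
    have fin: "finite T" using T finite_subset by blast
    have Yi: "{j. Y j \<in> multideg n T} = ?N - T" by (auto simp: multideg_def)
    have "codim (mlin (multideg n T)) I = codim (proper_on {} (multideg n T)) I"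
      by (simp add: proper_on_def)
    also have "\<dots> = (\<Sum>S\<in>Pow (?N - T). codim (proper (multideg n T - Y ` S)) I)"
      using codim_proper_on[OF I, of "multideg n T" "{}"] fin by (simp add: Yi) (simp add: multideg_def)
    also have "\<dots> = (\<Sum>U\<in>{U. T \<subseteq> U \<and> U \<subseteq> ?N}. proper_codim I (card U - card T) (card T))"
    proof (rule sum.reindex_bij_witness[where i = "\<lambda>U. ?N - U" and j = "\<lambda>S. ?N - S"])
      fix S assume S: "S \<in> Pow (?N - T)"
      then show "?N - (?N - S) = S" "?N - S \<in> {U. T \<subseteq> U \<and> U \<subseteq> ?N}" using T by auto
      have "multideg n T - Y ` S = Y ` (?N - S - T) \<union> Z ` T" unfolding multideg_def by auto
      moreover have "card (?N - S - T) = card (?N - S) - card T"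
        using S T fin by (intro card_Diff_subset) auto
      ultimately show "proper_codim I (card (?N - S) - card T) (card T) = codim (proper (multideg n T - Y ` S)) I"
        using codim_proper_rename[OF I, of "?N - S - T" T] fin by simp
    qed (use T in auto)
    finally show ?thesis .
  qed
  then have "codim (multilin n) I
      = (\<Sum>T\<in>Pow ?N. \<Sum>U\<in>{U. U \<in> Pow ?N \<and> T \<subseteq> U}. proper_codim I (card U - card T) (card T))"
    unfolding codim_multilin[OF I] by (intro sum.cong refl) (auto intro!: sum.cong)
  also have "\<dots> = (\<Sum>U\<in>Pow ?N. \<Sum>T\<in>{T. T \<in> Pow ?N \<and> T \<subseteq> U}. proper_codim I (card U - card T) (card T))"
    by (rule sum.swap_restrict) auto
  also have "\<dots> = (\<Sum>U\<in>Pow ?N. gamma I (card U))"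
  proof (rule sum.cong[OF refl])
    fix U assume U: "U \<in> Pow ?N"
    then have "{T. T \<in> Pow ?N \<and> T \<subseteq> U} = Pow U" by auto
    moreover have "finite U" using U finite_subset by blast
    ultimately show "(\<Sum>T\<in>{T. T \<in> Pow ?N \<and> T \<subseteq> U}. proper_codim I (card U - card T) (card T)) = gamma I (card U)"
      using sum_Pow_card[of U "\<lambda>k. proper_codim I (card U - k) k"] by (simp add: gamma_def)
  qed
  also have "\<dots> = (\<Sum>k\<le>n. (n choose k) * gamma I k)"
    using sum_Pow_card[of ?N "gamma I"] by simp
  finally show ?thesis .
qed

section \<open>Y-proper polynomials and their multihomogeneous components\<close>

definition shift_Y :: "nat \<Rightarrow> 'k::field free_alg \<Rightarrow> 'k free_alg"
  where "shift_Y j = subst_alg (\<lambda>x. if x = Y j then var x + 1 else var x)"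

text \<open>
  Commutators do not notice scalar summands, so commutators and hence all Y-proper
  polynomials are invariant under \<open>y\<^sub>j := y\<^sub>j + 1\<close>. For a polynomial that is linear in \<open>y\<^sub>j\<close> this means that
  it vanishes under \<open>y\<^sub>j := 1\<close>.
\<close>

lemma shift_brackets: "b \<in> brackets \<Longrightarrow> \<exists>c. shift_Y j b = b + scale c 1"
proof (induction rule: brackets.induct)
  case (letter x)
  have "shift_Y j (var x) = var x + scale (if x = Y j then 1 else 0) 1"
    by (simp add: shift_Y_def)
  then show ?case by blast
next
  case (bracket f g)
  then obtain a b where "shift_Y j f = f + scale a 1" "shift_Y j g = g + scale b 1" by blast
  then have "shift_Y j (f * g - g * f) = f * g - g * f + scale 0 1"
    by (simp add: shift_Y_def subst_alg_simps algebra_simps)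
  then show ?case by blast
qed

lemma shift_Y_proper: "p \<in> Y_proper \<Longrightarrow> shift_Y j p = p"
  unfolding Y_proper_def
proof (induction rule: subalg_gen.induct)
  case (gen p)
  then consider i where "p = var (Z i)" | f g where "p = f * g - g * f" "f \<in> brackets" "g \<in> brackets"
    by blast
  then show ?case
  proof cases
    case 1
    then show ?thesis by (simp add: shift_Y_def)
  next
    case 2
    obtain a b where "shift_Y j f = f + scale a 1" "shift_Y j g = g + scale b 1"
      using shift_brackets 2 by blast
    then show ?thesis unfolding 2 by (simp add: shift_Y_def subst_alg_simps algebra_simps)
  qed
qed (simp_all add: shift_Y_def subst_alg_simps)

lemma shift_Y_mult: "shift_Y j (f * g) = shift_Y j f * shift_Y j g"
  and shift_Y_var: "shift_Y j (var x) = (if x = Y j then var x + 1 else var x)"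
  and shift_Y_one: "shift_Y j 1 = 1"
  by (simp_all add: shift_Y_def subst_alg_mult)

lemma shift_Y_mlin:
  fixes f :: "'k::field free_alg"
  assumes f: "f \<in> mlin L" and j: "Y j \<in> L"
  shows "shift_Y j f = f + erase_Y j f"
proof -
  have lin: "Vector_Spaces.linear scale scale (\<lambda>f. shift_Y j f - f - erase_Y j f)"
    by (rule Vector_Spaces.linear_iff[THEN iffD2])
      (auto simp: shift_Y_def erase_Y_def subst_alg_simps free_alg.vector_space_axioms
        free_alg.scale_right_diff_distrib)
  have "shift_Y j f - f - erase_Y j f \<in> {0}"
  proof (rule mlin_linear_image[OF f lin])
    show "free_alg.subspace {0}" by (rule free_alg.subspace_single_0)
    fix xs assume xs: "distinct xs" "set xs = L"
    then obtain us vs where split: "xs = us @ Y j # vs" using j split_list by metis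
    have id: "shift_Y j (mono_of ws) = (mono_of ws :: 'k free_alg)"
        "erase_Y j (mono_of ws) = (mono_of ws :: 'k free_alg)"
      if "Y j \<notin> set ws" for ws
      using that
      by (induction ws)
        (auto simp: mono_of_Cons shift_Y_mult shift_Y_var shift_Y_one erase_Y_mult erase_Y_var erase_Y_mono[of j "[]", simplified])
    have "Y j \<notin> set us" "Y j \<notin> set vs" using xs split by auto
    note id = id[OF this(1)] id[OF this(2)]
    have "shift_Y j (mono_of xs :: 'k free_alg) = mono_of us * ((var (Y j) + 1) * mono_of vs)"
      unfolding split mono_of_append mono_of_Cons
      using id(1,3) by (simp add: shift_Y_mult shift_Y_var)
    moreover have "erase_Y j (mono_of xs :: 'k free_alg) = mono_of us * mono_of vs"
      unfolding split mono_of_append mono_of_Cons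
      using id(2,4) by (simp add: erase_Y_mult erase_Y_var)
    moreover have "(mono_of xs :: 'k free_alg) = mono_of us * (var (Y j) * mono_of vs)"
      unfolding split mono_of_append mono_of_Cons ..
    ultimately show "shift_Y j (mono_of xs) - mono_of xs - erase_Y j (mono_of xs) \<in> {0 :: 'k free_alg}"
      by (simp add: algebra_simps)
  qed
  then show ?thesis by (simp add: algebra_simps)
qed

lemma restr_multilin: "f \<in> multilin n \<Longrightarrow> T \<subseteq> {..<n} \<Longrightarrow> restr (multideg n T) f \<in> mlin (multideg n T)"
proof -
  assume f: "f \<in> multilin n" and T: "T \<subseteq> {..<n}"
  have "w \<in> ml_words (multideg n T)" if w: "w \<in> keys (restr (multideg n T) f)" for w
  proof -
    have "set (letters w) \<subseteq> multideg n T" "w \<in> keys f"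
      using w by (auto simp: in_keys_iff lookup_restr split: if_splits)
    moreover then obtain T' where T': "T' \<subseteq> {..<n}" "w \<in> ml_words (multideg n T')"
      using f unfolding multilin_keys by blast
    moreover then have "set (letters w) = multideg n T'" by (auto simp: ml_words_def)
    ultimately show ?thesis using multideg_subset_iff[OF T'(1) T] by simp
  qed
  then show ?thesis by (auto simp: mlin_def)
qed

lemma multilin_sum_restr:
  assumes f: "f \<in> multilin n"
  shows "f = (\<Sum>T\<in>Pow {..<n}. restr (multideg n T) f)"
proof (rule poly_mapping_eqI)
  fix w
  show "lookup f w = lookup (\<Sum>T\<in>Pow {..<n}. restr (multideg n T) f) w"
  proof (cases "w \<in> keys f")
    case True
    then obtain T where T: "T \<subseteq> {..<n}" "w \<in> ml_words (multideg n T)"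
      using f unfolding multilin_keys by blast
    then have w: "set (letters w) = multideg n T" by (auto simp: ml_words_def)
    have "(\<Sum>T'\<in>Pow {..<n}. lookup (restr (multideg n T') f) w)
        = (\<Sum>T'\<in>Pow {..<n}. if T' = T then lookup f w else 0)"
      using T(1) by (intro sum.cong refl) (auto simp: lookup_restr w multideg_subset_iff)
    then show ?thesis using T(1) by (simp add: lookup_sum)
  next
    case False
    then have "lookup (restr (multideg n T) f) w = 0" for T
      by (simp add: lookup_restr in_keys_iff)
    then show ?thesis using False by (simp add: lookup_sum in_keys_iff)
  qed
qed

text \<open>
  Extracting a component commutes with the shift of each variable that is kept.
\<close>

lemma restr_Gam:
  assumes f: "f \<in> Gam n" and T: "T \<subseteq> {..<n}"
  shows "restr (multideg n T) f \<in> proper (multideg n T)"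
  unfolding proper_iff
proof (intro conjI allI impI)
  let ?L = "multideg n T"
  have f': "f \<in> Y_proper" "f \<in> multilin n" using f by (auto simp: Gam_def)
  show r: "restr ?L f \<in> mlin ?L" by (rule restr_multilin[OF f'(2) T])
  fix j assume j: "Y j \<in> ?L"
  have "shift_Y j (restr ?L f) = restr ?L (shift_Y j f)"
    unfolding shift_Y_def restr_def subst_alg_comp
    using j by (intro subst_alg_cong) (auto simp: subst_alg_add)
  then have "shift_Y j (restr ?L f) = restr ?L f" by (simp add: shift_Y_proper[OF f'(1)])
  then show "erase_Y j (restr ?L f) = 0" using shift_Y_mlin[OF r j] by simp
qed

lemma mlin_subset_multilin: "T \<subseteq> {..<n} \<Longrightarrow> mlin (multideg n T) \<subseteq> multilin n"
  unfolding multilin_keys mlin_def by blast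

subsection \<open>Monomial substitutions\<close>

lemma brackets_monomial_subst:
  assumes "b \<in> brackets"
  shows "\<exists>d. \<exists>b'\<in>brackets. subst_alg (\<lambda>x. scale (c x) (var (p x))) b = scale d b'"
  using assms
proof (induction rule: brackets.induct)
  case (letter x)
  have "subst_alg (\<lambda>x. scale (c x) (var (p x))) (var x) = scale (c x) (var (p x))" by simp
  then show ?case using brackets.letter by blast
next
  case (bracket f g)
  then obtain d e b b' where "b \<in> brackets" "b' \<in> brackets"
    "subst_alg (\<lambda>x. scale (c x) (var (p x))) f = scale d b"
    "subst_alg (\<lambda>x. scale (c x) (var (p x))) g = scale e b'" by blast
  moreover from this have
    "subst_alg (\<lambda>x. scale (c x) (var (p x))) (f * g - g * f) = scale (d * e) (b * b' - b' * b)"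
    by (simp add: subst_alg_simps free_alg.scale_right_diff_distrib mult.commute)
  ultimately show ?case using brackets.bracket by blast
qed

lemma Y_proper_monomial_subst:
  assumes "f \<in> Y_proper" and p: "keeps_parity p"
  shows "subst_alg (\<lambda>x. scale (c x) (var (p x))) f \<in> Y_proper"
  using assms(1) unfolding Y_proper_def
proof (induction rule: subalg_gen.induct)
  case (gen f)
  let ?G = "{var (Z i) | i. True} \<union> {f * g - g * f | f g. f \<in> brackets \<and> g \<in> brackets}"
  have "\<exists>d. \<exists>f'\<in>?G. subst_alg (\<lambda>x. scale (c x) (var (p x))) f = scale d f'"
  proof -
    consider i where "f = var (Z i)" | g h where "f = g * h - h * g" "g \<in> brackets" "h \<in> brackets"
      using gen by blast
    then show ?thesis
    proof cases
      case 1
      obtain k where "p (Z i) = Z k" using p unfolding keeps_parity_def by (metis rangeE)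
      then have "subst_alg (\<lambda>x. scale (c x) (var (p x))) f = scale (c (Z i)) (var (Z k))" by (simp add: 1)
      then show ?thesis by blast
    next
      case 2
      obtain d e b b' where b: "b \<in> brackets" "b' \<in> brackets"
        "subst_alg (\<lambda>x. scale (c x) (var (p x))) g = scale d b"
        "subst_alg (\<lambda>x. scale (c x) (var (p x))) h = scale e b'"
        using brackets_monomial_subst[OF 2(2)] brackets_monomial_subst[OF 2(3)] by blast
      then have "subst_alg (\<lambda>x. scale (c x) (var (p x))) f = scale (d * e) (b * b' - b' * b)"
        unfolding 2(1) by (simp add: subst_alg_simps free_alg.scale_right_diff_distrib mult.commute)
      then show ?thesis using b by blast
    qed
  qed
  then obtain d f' where "f' \<in> ?G" "subst_alg (\<lambda>x. scale (c x) (var (p x))) f = scale d f'" by blast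
  then show ?case using subalg_gen.scale[OF subalg_gen.gen[of f' ?G]] by simp
qed (auto simp: subst_alg_simps intro: subalg_gen.intros)

lemma Y_proper_rename: "f \<in> Y_proper \<Longrightarrow> keeps_parity p \<Longrightarrow> rename p f \<in> Y_proper"
  using Y_proper_monomial_subst[of f p "\<lambda>_. 1"] by (simp add: rename_def)

lemma subspace_Gam: "free_alg.subspace (Gam n :: 'k::field free_alg set)"
proof -
  have "(0::'k free_alg) \<in> Y_proper"
    using subalg_gen.scale[OF subalg_gen.one, of 0] by (simp add: Y_proper_def)
  moreover have "free_alg.subspace (multilin n :: 'k free_alg set)"
    unfolding multilin_def by (rule free_alg.subspace_span)
  ultimately show ?thesis
    unfolding Gam_def free_alg.subspace_def
    by (auto simp: Y_proper_def intro: subalg_gen.add subalg_gen.scale)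
qed

lemma hyperoct_act_conv: "hyperoct_act a \<pi> = subst_alg (\<lambda>x. scale (case x of Y i \<Rightarrow> 1 | Z i \<Rightarrow> a (\<pi> i))
    (var (case x of Y i \<Rightarrow> Y (\<pi> i) | Z i \<Rightarrow> Z (\<pi> i))))"
  unfolding hyperoct_act_def by (intro arg_cong[where f = subst_alg] ext) (simp split: letter.split)

text \<open>
  The hyperoctahedral group acts by substitutions of letters by multiples of letters, which preserve
  parity and permute the multidegrees.
\<close>

lemma hyperoct_act_Gam:
  assumes f: "f \<in> Gam n" and \<pi>: "\<pi> permutes {..<n}"
  shows "hyperoct_act a \<pi> f \<in> Gam n"
proof -
  define c where "c x = (case x of Y i \<Rightarrow> 1 | Z i \<Rightarrow> a (\<pi> i))" for x
  define p where "p x = (case x of Y i \<Rightarrow> Y (\<pi> i) | Z i \<Rightarrow> Z (\<pi> i))" for x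
  have act: "hyperoct_act a \<pi> = subst_alg (\<lambda>x. scale (c x) (var (p x)))"
    unfolding hyperoct_act_conv c_def p_def ..
  have "keeps_parity p" by (auto simp: keeps_parity_def p_def)
  then have "hyperoct_act a \<pi> f \<in> Y_proper"
    unfolding act using f by (auto simp: Gam_def intro: Y_proper_monomial_subst)
  moreover have "hyperoct_act a \<pi> f \<in> multilin n"
  proof -
    have sub: "free_alg.subspace (multilin n :: 'a free_alg set)"
      unfolding multilin_def by (rule free_alg.subspace_span)
    have "restr (multideg n T) f \<in> {f. hyperoct_act a \<pi> f \<in> multilin n}" if T: "T \<in> Pow {..<n}" for T
    proof -
      have "\<exists>d. subst_alg (\<lambda>x. scale (c x) (var (p x))) (mono_of xs) = scale d (mono_of (map p xs))" for xs
      proof (induction xs)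
        case Nil
        show ?case by (rule exI[of _ 1]) simp
      next
        case (Cons x xs)
        then obtain d where "subst_alg (\<lambda>x. scale (c x) (var (p x))) (mono_of xs) = scale d (mono_of (map p xs))" by blast
        then have "subst_alg (\<lambda>x. scale (c x) (var (p x))) (mono_of (x # xs)) = scale (d * c x) (mono_of (map p (x # xs)))"
          by (simp add: mono_of_Cons subst_alg_mult)
        then show ?case by blast
      qed
      moreover have "mono_of (map p xs) \<in> multilin n" if xs: "distinct xs" "set xs = multideg n T" for xs
      proof -
        have "inj_on p (multideg n T)"
          using permutes_inj[OF \<pi>] by (auto simp: inj_on_def p_def split: letter.splits)
        moreover have "p ` multideg n T = multideg n (\<pi> ` T)"
          using permutes_image[OF \<pi>] image_set_diff[OF permutes_inj[OF \<pi>], of "{..<n}" T]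
          by (simp add: multideg_def image_Un image_image p_def) (simp add: image_image[symmetric])
        ultimately have "mono_of (map p xs) \<in> mlin (multideg n (\<pi> ` T))"
          using xs by (intro mono_of_in_mlin) (auto simp: distinct_map)
        moreover have "\<pi> ` T \<subseteq> {..<n}" using T permutes_image[OF \<pi>] by blast
        ultimately show ?thesis using mlin_subset_multilin by blast
      qed
      ultimately have m: "subst_alg (\<lambda>x. scale (c x) (var (p x))) (mono_of xs) \<in> multilin n"
        if "distinct xs" "set xs = multideg n T" for xs
        using that free_alg.subspace_scale[OF sub] by metis
      have "restr (multideg n T) f \<in> mlin (multideg n T)"
        using restr_multilin[of f n T] f T by (auto simp: Gam_def)
      then have "hyperoct_act a \<pi> (restr (multideg n T) f) \<in> multilin n"
        unfolding act by (rule mlin_linear_image[OF _ linear_subst_alg sub m])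
      then show ?thesis by simp
    qed
    then have "hyperoct_act a \<pi> (\<Sum>T\<in>Pow {..<n}. restr (multideg n T) f) \<in> multilin n"
      unfolding act subst_alg_sum by (intro free_alg.subspace_sum[OF sub]) auto
    then show ?thesis using multilin_sum_restr[of f n] f by (simp add: Gam_def)
  qed
  ultimately show ?thesis by (simp add: Gam_def)
qed

lemma free_aut_Gam: "f \<in> Gam n \<Longrightarrow> free_aut f \<in> Gam n"
proof -
  assume f: "f \<in> Gam n"
  have "free_aut f = hyperoct_act (\<lambda>_. -1) (\<lambda>i. i) f"
    unfolding free_aut_def hyperoct_act_def
    by (intro arg_cong[where f = "\<lambda>\<rho>. subst_alg \<rho> f"] ext) (simp split: letter.split)
  moreover have "(\<lambda>i. i) permutes {..<n}" using permutes_id[of "{..<n}"] by (simp add: id_def)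
  ultimately show ?thesis using hyperoct_act_Gam[OF f] by simp
qed

section \<open>Proper multilinear polynomials of degree at most three\<close>

abbreviation y :: "nat \<Rightarrow> 'k::field free_alg" where "y i \<equiv> var (Y i)"
abbreviation z :: "nat \<Rightarrow> 'k::field free_alg" where "z i \<equiv> var (Z i)"
abbreviation comm :: "'k::field free_alg \<Rightarrow> 'k free_alg \<Rightarrow> 'k free_alg"
  where "comm f g \<equiv> f * g - g * f"

definition lin_comb :: "'k::field free_alg list \<Rightarrow> (nat \<Rightarrow> 'k) \<Rightarrow> 'k free_alg"
  where "lin_comb bs c = (\<Sum>k<length bs. scale (c k) (bs ! k))"

text \<open>
  Bases of the proper polynomials in \<open>r\<close> even and \<open>s\<close> odd variables, adapted to the action of the
  symmetric groups. In type \<open>(3, 0)\<close> the two elements span an irreducible module. In type \<open>(0, 3)\<close>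
  the first two elements span the trivial and the sign module, and the following two pairs span copies
  of the two-dimensional module. In the first pair every letter occurs in the first and the second
  position with the same total coefficient, in the second pair in the second and the third
  position. In all other types every element spans a one-dimensional module.
\<close>

definition proper_basis :: "nat \<Rightarrow> nat \<Rightarrow> 'k::field free_alg list"
  where "proper_basis r s =
    (if (r, s) = (0, 1) then [z 0]
     else if (r, s) = (2, 0) then [comm (y 0) (y 1)]
     else if (r, s) = (1, 1) then [comm (y 0) (z 0)]
     else if (r, s) = (0, 2) then [z 0 * z 1 + z 1 * z 0, comm (z 0) (z 1)]
     else if (r, s) = (3, 0) then [comm (comm (y 0) (y 1)) (y 2), comm (comm (y 0) (y 2)) (y 1)]
     else if (r, s) = (2, 1) then
       [comm (comm (z 0) (y 0)) (y 1) + comm (comm (z 0) (y 1)) (y 0), comm (y 0) (y 1) * z 0, z 0 * comm (y 0) (y 1)]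
     else if (r, s) = (1, 2) then
       [z 0 * comm (y 0) (z 1) + z 1 * comm (y 0) (z 0), z 0 * comm (y 0) (z 1) - z 1 * comm (y 0) (z 0),
        comm (y 0) (z 0 * z 1 + z 1 * z 0), comm (y 0) (comm (z 0) (z 1))]
     else if (r, s) = (0, 3) then
       [z 0 * z 1 * z 2 + z 0 * z 2 * z 1 + z 1 * z 0 * z 2 + z 1 * z 2 * z 0 + z 2 * z 0 * z 1 + z 2 * z 1 * z 0,
        z 0 * z 1 * z 2 - z 0 * z 2 * z 1 - z 1 * z 0 * z 2 + z 1 * z 2 * z 0 + z 2 * z 0 * z 1 - z 2 * z 1 * z 0,
        z 0 * z 2 * z 1 - z 1 * z 2 * z 0 + z 2 * z 0 * z 1 - z 2 * z 1 * z 0,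
        z 0 * z 1 * z 2 - z 2 * z 1 * z 0 + z 1 * z 0 * z 2 - z 1 * z 2 * z 0,
        z 1 * z 2 * z 0 - z 0 * z 2 * z 1 + z 1 * z 0 * z 2 - z 0 * z 1 * z 2,
        z 2 * z 1 * z 0 - z 0 * z 1 * z 2 + z 2 * z 0 * z 1 - z 0 * z 2 * z 1]
     else [])"

definition small_types :: "(nat \<times> nat) set"
  where "small_types = {(1, 0), (0, 1), (2, 0), (1, 1), (0, 2), (3, 0), (2, 1), (1, 2), (0, 3)}"

lemma mono_normal:
  "var x = mono_of [x]" "mono_of xs * mono_of ys = mono_of (xs @ ys)"
  by (simp_all add: var_def mono_of_append)

lemma mlin_expand:
  assumes "f \<in> mlin L" "finite L"
  shows "f = (\<Sum>w\<in>ml_words L. scale (lookup f w) (mono_of (letters w)))"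
proof -
  have "(\<Sum>w\<in>keys f. scale (lookup f w) (mono_of (letters w)))
      = (\<Sum>w\<in>ml_words L. scale (lookup f w) (mono_of (letters w)))"
    using assms by (intro sum.mono_neutral_left finite_ml_words) (auto simp: mlin_def in_keys_iff)
  then show ?thesis using free_alg_expand[of f] by simp
qed

lemma ml_words_1: "ml_words {a} = {Word [a]}"
proof -
  have "xs = [a]" if "distinct xs" "set xs = {a}" for xs
  proof -
    have "length xs = 1" using that distinct_card by fastforce
    then obtain p where "xs = [p]" by (auto simp: length_Suc_conv)
    then show ?thesis using that by simp
  qed
  then show ?thesis by (auto simp: ml_words_def)
qed

lemma ml_words_2: "a \<noteq> b \<Longrightarrow> ml_words {a, b} = {Word [a, b], Word [b, a]}"
proof -
  assume ab: "a \<noteq> b"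
  have "xs = [a, b] \<or> xs = [b, a]" if "distinct xs" "set xs = {a, b}" for xs
  proof -
    have "length xs = 2" using that ab distinct_card[of xs] by simp
    then obtain p q where "xs = [p, q]" by (auto simp: length_Suc_conv numeral_2_eq_2)
    then show ?thesis using that by auto
  qed
  then show ?thesis using ab by (auto simp: ml_words_def)
qed

lemma ml_words_3:
  assumes "distinct [a, b, c]"
  shows "ml_words {a, b, c}
    = {Word [a, b, c], Word [a, c, b], Word [b, a, c], Word [b, c, a], Word [c, a, b], Word [c, b, a]}"
proof -
  have "xs \<in> {[a, b, c], [a, c, b], [b, a, c], [b, c, a], [c, a, b], [c, b, a]}"
    if "distinct xs" "set xs = {a, b, c}" for xs
  proof -
    have "length xs = 3" using that assms distinct_card[of xs] by simp
    then obtain p q r where xs: "xs = [p, q, r]" by (auto simp: length_Suc_conv numeral_3_eq_3)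
    have "p \<in> {a, b, c}" "q \<in> {a, b, c}" "r \<in> {a, b, c}" using that xs by auto
    then show ?thesis using that(1) xs by auto
  qed
  then show ?thesis using assms by (fastforce simp: ml_words_def)
qed

lemma mlin_1E:
  assumes "f \<in> mlin {a}"
  obtains c where "f = scale c (mono_of [a])"
  using mlin_expand[OF assms] by (simp add: ml_words_1)

lemma mlin_2E:
  assumes "f \<in> mlin {a, b}" "a \<noteq> b"
  obtains c1 c2 where "f = scale c1 (mono_of [a, b]) + scale c2 (mono_of [b, a])"
  using mlin_expand[OF assms(1)] assms(2) by (simp add: ml_words_2)

lemma mlin_3E:
  assumes "f \<in> mlin {a, b, c}" "distinct [a, b, c]"
  obtains c1 c2 c3 c4 c5 c6 where
    "f = scale c1 (mono_of [a, b, c]) + scale c2 (mono_of [a, c, b]) + scale c3 (mono_of [b, a, c])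
       + scale c4 (mono_of [b, c, a]) + scale c5 (mono_of [c, a, b]) + scale c6 (mono_of [c, b, a])"
  using mlin_expand[OF assms(1)] assms(2) by (simp add: ml_words_3 add.assoc)

lemma subspace_proper: "free_alg.subspace (proper L)"
  unfolding proper_def by (rule subspace_proper_on)

lemma lin_comb_in_subspace:
  assumes "free_alg.subspace V" "\<And>b. b \<in> set bs \<Longrightarrow> b \<in> V"
  shows "lin_comb bs c \<in> V"
  unfolding lin_comb_def using assms by (intro free_alg.subspace_sum free_alg.subspace_scale) auto

lemma erase_Y_simps: "erase_Y j (f + g) = erase_Y j f + erase_Y j g" "erase_Y j (f - g) = erase_Y j f - erase_Y j g"
  "erase_Y j (scale c f) = scale c (erase_Y j f)" "erase_Y j (- f) = - erase_Y j f"
  by (simp_all add: erase_Y_def subst_alg_simps)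

lemma mlin_intros:
  "f \<in> mlin L \<Longrightarrow> g \<in> mlin L \<Longrightarrow> f + g \<in> mlin L"
  "f \<in> mlin L \<Longrightarrow> g \<in> mlin L \<Longrightarrow> f - g \<in> mlin L"
  by (simp_all add: free_alg.subspace_add[OF subspace_mlin] free_alg.subspace_diff[OF subspace_mlin])

lemma std_letters_small:
  "std_letters 1 0 = {Y 0}" "std_letters 0 1 = {Z 0}"
  "std_letters 2 0 = {Y 0, Y 1}" "std_letters 1 1 = {Y 0, Z 0}" "std_letters 0 2 = {Z 0, Z 1}"
  "std_letters 3 0 = {Y 0, Y 1, Y 2}" "std_letters 2 1 = {Y 0, Y 1, Z 0}"
  "std_letters 1 2 = {Y 0, Z 0, Z 1}" "std_letters 0 3 = {Z 0, Z 1, Z 2}"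
  by (auto simp: std_letters_def numeral_2_eq_2 numeral_3_eq_3 lessThan_Suc)

lemma proper_basis_in_proper:
  assumes "(r, s) \<in> small_types" "b \<in> set (proper_basis r s)"
  shows "b \<in> proper (std_letters r s)"
  using assms unfolding small_types_def
  by (auto simp: proper_basis_def proper_iff std_letters_small[unfolded One_nat_def] mono_normal ring_distribs erase_Y_simps erase_Y_mono
      intro!: mlin_intros mono_of_in_mlin)

lemmas lookup_simps = lookup_add lookup_minus lookup_scale lookup_mono_of

lemma lin_comb_nth:
  "lin_comb [a] c = scale (c 0) a"
  "lin_comb [a, b] c = scale (c 0) a + scale (c 1) b"
  "lin_comb [a, b, d] c = scale (c 0) a + scale (c 1) b + scale (c 2) d"
  "lin_comb [a, b, d, e] c = scale (c 0) a + scale (c 1) b + scale (c 2) d + scale (c 3) e"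
  "lin_comb [a, b, d, e, f, g] c = scale (c 0) a + scale (c 1) b + scale (c 2) d + scale (c 3) e
    + scale (c 4) f + scale (c 5) g"
  by (simp_all add: lin_comb_def lessThan_Suc numeral_eq_Suc algebra_simps)

lemma proper_10: "f \<in> proper (std_letters 1 0) \<Longrightarrow> f = 0"
proof -
  assume f: "f \<in> proper (std_letters 1 0)"
  then obtain c where c: "f = scale c (mono_of [Y 0])"
    unfolding proper_iff std_letters_small by (auto elim: mlin_1E)
  have "erase_Y 0 f = 0" using f unfolding proper_iff std_letters_small by blast
  then have "lookup (scale c (mono_of [])) (Word []) = 0"
    unfolding c by (simp only: erase_Y_simps erase_Y_mono) simp
  then show "f = 0" unfolding c by (simp only: lookup_simps) simp
qed

lemma proper_01: "f \<in> proper (std_letters 0 1) \<Longrightarrow> \<exists>c. f = lin_comb (proper_basis 0 1) c"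
proof -
  assume "f \<in> proper (std_letters 0 1)"
  then obtain c where "f = scale c (mono_of [Z 0])"
    unfolding proper_iff std_letters_small by (auto elim: mlin_1E)
  then have "f = lin_comb (proper_basis 0 1) (\<lambda>_. c)"
    by (simp add: proper_basis_def lin_comb_nth mono_normal)
  then show ?thesis by blast
qed

lemma word_eqI:
  assumes "\<And>xs. lookup f (Word xs) = lookup g (Word xs)"
  shows "f = g"
  by (rule poly_mapping_eqI) (metis assms word.exhaust)

lemma proper_two_letters:
  assumes f: "f \<in> proper {Y 0, x}" and x: "x \<noteq> Y 0"
  shows "\<exists>c. f = scale c (comm (y 0) (var x))"
proof -
  have e: "erase_Y 0 f = 0" and "f \<in> mlin {Y 0, x}" using f unfolding proper_iff by blast+
  then obtain a b where c: "f = scale a (mono_of [Y 0, x]) + scale b (mono_of [x, Y 0])"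
    using x by (auto elim: mlin_2E)
  have "a + b = 0"
    using arg_cong[OF e, of "\<lambda>f. lookup f (Word [x])"] x
    unfolding c by (simp add: erase_Y_simps erase_Y_mono lookup_simps)
  then have b: "b = - a" by (simp add: eq_neg_iff_add_eq_0 add.commute)
  have "f = scale a (comm (y 0) (var x))"
    unfolding c b by (intro word_eqI) (simp add: mono_normal lookup_simps)
  then show ?thesis by blast
qed

lemma proper_20: "f \<in> proper (std_letters 2 0) \<Longrightarrow> \<exists>c. f = lin_comb (proper_basis 2 0) c"
  and proper_11: "f \<in> proper (std_letters 1 1) \<Longrightarrow> \<exists>c. f = lin_comb (proper_basis 1 1) c"
proof -
  have one: "\<exists>c. f = lin_comb [g] c" if h: "\<exists>c. f = scale c g" for f g :: "'a free_alg"
  proof -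
    obtain c where "f = scale c g" using h by blast
    then show ?thesis by (intro exI[of _ "\<lambda>_. c"]) (simp add: lin_comb_nth)
  qed
  show "\<exists>c. f = lin_comb (proper_basis 2 0) c" if "f \<in> proper (std_letters 2 0)"
    using one[OF proper_two_letters[of f "Y 1"]] that by (simp add: proper_basis_def std_letters_small)
  show "\<exists>c. f = lin_comb (proper_basis 1 1) c" if "f \<in> proper (std_letters 1 1)"
    using one[OF proper_two_letters[of f "Z 0"]] that by (simp add: proper_basis_def std_letters_small[simplified])
qed

lemma proper_02:
  fixes f :: "'k::field_char_0 free_alg"
  shows "f \<in> proper (std_letters 0 2) \<Longrightarrow> \<exists>c. f = lin_comb (proper_basis 0 2) c"
proof -
  assume f: "f \<in> proper (std_letters 0 2)"
  then have "f \<in> mlin {Z 0, Z 1}"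
    unfolding proper_iff std_letters_small by blast+
  then obtain a b where c: "f = scale a (mono_of [Z 0, Z 1]) + scale b (mono_of [Z 1, Z 0])"
    by (auto elim: mlin_2E)
  have "f = lin_comb (proper_basis 0 2) (\<lambda>k. [(a + b) / 2, (a - b) / 2] ! k)"
    unfolding c
    by (intro word_eqI) (auto simp: proper_basis_def lin_comb_nth mono_normal ring_distribs lookup_simps field_simps)
  then show ?thesis by blast
qed

lemma proper_30: "f \<in> proper (std_letters 3 0) \<Longrightarrow> \<exists>c. f = lin_comb (proper_basis 3 0) c"
proof -
  assume f: "f \<in> proper (std_letters 3 0)"
  then have m: "f \<in> mlin {Y 0, Y 1, Y 2}" and e: "erase_Y 0 f = 0" "erase_Y 1 f = 0" "erase_Y 2 f = 0"
    unfolding proper_iff std_letters_small by blast+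
  obtain c1 c2 c3 c4 c5 c6 where c: "f = scale c1 (mono_of [Y 0, Y 1, Y 2]) + scale c2 (mono_of [Y 0, Y 2, Y 1])
      + scale c3 (mono_of [Y 1, Y 0, Y 2]) + scale c4 (mono_of [Y 1, Y 2, Y 0])
      + scale c5 (mono_of [Y 2, Y 0, Y 1]) + scale c6 (mono_of [Y 2, Y 1, Y 0])"
    by (rule mlin_3E[OF m]) simp_all
  note lk = arg_cong[where f = "\<lambda>f. lookup f (Word xs)" for xs]
  have eqs: "c1 + c3 + c4 = 0" "c2 + c5 + c6 = 0" "c1 + c2 + c3 = 0" "c4 + c5 + c6 = 0" "c1 + c2 + c5 = 0"
    using lk[OF e(1), of "[Y 1, Y 2]"] lk[OF e(1), of "[Y 2, Y 1]"] lk[OF e(2), of "[Y 0, Y 2]"]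
      lk[OF e(2), of "[Y 2, Y 0]"] lk[OF e(3), of "[Y 0, Y 1]"]
    unfolding c by (simp_all add: erase_Y_simps erase_Y_mono lookup_simps)
  have s: "c3 = - c1 - c2" "c4 = c2" "c5 = - c1 - c2" "c6 = c1"
  proof -
    have "c3 - (- c1 - c2) = (c1 + c2 + c3)" by (simp add: algebra_simps)
    then show "c3 = - c1 - c2" by (simp add: eqs)
    have "c4 - (c2) = (c1 + c3 + c4) - (c1 + c2 + c3)" by (simp add: algebra_simps)
    then show "c4 = c2" by (simp add: eqs)
    have "c5 - (- c1 - c2) = (c1 + c2 + c5)" by (simp add: algebra_simps)
    then show "c5 = - c1 - c2" by (simp add: eqs)
    have "c6 - (c1) = (c2 + c5 + c6) - (c1 + c2 + c5)" by (simp add: algebra_simps)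
    then show "c6 = c1" by (simp add: eqs)
  qed
  have "f = lin_comb (proper_basis 3 0) (\<lambda>k. [c1, c2] ! k)"
    unfolding c s
    by (intro word_eqI) (simp add: proper_basis_def lin_comb_nth mono_normal ring_distribs lookup_simps)
  then show ?thesis by blast
qed

lemma proper_21:
  fixes f :: "'k::field_char_0 free_alg"
  shows "f \<in> proper (std_letters 2 1) \<Longrightarrow> \<exists>c. f = lin_comb (proper_basis 2 1) c"
proof -
  assume f: "f \<in> proper (std_letters 2 1)"
  then have m: "f \<in> mlin {Y 0, Y 1, Z 0}" and e: "erase_Y 0 f = 0" "erase_Y 1 f = 0"
    unfolding proper_iff std_letters_small by blast+
  obtain c1 c2 c3 c4 c5 c6 where c: "f = scale c1 (mono_of [Y 0, Y 1, Z 0]) + scale c2 (mono_of [Y 0, Z 0, Y 1])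
      + scale c3 (mono_of [Y 1, Y 0, Z 0]) + scale c4 (mono_of [Y 1, Z 0, Y 0])
      + scale c5 (mono_of [Z 0, Y 0, Y 1]) + scale c6 (mono_of [Z 0, Y 1, Y 0])"
    by (rule mlin_3E[OF m]) simp_all
  note lk = arg_cong[where f = "\<lambda>f. lookup f (Word xs)" for xs]
  have eqs: "c1 + c3 + c4 = 0" "c2 + c5 + c6 = 0" "c1 + c2 + c3 = 0" "c4 + c5 + c6 = 0"
    using lk[OF e(1), of "[Y 1, Z 0]"] lk[OF e(1), of "[Z 0, Y 1]"] lk[OF e(2), of "[Y 0, Z 0]"]
      lk[OF e(2), of "[Z 0, Y 0]"]
    unfolding c by (simp_all add: erase_Y_simps erase_Y_mono lookup_simps)
  define t where "t = - c2 / 2"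
  have c2: "c2 = - (t + t)" by (simp add: t_def field_simps)
  have s: "c4 = c2" "c3 = - c2 - c1" "c6 = - c2 - c5"
  proof -
    have "c4 - (c2) = (c1 + c3 + c4) - (c1 + c2 + c3)" by (simp add: algebra_simps)
    then show "c4 = c2" by (simp add: eqs)
    have "c3 - (- c2 - c1) = (c1 + c2 + c3)" by (simp add: algebra_simps)
    then show "c3 = - c2 - c1" by (simp add: eqs)
    have "c6 - (- c2 - c5) = (c2 + c5 + c6)" by (simp add: algebra_simps)
    then show "c6 = - c2 - c5" by (simp add: eqs)
  qed
  have "f = lin_comb (proper_basis 2 1) (\<lambda>k. [t, c1 - t, c5 - t] ! k)"
    unfolding c s c2
    by (intro word_eqI) (simp add: proper_basis_def lin_comb_nth mono_normal ring_distribs lookup_simps)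
  then show ?thesis by blast
qed

lemma proper_12:
  fixes f :: "'k::field_char_0 free_alg"
  shows "f \<in> proper (std_letters 1 2) \<Longrightarrow> \<exists>c. f = lin_comb (proper_basis 1 2) c"
proof -
  assume f: "f \<in> proper (std_letters 1 2)"
  then have m: "f \<in> mlin {Y 0, Z 0, Z 1}" and e: "erase_Y 0 f = 0"
    unfolding proper_iff std_letters_small by blast+
  obtain c1 c2 c3 c4 c5 c6 where c: "f = scale c1 (mono_of [Y 0, Z 0, Z 1]) + scale c2 (mono_of [Y 0, Z 1, Z 0])
      + scale c3 (mono_of [Z 0, Y 0, Z 1]) + scale c4 (mono_of [Z 0, Z 1, Y 0])
      + scale c5 (mono_of [Z 1, Y 0, Z 0]) + scale c6 (mono_of [Z 1, Z 0, Y 0])"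
    by (rule mlin_3E[OF m]) simp_all
  note lk = arg_cong[where f = "\<lambda>f. lookup f (Word xs)" for xs]
  have eqs: "c1 + c3 + c4 = 0" "c2 + c5 + c6 = 0"
    using lk[OF e, of "[Z 0, Z 1]"] lk[OF e, of "[Z 1, Z 0]"]
    unfolding c by (simp_all add: erase_Y_simps erase_Y_mono lookup_simps)
  have s: "c4 = - c1 - c3" "c6 = - c2 - c5"
  proof -
    have "c4 - (- c1 - c3) = (c1 + c3 + c4)" by (simp add: algebra_simps)
    then show "c4 = - c1 - c3" by (simp add: eqs)
    have "c6 - (- c2 - c5) = (c2 + c5 + c6)" by (simp add: algebra_simps)
    then show "c6 = - c2 - c5" by (simp add: eqs)
  qed
  have "f = lin_comb (proper_basis 1 2) (\<lambda>k. [(c3 + c5) / 2, (c3 - c5) / 2, (c1 + c2) / 2, (c1 - c2) / 2] ! k)"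
    unfolding c s
    by (intro word_eqI)
      (auto simp: proper_basis_def lin_comb_nth numeral_3_eq_3 mono_normal ring_distribs lookup_simps field_simps)
  then show ?thesis by blast
qed

text \<open>
  The coefficients are obtained by projecting to the isotypic components: the first two from the sum
  and the alternating sum of all coefficients, the others by comparing the total coefficients with which a variable occurs in two
  neighbouring positions.
\<close>

lemma proper_03:
  fixes f :: "'k::field_char_0 free_alg"
  shows "f \<in> proper (std_letters 0 3) \<Longrightarrow> \<exists>c. f = lin_comb (proper_basis 0 3) c"
proof -
  assume f: "f \<in> proper (std_letters 0 3)"
  then have m: "f \<in> mlin {Z 0, Z 1, Z 2}"
    unfolding proper_iff std_letters_small by blast+
  obtain c1 c2 c3 c4 c5 c6 where c: "f = scale c1 (mono_of [Z 0, Z 1, Z 2]) + scale c2 (mono_of [Z 0, Z 2, Z 1])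
      + scale c3 (mono_of [Z 1, Z 0, Z 2]) + scale c4 (mono_of [Z 1, Z 2, Z 0])
      + scale c5 (mono_of [Z 2, Z 0, Z 1]) + scale c6 (mono_of [Z 2, Z 1, Z 0])"
    by (rule mlin_3E[OF m]) simp_all
  have "f = lin_comb (proper_basis 0 3) (\<lambda>k. [(c1 + c2 + c3 + c4 + c5 + c6) / 6, (c1 - c2 - c3 + c4 + c5 - c6) / 6,
      (c2 + c5 - c1 - c6) / 3, (c1 + c3 - c2 - c4) / 3, (c3 + c4 - c1 - c6) / 3, (c5 + c6 - c2 - c4) / 3] ! k)"
    unfolding c
    by (intro word_eqI)
      (auto simp: proper_basis_def lin_comb_nth numeral_eq_Suc mono_normal ring_distribs lookup_simps field_simps)
  then show ?thesis by blast
qed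

lemma proper_lin_comb:
  fixes f :: "'k::field_char_0 free_alg"
  assumes "(r, s) \<in> small_types" "f \<in> proper (std_letters r s)"
  shows "\<exists>c. f = lin_comb (proper_basis r s) c"
proof (cases "(r, s) = (1, 0)")
  case True
  then have "f = lin_comb (proper_basis r s) (\<lambda>_. 0)"
    using assms(2) proper_10[of f] by (simp add: lin_comb_def)
  then show ?thesis by blast
next
  case False
  then show ?thesis
    using assms proper_01[of f] proper_20[of f] proper_11[of f] proper_02[of f] proper_30[of f]
      proper_21[of f] proper_12[of f] proper_03[of f]
    unfolding small_types_def by blast
qed

lemma finite_std_letters [simp]: "finite (std_letters r s)"
  by (simp add: std_letters_def)

lemma codim_by_proper_basis:
  fixes I :: "'k::field_char_0 free_alg set"
  assumes rs: "(r, s) \<in> small_types" and I: "T2_ideal I" and S: "S \<subseteq> {..<length (proper_basis r s :: 'k free_alg list)}"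
    and iff: "\<And>c. lin_comb (proper_basis r s) c \<in> I \<longleftrightarrow> (\<forall>k\<in>S. c k = 0)"
  shows "proper_codim I r s = card S"
  unfolding proper_codim_def
proof (rule codim_by_coordinates[OF fin_space_proper[OF finite_std_letters] T2_subspace[OF I]])
  let ?bs = "proper_basis r s :: 'k free_alg list"
  show "finite {..<length ?bs}" "S \<subseteq> {..<length ?bs}" using S by simp_all
  show "?bs ! k \<in> proper (std_letters r s)" if "k \<in> {..<length ?bs}" for k
    using that by (intro proper_basis_in_proper[OF rs] nth_mem) simp
  show "\<exists>c. v = (\<Sum>k<length ?bs. scale (c k) (?bs ! k))" if "v \<in> proper (std_letters r s)" for v
    using proper_lin_comb[OF rs that] by (simp add: lin_comb_def)
  show "((\<Sum>k<length ?bs. scale (c k) (?bs ! k)) \<in> I) = (\<forall>k\<in>S. c k = 0)" for c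
    using iff[of c] by (simp add: lin_comb_def)
qed

text \<open>
  An upper bound for the codimension: only the basis elements that are not recognized as elements of
  \<open>I\<close> are counted.
\<close>

lemma proper_codim_le:
  fixes I :: "'k::field_char_0 free_alg set"
  assumes rs: "(r, s) \<in> small_types" and I: "T2_ideal I" and S: "set S \<subseteq> set (proper_basis r s)"
    and rest: "\<And>b. b \<in> set (proper_basis r s) \<Longrightarrow> b \<in> set S \<or> b \<in> I"
  shows "proper_codim I r s \<le> length S"
proof -
  have "proper_codim I r s \<le> card (set S)"
    unfolding proper_codim_def
  proof (rule codim_le[OF fin_space_proper[OF finite_std_letters] T2_subspace[OF I]])
    show "set S \<subseteq> proper (std_letters r s)" using S proper_basis_in_proper[OF rs] by blast
    fix v :: "'k free_alg" assume "v \<in> proper (std_letters r s)"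
    then obtain c where v: "v = lin_comb (proper_basis r s) c" using proper_lin_comb[OF rs] by blast
    have "v \<in> {s + i | s i. s \<in> free_alg.span (set S) \<and> i \<in> I}"
      unfolding v
    proof (rule lin_comb_in_subspace[OF free_alg.subspace_sums[OF free_alg.subspace_span T2_subspace[OF I]]])
      fix b :: "'k free_alg" assume "b \<in> set (proper_basis r s)"
      then consider "b \<in> set S" | "b \<in> I" using rest by blast
      then show "b \<in> {s + i | s i. s \<in> free_alg.span (set S) \<and> i \<in> I}"
      proof cases
        case 1
        then have "b = b + 0" "b \<in> free_alg.span (set S)" by (auto intro: free_alg.span_base)
        then show ?thesis using T2_zero[OF I] by blast
      next
        case 2
        then have "b = 0 + b" "(0::'k free_alg) \<in> free_alg.span (set S)" by (auto intro: free_alg.span_zero)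
        then show ?thesis using 2 by blast
      qed
    qed
    then obtain t i where "v = t + i" "t \<in> free_alg.span (set S)" "i \<in> I" by blast
    then show "\<exists>s\<in>free_alg.span (set S). v - s \<in> I" by (intro bexI[of _ t]) simp_all
  qed simp
  also have "\<dots> \<le> length S" by (rule card_length)
  finally show ?thesis .
qed

lemma proper_codim_eq_0:
  fixes I :: "'k::field_char_0 free_alg set"
  assumes rs: "(r, s) \<in> small_types" and I: "T2_ideal I"
  shows "proper_codim I r s = 0 \<longleftrightarrow> set (proper_basis r s) \<subseteq> I"
proof
  assume "proper_codim I r s = 0"
  then have "proper (std_letters r s) \<subseteq> I"
    unfolding proper_codim_def by (subst (asm) codim_eq_0[OF fin_space_proper[OF finite_std_letters] T2_subspace[OF I]])
  then show "set (proper_basis r s) \<subseteq> I" using proper_basis_in_proper[OF rs] by blast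
next
  assume "set (proper_basis r s) \<subseteq> I"
  then show "proper_codim I r s = 0" using proper_codim_le[OF rs I, of "[]"] by auto
qed

subsection \<open>Proper polynomials of low degree are Y-proper\<close>

lemma Y_proper_intros:
  shows Y_proper_Z: "z i \<in> Y_proper"
    and Y_proper_comm: "f \<in> brackets \<Longrightarrow> g \<in> brackets \<Longrightarrow> comm f g \<in> Y_proper"
    and Y_proper_add: "f \<in> Y_proper \<Longrightarrow> g \<in> Y_proper \<Longrightarrow> f + g \<in> Y_proper"
    and Y_proper_mult: "f \<in> Y_proper \<Longrightarrow> g \<in> Y_proper \<Longrightarrow> f * g \<in> Y_proper"
    and Y_proper_scale: "f \<in> Y_proper \<Longrightarrow> scale c f \<in> Y_proper"
  unfolding Y_proper_def by (blast intro: subalg_gen.intros)+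

lemma Y_proper_diff: "f \<in> Y_proper \<Longrightarrow> g \<in> Y_proper \<Longrightarrow> f - g \<in> Y_proper"
  using Y_proper_add[of f "scale (-1) g"] Y_proper_scale[of g "-1"] by simp

lemma subspace_Y_proper: "free_alg.subspace (Y_proper :: 'k::field free_alg set)"
proof -
  have "(0::'k free_alg) \<in> Y_proper" using Y_proper_scale[OF Y_proper_Z, of 0 0] by simp
  then show ?thesis unfolding free_alg.subspace_def by (auto intro: Y_proper_add Y_proper_scale)
qed

lemma proper_basis_Y_proper:
  assumes "(r, s) \<in> small_types" "b \<in> set (proper_basis r s)"
  shows "b \<in> Y_proper"
proof -
  have leib: "comm (y 0) (z 0 * z 1 + z 1 * z 0)
      = comm (y 0) (z 0) * z 1 + z 0 * comm (y 0) (z 1) + comm (y 0) (z 1) * z 0 + z 1 * comm (y 0) (z 0)"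
    by (simp add: algebra_simps)
  have leib: "comm (y 0) (z 0 * z 1 + z 1 * z 0) \<in> Y_proper"
    unfolding leib by (intro Y_proper_intros brackets.letter)
  have c: "comm (var u) (var v) \<in> Y_proper" "comm (comm (var u) (var v)) (var w) \<in> Y_proper"
    "comm (var u) (comm (var v) (var w)) \<in> Y_proper" for u v w
    by (intro Y_proper_comm brackets.intros)+
  show ?thesis
    using assms unfolding small_types_def
    by (auto simp: proper_basis_def leib c Y_proper_Z simp del: One_nat_def)
      (rule c Y_proper_Z | rule Y_proper_add Y_proper_mult Y_proper_diff)+
qed

lemma small_typesI: "r + s \<in> {1, 2, 3} \<Longrightarrow> (r, s) \<in> small_types"
  unfolding small_types_def insert_iff empty_iff prod.inject by presburger

text \<open>
  In degree at most three the elements of the explicit bases are visibly Y-proper, and renaming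
  variables transports this to arbitrary indices.
\<close>

lemma proper_subset_Gam:
  assumes n: "n \<in> {1, 2, 3}" and T: "T \<subseteq> {..<n}"
  shows "proper (multideg n T) \<subseteq> (Gam n :: 'k::field_char_0 free_alg set)"
proof
  fix f :: "'k free_alg" assume f: "f \<in> proper (multideg n T)"
  let ?P = "{..<n} - T" and ?L = "std_letters (card ({..<n} - T)) (card T)"
  have fin: "finite ?P" "finite T" using T finite_subset by auto
  have "card ?P + card T = n" using card_Diff_subset[OF fin(2) T] card_mono[OF _ T] by simp
  then have "(card ?P, card T) \<in> small_types" using n by (intro small_typesI) simp
  then have std: "proper ?L \<subseteq> (Y_proper :: 'k free_alg set)"
    using proper_lin_comb proper_basis_Y_proper lin_comb_in_subspace[OF subspace_Y_proper] by blast
  obtain p q where p: "keeps_parity p" "keeps_parity q" "p ` multideg n T = ?L"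
    and inv: "\<And>x. x \<in> multideg n T \<Longrightarrow> q (p x) = x"
    unfolding multideg_def using letter_renaming[OF fin] by metis
  have "inj_on p (multideg n T)" using inv by (metis inj_on_inverseI)
  then have "rename p f \<in> Y_proper" using rename_proper[OF p(1) _ f] p(3) std by auto
  then have "rename q (rename p f) \<in> Y_proper" using p(2) by (rule Y_proper_rename)
  moreover have m: "f \<in> mlin (multideg n T)" using f by (simp add: proper_iff)
  ultimately show "f \<in> Gam n"
    using rename_inverse[of f "multideg n T" q p, OF m inv] mlin_subset_multilin[OF T] by (auto simp: Gam_def)
qed

lemma gamma_eq_0_iff:
  fixes I :: "'k::field_char_0 free_alg set"
  assumes I: "T2_ideal I"
  shows "gamma I n = 0 \<longleftrightarrow> (\<forall>T\<subseteq>{..<n}. proper (multideg n T) \<subseteq> I)"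
proof -
  have pc: "proper_codim I (n - card T) (card T) = 0 \<longleftrightarrow> proper (multideg n T) \<subseteq> I" if T: "T \<subseteq> {..<n}" for T
  proof -
    have fin: "finite T" using T finite_subset by blast
    have "proper_codim I (n - card T) (card T) = codim (proper (multideg n T)) I"
      unfolding multideg_def using codim_proper_rename[OF I _ fin, of "{..<n} - T"] T fin
      by (simp add: card_Diff_subset)
    moreover have "finite (multideg n T)" using fin by (simp add: multideg_def)
    ultimately show ?thesis using codim_eq_0[OF fin_space_proper T2_subspace[OF I]] by metis
  qed
  have "gamma I n = 0 \<longleftrightarrow> (\<forall>r\<le>n. proper_codim I (n - r) r = 0)"
    by (auto simp: gamma_def)
  also have "\<dots> \<longleftrightarrow> (\<forall>T\<subseteq>{..<n}. proper_codim I (n - card T) (card T) = 0)"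
  proof
    assume h: "\<forall>T\<subseteq>{..<n}. proper_codim I (n - card T) (card T) = 0"
    show "\<forall>r\<le>n. proper_codim I (n - r) r = 0"
    proof (intro allI impI)
      fix r assume "r \<le> n"
      then show "proper_codim I (n - r) r = 0" using h[rule_format, of "{..<r}"] by simp
    qed
  next
    assume h: "\<forall>r\<le>n. proper_codim I (n - r) r = 0"
    show "\<forall>T\<subseteq>{..<n}. proper_codim I (n - card T) (card T) = 0"
      using h card_mono[of "{..<n}"] by fastforce
  qed
  finally show ?thesis using pc by simp
qed

lemma Gam_subset_iff:
  fixes I :: "'k::field_char_0 free_alg set"
  assumes I: "T2_ideal I"
  shows "gamma I n = 0 \<Longrightarrow> Gam n \<subseteq> I"
    and "n \<in> {1, 2, 3} \<Longrightarrow> Gam n \<subseteq> I \<Longrightarrow> gamma I n = 0"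
proof -
  show "Gam n \<subseteq> I" if g: "gamma I n = 0"
  proof
    fix f :: "'k free_alg" assume f: "f \<in> Gam n"
    have "restr (multideg n T) f \<in> I" if "T \<in> Pow {..<n}" for T
      using restr_Gam[OF f, of T] that g unfolding gamma_eq_0_iff[OF I] by blast
    then have "(\<Sum>T\<in>Pow {..<n}. restr (multideg n T) f) \<in> I" by (intro T2_sum[OF I])
    then show "f \<in> I" using multilin_sum_restr[of f n] f by (simp add: Gam_def)
  qed
  show "gamma I n = 0" if "n \<in> {1, 2, 3}" "Gam n \<subseteq> I"
    unfolding gamma_eq_0_iff[OF I] using proper_subset_Gam[OF that(1)] that(2) by blast
qed

text \<open>
  The components of an element of a T2-ideal lie in the T2-ideal, and so do their renamings to the
  standard letters.
\<close>

lemma Gam_Int_trivial: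
  fixes I :: "'k::field_char_0 free_alg set"
  assumes I: "T2_ideal I" and triv: "\<And>r. r \<le> n \<Longrightarrow> proper (std_letters (n - r) r) \<inter> I \<subseteq> {0}"
  shows "Gam n \<inter> I = {0}"
proof -
  have "f = 0" if f: "f \<in> Gam n" "f \<in> I" for f
  proof -
    have "restr (multideg n T) f = 0" if T: "T \<in> Pow {..<n}" for T
    proof -
      have fin: "finite ({..<n} - T)" "finite T" using T finite_subset by auto
      have card: "card ({..<n} - T) = n - card T" "card T \<le> n"
        using T fin card_mono[of "{..<n}" T] by (auto simp: card_Diff_subset)
      have pr: "restr (multideg n T) f \<in> proper (multideg n T)" using restr_Gam[OF f(1)] T by blast
      obtain p q where p: "keeps_parity p" "keeps_parity q" "p ` multideg n T = std_letters (n - card T) (card T)"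
        and inv: "\<And>x. x \<in> multideg n T \<Longrightarrow> q (p x) = x"
        unfolding multideg_def card(1)[symmetric] using letter_renaming[OF fin] by metis
      have "inj_on p (multideg n T)" using inv by (metis inj_on_inverseI)
      then have "rename p (restr (multideg n T) f) \<in> proper (std_letters (n - card T) (card T))"
        using rename_proper[OF p(1) _ pr] p(3) by simp
      moreover have "restr (multideg n T) f \<in> I"
        unfolding restr_def by (rule T2_subst[OF I f(2) graded_subst_restr])
      then have "rename p (restr (multideg n T) f) \<in> I"
        unfolding rename_def by (rule T2_subst[OF I _ graded_subst_rename[OF p(1)]])
      ultimately have "rename p (restr (multideg n T) f) = 0" using triv[OF card(2)] by blast
      then have "rename q (rename p (restr (multideg n T) f)) = 0" by (simp add: rename_def)
      moreover have "rename q (rename p (restr (multideg n T) f)) = restr (multideg n T) f"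
        using pr inv by (intro rename_inverse[of _ "multideg n T"]) (auto simp: proper_iff)
      ultimately show ?thesis by simp
    qed
    then show ?thesis using multilin_sum_restr[of f n] f(1) by (simp add: Gam_def)
  qed
  moreover have "0 \<in> Gam n \<inter> I" using T2_zero[OF I] free_alg.subspace_0[OF subspace_Gam] by blast
  ultimately show ?thesis by blast
qed

section \<open>Consequences of identities of degree at most two\<close>

lemma proper_basis_simps:
  "proper_basis 1 0 = []"
  "proper_basis 0 1 = [z 0]"
  "proper_basis 2 0 = [comm (y 0) (y 1)]"
  "proper_basis 1 1 = [comm (y 0) (z 0)]"
  "proper_basis 0 2 = [z 0 * z 1 + z 1 * z 0, comm (z 0) (z 1)]"
  "proper_basis 3 0 = [comm (comm (y 0) (y 1)) (y 2), comm (comm (y 0) (y 2)) (y 1)]"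
  "proper_basis 2 1 = [comm (comm (z 0) (y 0)) (y 1) + comm (comm (z 0) (y 1)) (y 0), comm (y 0) (y 1) * z 0, z 0 * comm (y 0) (y 1)]"
  "proper_basis 1 2 = [z 0 * comm (y 0) (z 1) + z 1 * comm (y 0) (z 0), z 0 * comm (y 0) (z 1) - z 1 * comm (y 0) (z 0),
        comm (y 0) (z 0 * z 1 + z 1 * z 0), comm (y 0) (comm (z 0) (z 1))]"
  "proper_basis 0 3 =
     [z 0 * z 1 * z 2 + z 0 * z 2 * z 1 + z 1 * z 0 * z 2 + z 1 * z 2 * z 0 + z 2 * z 0 * z 1 + z 2 * z 1 * z 0,
      z 0 * z 1 * z 2 - z 0 * z 2 * z 1 - z 1 * z 0 * z 2 + z 1 * z 2 * z 0 + z 2 * z 0 * z 1 - z 2 * z 1 * z 0,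
      z 0 * z 2 * z 1 - z 1 * z 2 * z 0 + z 2 * z 0 * z 1 - z 2 * z 1 * z 0,
      z 0 * z 1 * z 2 - z 2 * z 1 * z 0 + z 1 * z 0 * z 2 - z 1 * z 2 * z 0,
      z 1 * z 2 * z 0 - z 0 * z 2 * z 1 + z 1 * z 0 * z 2 - z 0 * z 1 * z 2,
      z 2 * z 1 * z 0 - z 0 * z 1 * z 2 + z 2 * z 0 * z 1 - z 0 * z 2 * z 1]"
  by (simp_all add: proper_basis_def)

lemma small_types_simps [simp]:
  "(1, 0) \<in> small_types" "(0, 1) \<in> small_types" "(2, 0) \<in> small_types" "(1, 1) \<in> small_types"
  "(0, 2) \<in> small_types" "(3, 0) \<in> small_types" "(2, 1) \<in> small_types" "(1, 2) \<in> small_types"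
  "(0, 3) \<in> small_types" "(Suc 0, 0) \<in> small_types" "(0, Suc 0) \<in> small_types"
  "(Suc 0, Suc 0) \<in> small_types" "(2, Suc 0) \<in> small_types" "(Suc 0, 2) \<in> small_types"
  by (simp_all add: small_types_def)

lemma scale_double: "scale (2 * c) f = scale c f + scale c f"
  by (simp only: mult_2 free_alg.scale_left_distrib)

context
  fixes I :: "'k::field_char_0 free_alg set"
  assumes I: "T2_ideal I"
begin

lemma T2_scale_notin: "scale c f \<in> I \<Longrightarrow> f \<notin> I \<Longrightarrow> c = 0"
  using T2_scale_cancel[OF I] by blast

text \<open>
  If every relation between the basis elements modulo \<open>I\<close> only involves elements of \<open>I\<close>, the codimension
  counts the basis elements outside \<open>I\<close>.
\<close>

lemma proper_codim_independent:
  assumes rs: "(r, s) \<in> small_types"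
    and ind: "\<And>c k. lin_comb (proper_basis r s) c \<in> I \<Longrightarrow> k < length (proper_basis r s :: 'k free_alg list)
      \<Longrightarrow> proper_basis r s ! k \<notin> I \<Longrightarrow> c k = 0"
  shows "proper_codim I r s = card {k. k < length (proper_basis r s :: 'k free_alg list) \<and> proper_basis r s ! k \<notin> I}"
proof (rule codim_by_proper_basis[OF rs I])
  fix c
  show "lin_comb (proper_basis r s) c \<in> I \<longleftrightarrow>
    (\<forall>k\<in>{k. k < length (proper_basis r s :: 'k free_alg list) \<and> proper_basis r s ! k \<notin> I}. c k = 0)"
  proof
    assume h: "\<forall>k\<in>{k. k < length (proper_basis r s :: 'k free_alg list) \<and> proper_basis r s ! k \<notin> I}. c k = 0"
    show "lin_comb (proper_basis r s) c \<in> I"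
      unfolding lin_comb_def
    proof (rule T2_sum[OF I])
      fix k assume "k \<in> {..<length (proper_basis r s :: 'k free_alg list)}"
      then show "scale (c k) (proper_basis r s ! k) \<in> I"
        using h by (cases "proper_basis r s ! k \<in> I") (auto intro: T2_scale[OF I] T2_zero[OF I])
    qed
  qed (use ind in blast)
qed auto

lemma proper_codim_single:
  assumes rs: "(r, s) \<in> small_types" and b: "proper_basis r s = [b]"
  shows "proper_codim I r s = (if b \<in> I then 0 else 1)"
proof -
  have "proper_codim I r s = card {k. k < length [b] \<and> [b] ! k \<notin> I}"
    unfolding b[symmetric]
    by (rule proper_codim_independent[OF rs]) (auto simp: b lin_comb_nth dest: T2_scale_notin)
  moreover have "k < length [b] \<and> [b] ! k \<notin> I \<longleftrightarrow> k = 0 \<and> b \<notin> I" for k by (cases k) auto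
  ultimately show ?thesis by simp
qed

lemma proper_codim_01: "proper_codim I 0 1 = (if z 0 \<in> I then 0 else 1)"
  and proper_codim_20: "proper_codim I 2 0 = (if comm (y 0) (y 1) \<in> I then 0 else 1)"
  and proper_codim_11: "proper_codim I 1 1 = (if comm (y 0) (z 0) \<in> I then 0 else 1)"
  by (rule proper_codim_single; simp add: proper_basis_simps[simplified])+

lemma proper_codim_10: "proper_codim I 1 0 = 0"
  by (subst proper_codim_eq_0[OF _ I]) (simp_all add: proper_basis_simps[simplified])

lemma proper_codim_bounds:
  "proper_codim I 3 0 \<le> 2" "proper_codim I 2 1 \<le> 3" "proper_codim I 1 2 \<le> 4" "proper_codim I 0 3 \<le> 6"
  using proper_codim_le[OF _ I, of 3 0 "proper_basis 3 0"] proper_codim_le[OF _ I, of 2 1 "proper_basis 2 1"]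
    proper_codim_le[OF _ I, of 1 2 "proper_basis 1 2"] proper_codim_le[OF _ I, of 0 3 "proper_basis 0 3"]
  by (simp_all add: proper_basis_simps[simplified])

lemma graded_subst_two:
  assumes "even_poly f \<and> even_poly g \<and> a = Y 0 \<and> b = Y 1 \<or> even_poly f \<and> odd_poly g \<and> a = Y 0 \<and> b = Z 0
    \<or> odd_poly f \<and> odd_poly g \<and> a = Z 0 \<and> b = Z 1"
  shows "graded_subst (\<lambda>x. if x = a then f else if x = b then g else 0)"
  using assms by (auto simp: graded_subst_def)

lemma commuting_evens:
  assumes "comm (y 0) (y 1) \<in> I" "even_poly f" "even_poly g"
  shows "comm f g \<in> I"
  using T2_subst[OF I assms(1) graded_subst_two[of f g "Y 0" "Y 1"]] assms by (simp add: subst_alg_simps)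

lemma commuting_even_odd:
  assumes "comm (y 0) (z 0) \<in> I" "even_poly f" "odd_poly g"
  shows "comm f g \<in> I"
  using T2_subst[OF I assms(1) graded_subst_two[of f g "Y 0" "Z 0"]] assms by (simp add: subst_alg_simps)

lemma commuting_odds:
  assumes "comm (z 0) (z 1) \<in> I" "odd_poly f" "odd_poly g"
  shows "comm f g \<in> I"
  using T2_subst[OF I assms(1) graded_subst_two[of f g "Z 0" "Z 1"]] assms by (simp add: subst_alg_simps)

lemma anticommuting_odds:
  assumes "z 0 * z 1 + z 1 * z 0 \<in> I" "odd_poly f" "odd_poly g"
  shows "f * g + g * f \<in> I"
  using T2_subst[OF I assms(1) graded_subst_two[of f g "Z 0" "Z 1"]] assms by (simp add: subst_alg_simps)

text \<open>
  Symmetric and skew-symmetric part can be separated, so both of them matter independently.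
\<close>

lemma proper_codim_02:
  "proper_codim I 0 2 = (if z 0 * z 1 + z 1 * z 0 \<in> I then 0 else 1) + (if comm (z 0) (z 1) \<in> I then 0 else 1)"
proof -
  let ?S = "z 0 * z 1 + z 1 * z 0 :: 'k free_alg" and ?D = "comm (z 0) (z 1) :: 'k free_alg"
  have ind: "(c 0 = 0 \<or> ?S \<in> I) \<and> (c 1 = 0 \<or> ?D \<in> I)" if h: "scale (c 0) ?S + scale (c 1) ?D \<in> I" for c :: "nat \<Rightarrow> 'k"
  proof -
    \<comment> \<open>Exchanging the two variables fixes the first summand and negates the second.\<close>
    have "scale (c 0) ?S - scale (c 1) ?D \<in> I"
      using T2_subst[OF I h graded_subst_two[of "z 1" "z 0" "Z 0" "Z 1"]]
      by (simp add: subst_alg_simps free_alg.scale_right_diff_distrib free_alg.scale_right_distrib algebra_simps)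
    note h' = this
    have e: "f + f = (f + g) + (f - g)" "g + g = (f + g) - (f - g)" for f g :: "'k free_alg" by simp_all
    have "scale (2 * c 0) ?S \<in> I"
      unfolding scale_double e(1)[of "scale (c 0) ?S" "scale (c 1) ?D"] by (rule T2_add[OF I h h'])
    moreover have "scale (2 * c 1) ?D \<in> I"
      unfolding scale_double e(2)[of "scale (c 1) ?D" "scale (c 0) ?S"] by (rule T2_diff[OF I h h'])
    ultimately have "?S \<in> I \<or> 2 * c 0 = 0" "?D \<in> I \<or> 2 * c 1 = 0" using T2_scale_notin by blast+
    then show ?thesis by auto
  qed
  have bs: "proper_basis 0 2 = [?S, ?D]" by (simp add: proper_basis_simps)
  have "proper_codim I 0 2 = card {k. k < length [?S, ?D] \<and> [?S, ?D] ! k \<notin> I}"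
    unfolding bs[symmetric]
  proof (rule proper_codim_independent, goal_cases)
    case (2 c k)
    then show ?case using ind[of c] unfolding bs by (auto simp: lin_comb_nth less_Suc_eq)
  qed simp
  moreover have "k < length [?S, ?D] \<and> [?S, ?D] ! k \<notin> I \<longleftrightarrow> k = 0 \<and> ?S \<notin> I \<or> k = 1 \<and> ?D \<notin> I" for k
    by (auto simp: nth_Cons less_Suc_eq)
  then have "{k. k < length [?S, ?D] \<and> [?S, ?D] ! k \<notin> I} = (if ?S \<in> I then {} else {0}) \<union> (if ?D \<in> I then {} else {1})"
    by auto
  ultimately show ?thesis by simp
qed

text \<open>
  The proper polynomials in three even variables form an irreducible module over the symmetric group,
  and the space of identities is a submodule. Irreducibility is verified on coordinates: two
  transpositions turn a single nontrivial relation into enough relations to force both basis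
  elements into \<open>I\<close>.
\<close>

lemma proper_codim_30: "proper_codim I 3 0 \<in> {0, 2}"
proof -
  let ?a = "comm (comm (y 0) (y 1)) (y 2) :: 'k free_alg" and ?b = "comm (comm (y 0) (y 2)) (y 1) :: 'k free_alg"
  have bs: "proper_basis 3 0 = [?a, ?b]" by (simp add: proper_basis_simps)
  have sub: "subst_alg (\<lambda>x. var (case x of Y i \<Rightarrow> Y (p i) | Z i \<Rightarrow> Z i)) f \<in> I" if "f \<in> I" for p f
    by (rule T2_subst[OF I that]) (simp add: graded_subst_def)
  have sw12: "scale d ?a + scale c ?b \<in> I" if "scale c ?a + scale d ?b \<in> I" for c d
    using sub[OF that, of "Fun.swap 1 2 id"] by (simp add: subst_alg_simps transpose_def add.commute)
  have sw01: "scale d ?b - scale (c + d) ?a \<in> I" if "scale c ?a + scale d ?b \<in> I" for c d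
  proof -
    have jac: "comm (comm (y 1) (y 2)) (y 0) = ?b - ?a" "comm (comm (y 1) (y 0)) (y 2) = - ?a"
      by (simp_all add: algebra_simps)
    have "scale c (comm (comm (y 1) (y 0)) (y 2)) + scale d (comm (comm (y 1) (y 2)) (y 0)) \<in> I"
      using sub[OF that, of "Fun.swap 0 1 id"] by (simp add: subst_alg_simps transpose_def)
    then show ?thesis
      unfolding jac by (simp add: free_alg.scale_left_distrib free_alg.scale_right_diff_distrib algebra_simps)
  qed
  have swab: "?a \<in> I \<longleftrightarrow> ?b \<in> I" using sw12[of 1 0] sw12[of 0 1] by auto
  have ind: "c = 0 \<and> d = 0" if h: "scale c ?a + scale d ?b \<in> I" and na: "?a \<notin> I" for c d
  proof -
    have "scale c (scale c ?a + scale d ?b) - scale d (scale d ?a + scale c ?b) \<in> I"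
      using h sw12[OF h] by (intro T2_diff[OF I] T2_scale[OF I])
    then have "scale (c * c - d * d) ?a \<in> I"
      by (simp add: free_alg.scale_right_distrib free_alg.scale_left_diff_distrib mult.commute
          del: free_alg.scale_right_diff_distrib)
    then have "c * c - d * d = 0" using T2_scale_notin[OF _ na] by blast
    then have cd: "d = c \<or> d = - c" by (simp add: square_eq_iff) (metis minus_minus)
    have d2: "scale c ?a + scale d ?b - (scale d ?b - scale (c + d) ?a) \<in> I"
      using h sw01[OF h] by (rule T2_diff[OF I])
    have "scale (c + (c + d)) ?a \<in> I"
    proof -
      have "f + g = f + h - (h - g)" for f g h :: "'k free_alg" by simp
      then show ?thesis using d2 by (simp only: free_alg.scale_left_distrib[of c "c + d"])
    qed
    then have sum0: "c + (c + d) = 0" by (rule T2_scale_notin[OF _ na])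
    from cd have "c = 0"
    proof
      assume "d = c"
      then have "3 * c = 0" using sum0 by simp
      then show "c = 0" by simp
    next
      assume "d = - c"
      then show "c = 0" using sum0 by simp
    qed
    then show ?thesis using cd by auto
  qed
  show ?thesis
  proof (cases "?a \<in> I")
    case True
    then have "proper_codim I 3 0 = 0" using swab by (subst proper_codim_eq_0[OF _ I]) (auto simp: bs)
    then show ?thesis by simp
  next
    case False
    have "proper_codim I 3 0 = card {0, 1::nat}"
    proof (rule codim_by_proper_basis[OF _ I])
      fix c :: "nat \<Rightarrow> 'k"
      show "(lin_comb (proper_basis 3 0) c \<in> I) = (\<forall>k\<in>{0, 1}. c k = 0)"
        using ind[OF _ False, of "c 0" "c 1"] T2_zero[OF I] by (auto simp: bs lin_comb_nth)
    qed (auto simp: bs)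
    then show ?thesis by simp
  qed
qed

text \<open>
  The commutators \<open>[y\<^sub>0, y\<^sub>1]\<close> times anything are identities, and so is \<open>[y\<^sub>0, z\<^sub>0 z\<^sub>1]\<close> because
  \<open>z\<^sub>0 z\<^sub>1\<close> is even.
\<close>

lemma evens_commute_consequences:
  assumes a: "comm (y 0) (y 1) \<in> I"
  shows "proper_codim I 3 0 = 0" "proper_codim I 2 1 \<le> 1" "proper_codim I 1 2 \<le> 2"
proof -
  have c: "comm (y i) (y j) \<in> I" for i j by (rule commuting_evens[OF a]) simp_all
  show "proper_codim I 3 0 = 0"
    using T2_diff[OF I T2_mult(2)[OF I c] T2_mult(1)[OF I c]]
    by (subst proper_codim_eq_0[OF _ I]) (auto simp: proper_basis_simps)
  show "proper_codim I 2 1 \<le> 1"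
  proof -
    have "proper_codim I 2 1 \<le> length [proper_basis 2 1 ! 0 :: 'k free_alg]"
      by (rule proper_codim_le[OF _ I]) (auto simp: proper_basis_simps[simplified] intro: T2_mult[OF I c])
    then show ?thesis by simp
  qed
  have "comm (y 0) (z 0 * z 1 + z 1 * z 0) \<in> I" "comm (y 0) (comm (z 0) (z 1)) \<in> I"
    by (rule commuting_evens[OF a]; simp add: parity_add even_poly_def free_aut_diff free_aut_add free_aut_mult)+
  then have "proper_codim I 1 2 \<le> length [proper_basis 1 2 ! 0, proper_basis 1 2 ! 1 :: 'k free_alg]"
    by (intro proper_codim_le[OF _ I]) (auto simp: proper_basis_simps[simplified])
  then show "proper_codim I 1 2 \<le> 2" by simp
qed

text \<open>
  The identity also holds with \<open>y z\<close> or \<open>z y\<close> in place of one of the odd variables. Comparing this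
  with the identity for \<open>z\<close> itself shows that the products of \<open>z\<close> and \<open>[y, z']\<close> vanish. In three odd variables all
  monomials become equal up to sign, so that only one basis element survives.
\<close>

lemma odds_signed_commute_consequences:
  assumes r: "z 0 * z 1 + z 1 * z 0 \<in> I \<or> comm (z 0) (z 1) \<in> I"
  shows "proper_codim I 1 2 = 0" "proper_codim I 0 3 \<le> 1"
proof -
  have zc: "z i * comm (y 0) (z j) \<in> I \<and> comm (y 0) (z j) * z i \<in> I" for i j
    using r
  proof
    assume s: "z 0 * z 1 + z 1 * z 0 \<in> I"
    note ac = anticommuting_odds[OF s]
    have "(z i * y 0) * z j + z j * (z i * y 0) - (z i * z j + z j * z i) * y 0 \<in> I"
      by (intro T2_diff[OF I] T2_mult[OF I] ac) simp_all
    moreover have "y 0 * (z j * z i + z i * z j) - (z j * (y 0 * z i) + (y 0 * z i) * z j) \<in> I"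
      by (intro T2_diff[OF I] T2_mult[OF I] ac) simp_all
    ultimately show ?thesis by (simp add: algebra_simps)
  next
    assume s: "comm (z 0) (z 1) \<in> I"
    note ac = commuting_odds[OF s]
    have "comm (z i * y 0) (z j) - comm (z i) (z j) * y 0 \<in> I"
      by (intro T2_diff[OF I] T2_mult[OF I] ac) simp_all
    moreover have "y 0 * comm (z j) (z i) - comm (z j) (y 0 * z i) \<in> I"
      by (intro T2_diff[OF I] T2_mult[OF I] ac) simp_all
    ultimately show ?thesis by (simp add: algebra_simps)
  qed
  have leib: "comm (y 0) (z 0 * z 1 + z 1 * z 0)
      = comm (y 0) (z 0) * z 1 + z 0 * comm (y 0) (z 1) + (comm (y 0) (z 1) * z 0 + z 1 * comm (y 0) (z 0))"
     "comm (y 0) (comm (z 0) (z 1))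
      = comm (y 0) (z 0) * z 1 + z 0 * comm (y 0) (z 1) - (comm (y 0) (z 1) * z 0 + z 1 * comm (y 0) (z 0))"
    by (simp_all add: algebra_simps)
  have "comm (y 0) (z 0 * z 1 + z 1 * z 0) \<in> I" "comm (y 0) (comm (z 0) (z 1)) \<in> I"
    unfolding leib using zc by (auto intro!: T2_add[OF I] T2_diff[OF I])
  then show "proper_codim I 1 2 = 0"
    using zc by (subst proper_codim_eq_0[OF _ I])
      (auto simp: proper_basis_simps[simplified] intro: T2_add[OF I] T2_diff[OF I])
  from r show "proper_codim I 0 3 \<le> 1"
  proof
    assume s: "z 0 * z 1 + z 1 * z 0 \<in> I"
    define S :: "nat \<Rightarrow> nat \<Rightarrow> 'k free_alg" where "S i j = z i * z j + z j * z i" for i j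
    have S: "S i j \<in> I" for i j unfolding S_def by (rule anticommuting_odds[OF s]) simp_all
    have "set (proper_basis 0 3) - {proper_basis 0 3 ! 1} \<subseteq>
      {S 0 1 * z 2 + S 0 2 * z 1 + S 1 2 * z 0, S 0 2 * z 1 - S 1 2 * z 0, S 0 1 * z 2 - S 1 2 * z 0,
       z 1 * S 0 2 - z 0 * S 1 2, z 2 * S 0 1 - z 0 * S 1 2}"
      by (auto simp: proper_basis_simps S_def algebra_simps)
    moreover have "\<dots> \<subseteq> I" using T2_mult[OF I S] by (auto intro!: T2_add[OF I] T2_diff[OF I])
    ultimately have sub: "set (proper_basis 0 3) - {proper_basis 0 3 ! 1} \<subseteq> I" by (rule subset_trans)
    have "proper_basis 0 3 ! 1 \<in> set (proper_basis 0 3 :: 'k free_alg list)"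
      by (rule nth_mem) (simp add: proper_basis_simps(9))
    then have "proper_codim I 0 3 \<le> length [proper_basis 0 3 ! 1 :: 'k free_alg]"
      using sub by (intro proper_codim_le[OF _ I]) auto
    then show ?thesis by simp
  next
    assume s: "comm (z 0) (z 1) \<in> I"
    define C :: "nat \<Rightarrow> nat \<Rightarrow> 'k free_alg" where "C i j = comm (z i) (z j)" for i j
    have C: "C i j \<in> I" for i j unfolding C_def by (rule commuting_odds[OF s]) simp_all
    have "set (proper_basis 0 3) - {proper_basis 0 3 ! 0} \<subseteq>
      {z 0 * C 1 2 + z 1 * C 2 0 + z 2 * C 0 1,
       z 0 * C 2 1 + C 0 1 * z 2 + z 1 * C 0 2 + z 2 * C 0 1,
       z 0 * C 1 2 + C 0 2 * z 1 + z 2 * C 0 1 + z 1 * C 0 2,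
       C 1 0 * z 2 - (z 0 * C 2 1 + C 0 1 * z 2 + z 1 * C 0 2),
       C 2 0 * z 1 - (z 0 * C 1 2 + C 0 2 * z 1 + z 2 * C 0 1)}"
      by (auto simp: proper_basis_simps C_def algebra_simps)
    moreover have "\<dots> \<subseteq> I" using T2_mult[OF I C] by (auto intro!: T2_add[OF I] T2_diff[OF I])
    ultimately have sub: "set (proper_basis 0 3) - {proper_basis 0 3 ! 0} \<subseteq> I" by (rule subset_trans)
    have "proper_basis 0 3 ! 0 \<in> set (proper_basis 0 3 :: 'k free_alg list)"
      by (rule nth_mem) (simp add: proper_basis_simps(9))
    then have "proper_codim I 0 3 \<le> length [proper_basis 0 3 ! 0 :: 'k free_alg]"
      using sub by (intro proper_codim_le[OF _ I]) auto
    then show ?thesis by simp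
  qed
qed

lemma odds_square_zero_consequences:
  assumes "z 0 * z 1 + z 1 * z 0 \<in> I" "comm (z 0) (z 1) \<in> I"
  shows "proper_codim I 0 3 = 0"
proof -
  have "z i * z j \<in> I" for i j
  proof -
    have "(z i * z j + z j * z i) + comm (z i) (z j) \<in> I"
      by (rule T2_add[OF I anticommuting_odds[OF assms(1)] commuting_odds[OF assms(2)]]) simp_all
    then have "scale 2 (z i * z j) \<in> I"
      using scale_double[of 1 "z i * z j :: 'k free_alg"] by simp
    then show ?thesis using T2_scale_cancel[OF I, of 2] by simp
  qed
  from T2_mult(2)[OF I this] show ?thesis
    by (subst proper_codim_eq_0[OF _ I])
      (auto simp: proper_basis_simps[simplified] intro!: T2_add[OF I] T2_diff[OF I])
qed

text \<open>
  Since \<open>y z\<close> is odd and \<open>z z'\<close> is even, \<open>[y\<^sub>0, y\<^sub>1 z] = [y\<^sub>0, y\<^sub>1] z + y\<^sub>1 [y\<^sub>0, z]\<close> and \<open>[z z', z'']\<close> are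
  identities. The first makes \<open>[y\<^sub>0, y\<^sub>1] z\<close> vanish; by the second, products of three odd variables are
  invariant under cyclic rotation, which kills the two-dimensional modules.
\<close>

lemma even_odd_commute_consequences:
  assumes a: "comm (y 0) (z 0) \<in> I"
  shows "proper_codim I 2 1 = 0" "proper_codim I 1 2 = 0" "proper_codim I 0 3 \<le> 2"
proof -
  note c = commuting_even_odd[OF a]
  have "comm (comm (z 0) (y 0)) (y 1) \<in> I" "comm (comm (z 0) (y 1)) (y 0) \<in> I"
    using T2_neg[OF I c[of "y 1" "comm (z 0) (y 0)"]] T2_neg[OF I c[of "y 0" "comm (z 0) (y 1)"]]
    by (simp_all add: odd_poly_def free_aut_diff free_aut_mult)
  moreover have "comm (y 0) (y 1) * z 0 \<in> I"
  proof -
    have "comm (y 0) (y 1 * z 0) - y 1 * comm (y 0) (z 0) \<in> I"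
      by (intro T2_diff[OF I] T2_mult[OF I] c) simp_all
    then show ?thesis by (simp add: algebra_simps)
  qed
  moreover have "z 0 * comm (y 0) (y 1) \<in> I"
  proof -
    have "comm (y 0) (z 0 * y 1) - comm (y 0) (z 0) * y 1 \<in> I"
      by (intro T2_diff[OF I] T2_mult[OF I] c) simp_all
    then show ?thesis by (simp add: algebra_simps)
  qed
  ultimately show "proper_codim I 2 1 = 0"
    by (subst proper_codim_eq_0[OF _ I]) (auto simp: proper_basis_simps[simplified] intro: T2_add[OF I])
  have cz: "comm (y 0) (z i) \<in> I" for i by (rule c) simp_all
  have leib: "comm (y 0) (z 0 * z 1 + z 1 * z 0)
      = comm (y 0) (z 0) * z 1 + z 0 * comm (y 0) (z 1) + (comm (y 0) (z 1) * z 0 + z 1 * comm (y 0) (z 0))"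
     "comm (y 0) (comm (z 0) (z 1))
      = comm (y 0) (z 0) * z 1 + z 0 * comm (y 0) (z 1) - (comm (y 0) (z 1) * z 0 + z 1 * comm (y 0) (z 0))"
    by (simp_all add: algebra_simps)
  have "comm (y 0) (z 0 * z 1 + z 1 * z 0) \<in> I" "comm (y 0) (comm (z 0) (z 1)) \<in> I"
    unfolding leib using T2_mult[OF I cz] by (auto intro!: T2_add[OF I] T2_diff[OF I])
  then show "proper_codim I 1 2 = 0"
    using T2_mult[OF I cz] by (subst proper_codim_eq_0[OF _ I])
      (auto simp: proper_basis_simps[simplified] intro!: T2_add[OF I] T2_diff[OF I])
  define R :: "nat \<Rightarrow> nat \<Rightarrow> nat \<Rightarrow> 'k free_alg" where "R i j k = comm (z i * z j) (z k)" for i j k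
  have R: "R i j k \<in> I" for i j k unfolding R_def by (rule c) simp_all
  have "set (proper_basis 0 3) - set (take 2 (proper_basis 0 3)) \<subseteq>
      {R 2 0 1 - R 2 1 0, R 1 0 2 - R 1 2 0, R 1 2 0 - R 0 2 1, R 2 1 0 - R 0 1 2}"
    by (auto simp: proper_basis_simps R_def algebra_simps)
  moreover have "\<dots> \<subseteq> I" using R by (auto intro!: T2_diff[OF I])
  ultimately have sub: "set (proper_basis 0 3) - set (take 2 (proper_basis 0 3)) \<subseteq> I" by (rule subset_trans)
  then have "proper_codim I 0 3 \<le> length (take 2 (proper_basis 0 3 :: 'k free_alg list))"
    by (intro proper_codim_le[OF _ I]) (auto dest: in_set_takeD)
  then show "proper_codim I 0 3 \<le> 2" by simp
qed

lemma trivial_grading_consequences: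
  assumes z0: "z 0 \<in> I" and s: "s \<noteq> 0" "(r, s) \<in> small_types"
  shows "proper_codim I r s = 0"
proof -
  have "z i \<in> I" for i
    using T2_subst[OF I z0, of "\<lambda>x. case x of Y j \<Rightarrow> 0 | Z j \<Rightarrow> z i"] by (simp add: graded_subst_def)
  note z = this T2_mult[OF I this]
  have d: "comm (z i) (y j) \<in> I" "comm (y j) (z i) \<in> I" "comm (z i) (z j) \<in> I"
    "z i * z j + z j * z i \<in> I" for i j
    using z by (auto intro: T2_diff[OF I] T2_add[OF I])
  note e = T2_mult[OF I d(1)] T2_mult[OF I d(3)] T2_mult[OF I d(4)]
  consider "r = 0 \<and> s = 1" | "r = 1 \<and> s = 1" | "r = 0 \<and> s = 2" | "r = 2 \<and> s = 1" | "r = 1 \<and> s = 2" | "r = 0 \<and> s = 3"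
    using s unfolding small_types_def by auto
  then have "set (proper_basis r s) \<subseteq> I"
  proof cases
    case 4
    then show ?thesis by (simp add: proper_basis_simps[simplified] T2_add[OF I] T2_diff[OF I] z d e)
  next
    case 5
    then show ?thesis by (simp add: proper_basis_simps[simplified] T2_add[OF I] T2_diff[OF I] z d e)
  next
    case 6
    then show ?thesis by (simp add: proper_basis_simps(9) T2_add[OF I] T2_diff[OF I] z)
  qed (simp_all add: proper_basis_simps[simplified] z d)
  then show ?thesis by (subst proper_codim_eq_0[OF s(2) I])
qed

end

section \<open>T2-ideals defined by linear functionals\<close>

definition functional :: "(letter list \<Rightarrow> 'k::field) \<Rightarrow> 'k free_alg \<Rightarrow> 'k"
  where "functional l f = (\<Sum>w\<in>keys f. lookup f w * l (letters w))"

text \<open>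
  The largest T2-ideal in the kernel of the functional: its elements are the polynomials all of whose
  consequences are annihilated.
\<close>

definition core_ideal :: "(letter list \<Rightarrow> 'k::field) \<Rightarrow> 'k free_alg set"
  where "core_ideal l =
    {f. \<forall>\<rho> u v. graded_subst \<rho> \<longrightarrow> functional l (u * subst_alg \<rho> f * v) = 0}"

lemma functional_superset:
  assumes "finite S" "keys f \<subseteq> S"
  shows "functional l f = (\<Sum>w\<in>S. lookup f w * l (letters w))"
  unfolding functional_def using assms by (intro sum.mono_neutral_left) (auto simp: in_keys_iff)

lemma functional_add: "functional l (f + g) = functional l f + functional l g"
proof -
  have fin: "finite (keys f \<union> keys g)" by simp
  note sup = functional_superset[OF fin, of _ l]
  show ?thesis
    unfolding sup[OF keys_add] sup[OF Un_upper1] sup[OF Un_upper2]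
    by (simp add: lookup_add distrib_right sum.distrib)
qed

lemma functional_scale: "functional l (scale c f) = c * functional l f"
proof -
  have "keys (scale c f) \<subseteq> keys f" by (auto simp: in_keys_iff lookup_scale)
  note sup = functional_superset[OF finite_keys[of f] this]
  show ?thesis unfolding sup by (simp add: functional_def lookup_scale sum_distrib_left mult.assoc)
qed

lemma functional_zero [simp]: "functional l 0 = 0"
  by (simp add: functional_def)

lemma functional_diff: "functional l (f - g) = functional l f - functional l g"
  using functional_add[of l "f - g" g] by simp

lemma functional_mono [simp]: "functional l (mono_of xs) = l xs"
  by (simp add: functional_def) (simp add: mono_of_def)

lemma functional_eq_0: "(\<And>w. w \<in> keys f \<Longrightarrow> l (letters w) = 0) \<Longrightarrow> functional l f = 0"
  by (simp add: functional_def)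

lemma graded_subst_comp:
  assumes "graded_subst \<rho>" "graded_subst \<rho>'"
  shows "graded_subst (\<lambda>x. subst_alg \<rho> (\<rho>' x))"
  using assms free_aut_subst_alg[OF assms(1)]
  unfolding graded_subst_def even_poly_def odd_poly_def by (simp add: subst_alg_uminus)

lemma T2_ideal_core_ideal: "T2_ideal (core_ideal l)"
proof (rule T2_idealI)
  show "free_alg.subspace (core_ideal l)"
    unfolding free_alg.subspace_def
    by (auto simp: core_ideal_def subst_alg_simps distrib_left distrib_right functional_add functional_scale)
  fix f g :: "'a free_alg" and \<rho>' :: "letter \<Rightarrow> 'a free_alg"
  assume f: "f \<in> core_ideal l"
  then have h: "functional l (u * subst_alg \<rho> f * v) = 0" if "graded_subst \<rho>" for \<rho> u v
    using that by (simp add: core_ideal_def)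
  show "g * f \<in> core_ideal l"
    unfolding core_ideal_def
  proof (intro CollectI allI impI)
    fix \<rho> :: "letter \<Rightarrow> 'a free_alg" and u v assume "graded_subst \<rho>"
    from h[OF this, of "u * subst_alg \<rho> g" v] show "functional l (u * subst_alg \<rho> (g * f) * v) = 0"
      by (simp add: subst_alg_mult mult.assoc)
  qed
  show "f * g \<in> core_ideal l"
    unfolding core_ideal_def
  proof (intro CollectI allI impI)
    fix \<rho> :: "letter \<Rightarrow> 'a free_alg" and u v assume "graded_subst \<rho>"
    from h[OF this, of u "subst_alg \<rho> g * v"] show "functional l (u * subst_alg \<rho> (f * g) * v) = 0"
      by (simp add: subst_alg_mult mult.assoc)
  qed
  show "subst_alg \<rho>' f \<in> core_ideal l" if "graded_subst \<rho>'"
    unfolding core_ideal_def using h graded_subst_comp[OF _ that] by (simp add: subst_alg_comp)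
qed

lemma T2_ideal_Inter:
  assumes "\<And>J. J \<in> \<J> \<Longrightarrow> T2_ideal J"
  shows "T2_ideal (\<Inter>\<J>)"
proof (rule T2_idealI)
  show "free_alg.subspace (\<Inter>\<J>)"
    using assms T2_subspace by (intro free_alg.subspace_Inter) blast
qed (use assms in \<open>auto intro: T2_mult T2_subst\<close>)

subsection \<open>Reduction to substitutions of words\<close>

definition odd_word :: "letter list \<Rightarrow> bool"
  where "odd_word xs \<longleftrightarrow> odd (length (filter (\<lambda>x. \<exists>i. x = Z i) xs))"

definition good_word :: "letter \<Rightarrow> letter list \<Rightarrow> bool"
  where "good_word x xs \<longleftrightarrow> (case x of Y i \<Rightarrow> \<not> odd_word xs | Z i \<Rightarrow> odd_word xs)"

lemma free_aut_mono: "free_aut (mono_of xs) = (if odd_word xs then - mono_of xs else mono_of xs)"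
proof (induction xs)
  case (Cons x xs)
  then show ?case by (cases x) (auto simp: mono_of_Cons free_aut_mult odd_word_def)
qed (simp add: odd_word_def)

lemma lookup_free_aut:
  "lookup (free_aut f) (Word xs) = (if odd_word xs then - 1 else 1) * lookup f (Word xs)"
  by (induction f rule: free_alg_induct)
    (auto simp: lookup_add lookup_scale free_aut_add free_aut_scale free_aut_mono lookup_mono_of algebra_simps)

text \<open>
  In characteristic different from two, a homogeneous polynomial is a combination of words of its parity.
\<close>

lemma graded_subst_span:
  fixes \<rho> :: "letter \<Rightarrow> 'k::field_char_0 free_alg"
  assumes "graded_subst \<rho>"
  shows "\<rho> x \<in> free_alg.span {mono_of xs | xs. good_word x xs}"
proof -
  have "good_word x xs" if "Word xs \<in> keys (\<rho> x)" for xs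
  proof (rule ccontr)
    assume bad: "\<not> good_word x xs"
    have "lookup (\<rho> x) (Word xs) = - lookup (\<rho> x) (Word xs)"
    proof (cases x)
      case (Y i)
      then show ?thesis
        using assms bad lookup_free_aut[of "\<rho> x" xs]
        by (simp add: graded_subst_def even_poly_def good_word_def)
    next
      case (Z i)
      then show ?thesis
        using assms bad lookup_free_aut[of "\<rho> x" xs]
        by (simp add: graded_subst_def odd_poly_def good_word_def)
    qed
    then show False using that by (simp add: in_keys_iff eq_neg_iff_add_eq_0)
  qed
  then have "(\<Sum>w\<in>keys (\<rho> x). scale (lookup (\<rho> x) w) (mono_of (letters w)))
      \<in> free_alg.span {mono_of xs | xs. good_word x xs}"
    by (intro free_alg.span_sum free_alg.span_scale free_alg.span_base)
      (metis (mono_tags, lifting) mem_Collect_eq word.collapse)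
  then show ?thesis using free_alg_expand[of "\<rho> x"] by simp
qed

lemma subst_linear_in_letter:
  fixes f :: "'k::field free_alg"
  assumes f: "f \<in> mlin L" and x: "x \<in> L"
  shows "subst_alg (\<rho>(x := p + q)) f = subst_alg (\<rho>(x := p)) f + subst_alg (\<rho>(x := q)) f"
    and "subst_alg (\<rho>(x := scale c p)) f = scale c (subst_alg (\<rho>(x := p)) f)"
proof -
  have mono: "subst_alg (\<rho>(x := p)) (mono_of (us @ x # vs)) = subst_alg \<rho> (mono_of us) * p * subst_alg \<rho> (mono_of vs)"
    if "x \<notin> set us" "x \<notin> set vs" for us vs p
  proof -
    have id: "subst_alg (\<rho>(x := p)) (mono_of ws) = subst_alg \<rho> (mono_of ws)" if "x \<notin> set ws" for ws
      using that by (intro subst_alg_cong) auto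
    show ?thesis using id[OF that(1)] id[OF that(2)]
      by (simp add: mono_of_append mono_of_Cons subst_alg_mult mult.assoc)
  qed
  have "subst_alg (\<rho>(x := p + q)) f - subst_alg (\<rho>(x := p)) f - subst_alg (\<rho>(x := q)) f \<in> {0}"
  proof (rule mlin_linear_image[OF f, where d = "\<lambda>f. subst_alg (\<rho>(x := p + q)) f - subst_alg (\<rho>(x := p)) f - subst_alg (\<rho>(x := q)) f"])
    show "Vector_Spaces.linear scale scale (\<lambda>f. subst_alg (\<rho>(x := p + q)) f - subst_alg (\<rho>(x := p)) f - subst_alg (\<rho>(x := q)) f)"
      by (rule Vector_Spaces.linear_iff[THEN iffD2])
        (auto simp: subst_alg_simps free_alg.vector_space_axioms free_alg.scale_right_diff_distrib)
    show "free_alg.subspace {0 :: 'k free_alg}" by (rule free_alg.subspace_single_0)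
    fix xs assume xs: "distinct xs" "set xs = L"
    then obtain us vs where "xs = us @ x # vs" using x split_list by metis
    then show "subst_alg (\<rho>(x := p + q)) (mono_of xs) - subst_alg (\<rho>(x := p)) (mono_of xs)
        - subst_alg (\<rho>(x := q)) (mono_of xs) \<in> {0}"
      using xs by (simp add: mono algebra_simps)
  qed
  then show "subst_alg (\<rho>(x := p + q)) f = subst_alg (\<rho>(x := p)) f + subst_alg (\<rho>(x := q)) f"
    by (simp add: algebra_simps)
  have "subst_alg (\<rho>(x := scale c p)) f - scale c (subst_alg (\<rho>(x := p)) f) \<in> {0}"
  proof (rule mlin_linear_image[OF f, where d = "\<lambda>f. subst_alg (\<rho>(x := scale c p)) f - scale c (subst_alg (\<rho>(x := p)) f)"])
    show "Vector_Spaces.linear scale scale (\<lambda>f. subst_alg (\<rho>(x := scale c p)) f - scale c (subst_alg (\<rho>(x := p)) f))"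
      by (rule Vector_Spaces.linear_iff[THEN iffD2])
        (auto simp: subst_alg_simps free_alg.vector_space_axioms free_alg.scale_right_diff_distrib
          free_alg.scale_right_distrib mult.commute)
    show "free_alg.subspace {0 :: 'k free_alg}" by (rule free_alg.subspace_single_0)
    fix xs assume xs: "distinct xs" "set xs = L"
    then obtain us vs where "xs = us @ x # vs" using x split_list by metis
    then show "subst_alg (\<rho>(x := scale c p)) (mono_of xs) - scale c (subst_alg (\<rho>(x := p)) (mono_of xs)) \<in> {0}"
      using xs by (simp add: mono)
  qed
  then show "subst_alg (\<rho>(x := scale c p)) f = scale c (subst_alg (\<rho>(x := p)) f)" by simp
qed

text \<open>
  A multilinear polynomial depends linearly on the element substituted for each of its variables, so
  the substituted elements can be replaced by words, one variable after the other.
\<close>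

lemma word_substitutions_suffice:
  fixes f :: "'k::field_char_0 free_alg"
  assumes f: "f \<in> mlin L" and fin: "finite L" and \<rho>: "graded_subst \<rho>"
    and words: "\<And>r. (\<And>x. x \<in> L \<Longrightarrow> good_word x (r x)) \<Longrightarrow> functional l (u * subst_alg (\<lambda>x. mono_of (r x)) f * v) = 0"
  shows "functional l (u * subst_alg \<rho> f * v) = 0"
proof -
  let ?G = "\<lambda>x. {mono_of xs | xs. good_word x xs} :: 'k free_alg set"
  have main: "functional l (u * subst_alg \<rho> f * v) = 0"
    if "finite M" "M \<subseteq> L" "\<And>x. x \<in> M \<Longrightarrow> \<rho> x \<in> free_alg.span (?G x)" "\<And>x. x \<in> L - M \<Longrightarrow> \<rho> x \<in> ?G x" for M \<rho>
    using that
  proof (induction M arbitrary: \<rho> rule: finite_induct)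
    case empty
    then have "\<forall>x. \<exists>xs. x \<in> L \<longrightarrow> \<rho> x = mono_of xs \<and> good_word x xs" by auto
    then obtain r where r: "\<And>x. x \<in> L \<Longrightarrow> \<rho> x = mono_of (r x) \<and> good_word x (r x)" by metis
    have "subst_alg \<rho> f = subst_alg (\<lambda>x. mono_of (r x)) f"
      using f r by (intro subst_alg_cong) (auto simp: mlin_def ml_words_def)
    then show ?case using words[of r] r by simp
  next
    case (insert x M)
    have x: "x \<in> L" using insert.prems by simp
    have "functional l (u * subst_alg (\<rho>(x := \<rho> x)) f * v) = 0"
    proof (rule free_alg.span_induct[of "\<rho> x" "?G x" "\<lambda>p. functional l (u * subst_alg (\<rho>(x := p)) f * v) = 0"])
      show "\<rho> x \<in> free_alg.span (?G x)" using insert.prems by simp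
      have "subst_alg (\<rho>(x := 0)) f = 0"
        using subst_linear_in_letter(2)[OF f x, of \<rho> 0 0] by simp
      then show "free_alg.subspace {p. functional l (u * subst_alg (\<rho>(x := p)) f * v) = 0}"
        unfolding free_alg.subspace_def
        by (auto simp: subst_linear_in_letter[OF f x] distrib_left distrib_right functional_add functional_scale)
      fix p assume p: "p \<in> ?G x"
      show "functional l (u * subst_alg (\<rho>(x := p)) f * v) = 0"
        using insert.prems insert.hyps p by (intro insert.IH) auto
    qed
    then show ?case by simp
  qed
  show ?thesis by (rule main[of L]) (use fin graded_subst_span[OF \<rho>] in auto)
qed

text \<open>
  For proper polynomials the empty word need not be considered, so only words of bounded
  length matter for a functional of bounded degree.
\<close>

lemma core_idealI:
  fixes f :: "'k::field_char_0 free_alg"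
  assumes f: "f \<in> proper L" and fin: "finite L"
    and words: "\<And>r u v. (\<And>x. x \<in> L \<Longrightarrow> good_word x (r x) \<and> r x \<noteq> []) \<Longrightarrow>
      functional l (mono_of u * subst_alg (\<lambda>x. mono_of (r x)) f * mono_of v) = 0"
  shows "f \<in> core_ideal l"
proof -
  have m: "f \<in> mlin L" using f by (simp add: proper_iff)
  have on_words: "functional l (mono_of u * subst_alg (\<lambda>x. mono_of (r x)) f * mono_of v) = 0"
    if r: "\<And>x. x \<in> L \<Longrightarrow> good_word x (r x)" for r u v
  proof (cases "\<exists>x\<in>L. r x = []")
    case True
    then obtain x where x: "x \<in> L" "r x = []" by blast
    \<comment> \<open>Only an even variable can be replaced by the empty word, and proper polynomials do not survive that.\<close>
    then obtain j where j: "x = Y j" using r[OF x(1)] by (cases x) (auto simp: good_word_def odd_word_def)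
    have "subst_alg (\<lambda>x. mono_of (r x)) f = subst_alg (\<lambda>x. mono_of (r x)) (erase_Y j f)"
      unfolding erase_Y_def subst_alg_comp using x j by (intro subst_alg_cong) simp
    also have "\<dots> = 0" using f x j by (simp add: proper_iff)
    finally show ?thesis by simp
  next
    case False
    then show ?thesis using r by (intro words) blast
  qed
  have "functional l (u * subst_alg \<rho> f * v) = 0" if \<rho>: "graded_subst \<rho>" for \<rho> u v
  proof (induction u rule: free_alg_induct)
    case (mono c us)
    show ?case
    proof (induction v rule: free_alg_induct)
      case (mono d vs)
      have "functional l (mono_of us * subst_alg \<rho> f * mono_of vs) = 0"
        by (rule word_substitutions_suffice[OF m fin \<rho>]) (rule on_words)
      then show ?case by (simp add: functional_scale)
    qed (simp_all add: distrib_left functional_add)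
  qed (simp_all add: distrib_right functional_add)
  then show ?thesis by (simp add: core_ideal_def)
qed

lemma functional_long_words:
  fixes f :: "'k::field free_alg"
  assumes f: "f \<in> mlin L" and fin: "finite L" and supp: "\<And>xs. l xs \<noteq> 0 \<Longrightarrow> length xs \<le> d"
    and long: "d < length u + length v + (\<Sum>x\<in>L. length (r x))"
  shows "functional l (mono_of u * subst_alg (\<lambda>x. mono_of (r x)) f * mono_of v) = 0"
proof (rule functional_eq_0)
  let ?T = "\<lambda>f. mono_of u * subst_alg (\<lambda>x. mono_of (r x)) f * mono_of v"
  have subst: "subst_alg (\<lambda>x. mono_of (r x)) (mono_of xs) = mono_of (concat (map r xs))" for xs
    by (induction xs) (simp_all add: mono_of_Cons subst_alg_mult mono_of_append)
  have "?T f \<in> {g :: 'k free_alg. keys g \<subseteq> {w. d < length (letters w)}}"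
  proof (rule mlin_linear_image[OF f _ subspace_keys])
    show "Vector_Spaces.linear scale scale ?T"
      by (rule Vector_Spaces.linear_iff[THEN iffD2])
        (auto simp: subst_alg_simps free_alg.vector_space_axioms distrib_left distrib_right)
    fix xs assume "distinct xs" "set xs = L"
    then have "length (concat (map r xs)) = (\<Sum>x\<in>L. length (r x))"
      by (simp add: length_concat sum_list_distinct_conv_sum_set o_def)
    then show "?T (mono_of xs) \<in> {g. keys g \<subseteq> {w. d < length (letters w)}}"
      using long by (simp add: subst mono_of_append[symmetric])
  qed
  then show "l (letters w) = 0" if "w \<in> keys (?T f)" for w
    using that supp[of "letters w"] by force
qed

section \<open>Realizing codimensions\<close>

text \<open>
  The first line lists the functionals of degree at most two, which make a polynomial of degree
  two (or the variable \<open>z\<^sub>0\<close>) a non-identity. The others have degree three and are named after the variables and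
  the symmetry type of the component that they detect.
\<close>

datatype atom = Deg_z | Comm_yy | Comm_yz | Sym_zz | Alt_zz
  | Lie_yyy | Sym_yyz | Alt_yyz | Alt_zyy | Sym_zyz | Alt_zyz | Sym_yzz | Alt_yzz
  | Sym_zzz | Alt_zzz | Std_zzz1 | Std_zzz2

definition ind :: "letter list \<Rightarrow> letter list \<Rightarrow> 'k::field"
  where "ind w xs = of_bool (xs = w)"

text \<open>
  Repeating a letter symmetrizes the corresponding arguments, and the alternating combinations skew-symmetrize
  them. The functionals of the two atoms of standard type are combinations with coefficient sum zero of the words in
  two equal letters and one different letter; such combinations annihilate the trivial and the sign module.
\<close>

primrec atom_functional :: "atom \<Rightarrow> letter list \<Rightarrow> 'k::field" where
  "atom_functional Deg_z = ind [Z 0]"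
| "atom_functional Comm_yy = ind [Y 0, Y 1]"
| "atom_functional Comm_yz = ind [Y 0, Z 0]"
| "atom_functional Sym_zz = (\<lambda>xs. ind [Z 0, Z 1] xs + ind [Z 1, Z 0] xs)"
| "atom_functional Alt_zz = (\<lambda>xs. ind [Z 0, Z 1] xs - ind [Z 1, Z 0] xs)"
| "atom_functional Lie_yyy = ind [Y 0, Y 1, Y 2]"
| "atom_functional Sym_yyz = ind [Y 0, Y 0, Z 0]"
| "atom_functional Alt_yyz = (\<lambda>xs. ind [Y 0, Y 1, Z 0] xs - ind [Y 1, Y 0, Z 0] xs)"
| "atom_functional Alt_zyy = (\<lambda>xs. ind [Z 0, Y 0, Y 1] xs - ind [Z 0, Y 1, Y 0] xs)"
| "atom_functional Sym_zyz = ind [Z 0, Y 0, Z 0]"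
| "atom_functional Alt_zyz = (\<lambda>xs. ind [Z 0, Y 0, Z 1] xs - ind [Z 1, Y 0, Z 0] xs)"
| "atom_functional Sym_yzz = ind [Y 0, Z 0, Z 0]"
| "atom_functional Alt_yzz = (\<lambda>xs. ind [Y 0, Z 0, Z 1] xs - ind [Y 0, Z 1, Z 0] xs)"
| "atom_functional Sym_zzz = ind [Z 0, Z 0, Z 0]"
| "atom_functional Alt_zzz = (\<lambda>xs. ind [Z 0, Z 1, Z 2] xs - ind [Z 0, Z 2, Z 1] xs - ind [Z 1, Z 0, Z 2] xs
    + ind [Z 1, Z 2, Z 0] xs + ind [Z 2, Z 0, Z 1] xs - ind [Z 2, Z 1, Z 0] xs)"
| "atom_functional Std_zzz1 = (\<lambda>xs. ind [Z 0, Z 0, Z 1] xs - ind [Z 0, Z 1, Z 0] xs)"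
| "atom_functional Std_zzz2 = (\<lambda>xs. ind [Z 0, Z 1, Z 0] xs - ind [Z 1, Z 0, Z 0] xs)"

definition atom_ideal :: "atom set \<Rightarrow> 'k::field free_alg set"
  where "atom_ideal Q = (\<Inter>q\<in>Q. core_ideal (atom_functional q))"

lemma T2_ideal_atom_ideal: "T2_ideal (atom_ideal Q)"
  unfolding atom_ideal_def using T2_ideal_core_ideal by (intro T2_ideal_Inter) blast

lemma atom_functional_length: "atom_functional q xs \<noteq> 0 \<Longrightarrow> length xs \<le> 3"
  by (cases q) (auto simp: ind_def of_bool_def split: if_splits)

subsection \<open>Degrees above three\<close>

text \<open>
  A nonempty word has to be substituted for each variable, so only words beyond the support arise.
\<close>

lemma proper_long_core_ideal:
  fixes f :: "'k::field_char_0 free_alg"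
  assumes f: "f \<in> proper L" and L: "finite L" "d < card L" and supp: "\<And>xs. l xs \<noteq> 0 \<Longrightarrow> length xs \<le> d"
  shows "f \<in> core_ideal l"
proof (rule core_idealI[OF f L(1)])
  fix r and u v :: "letter list" assume r: "\<And>x. x \<in> L \<Longrightarrow> good_word x (r x) \<and> r x \<noteq> []"
  have "card L = (\<Sum>x\<in>L. 1)" by simp
  also have "\<dots> \<le> (\<Sum>x\<in>L. length (r x))" using r by (intro sum_mono) (simp add: Suc_le_eq)
  finally have "d < length u + length v + (\<Sum>x\<in>L. length (r x))" using L(2) by linarith
  then show "functional l (mono_of u * subst_alg (\<lambda>x. mono_of (r x)) f * mono_of v) = 0"
    using f L(1) supp by (intro functional_long_words[where L = L and d = d]) (auto simp: proper_iff)
qed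

lemma card_std_letters: "card (std_letters r s) = r + s"
  unfolding std_letters_def by (subst card_Un_disjoint) (auto simp: card_image inj_on_def)

lemma gamma_atom_ideal_high:
  assumes "3 < k"
  shows "gamma (atom_ideal Q :: 'k::field_char_0 free_alg set) k = 0"
proof -
  have "proper_codim (atom_ideal Q :: 'k free_alg set) (k - r) r = 0" if "r \<le> k" for r
    unfolding proper_codim_def
    using that assms atom_functional_length
    by (subst codim_eq_0[OF fin_space_proper[OF finite_std_letters] T2_subspace[OF T2_ideal_atom_ideal]])
      (auto simp: atom_ideal_def card_std_letters intro!: proper_long_core_ideal[where d = 3])
  then show ?thesis by (simp add: gamma_def)
qed

subsection \<open>Degree three\<close>

definition index_map :: "(nat \<Rightarrow> nat) \<Rightarrow> (nat \<Rightarrow> nat) \<Rightarrow> letter \<Rightarrow> letter"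
  where "index_map a b x = (case x of Y i \<Rightarrow> Y (a i) | Z i \<Rightarrow> Z (b i))"

text \<open>
  When the degree of the polynomial reaches the degree of the functional, only substitutions of single
  letters for the variables can contribute.
\<close>

lemma core_ideal_top_degree:
  fixes f :: "'k::field_char_0 free_alg"
  assumes f: "f \<in> proper L" and L: "finite L" "card L = d" and supp: "\<And>xs. l xs \<noteq> 0 \<Longrightarrow> length xs \<le> d"
  shows "f \<in> core_ideal l \<longleftrightarrow> (\<forall>a b. functional l (rename (index_map a b) f) = 0)"
proof
  assume h: "f \<in> core_ideal l"
  have "graded_subst (\<lambda>x. var (index_map a b x) :: 'k free_alg)" for a b
    by (simp add: graded_subst_def index_map_def)
  then have "functional l (1 * rename (index_map a b) f * 1) = 0" for a b
    using h unfolding core_ideal_def rename_def by blast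
  then show "\<forall>a b. functional l (rename (index_map a b) f) = 0" by simp
next
  assume h: "\<forall>a b. functional l (rename (index_map a b) f) = 0"
  have m: "f \<in> mlin L" using f by (simp add: proper_iff)
  show "f \<in> core_ideal l"
  proof (rule core_idealI[OF f L(1)])
    fix r and u v :: "letter list" assume r: "\<And>x. x \<in> L \<Longrightarrow> good_word x (r x) \<and> r x \<noteq> []"
    have pos: "1 \<le> length (r x)" if "x \<in> L" for x using r[OF that] by (simp add: Suc_le_eq)
    show "functional l (mono_of u * subst_alg (\<lambda>x. mono_of (r x)) f * mono_of v) = 0"
    proof (cases "u = [] \<and> v = [] \<and> (\<forall>x\<in>L. length (r x) = 1)")
      case True
      define i where "i x = (case hd (r x) of Y j \<Rightarrow> j | Z j \<Rightarrow> j)" for x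
      have "(mono_of (r x) :: 'k free_alg) = var (index_map (\<lambda>j. i (Y j)) (\<lambda>j. i (Z j)) x)" if x: "x \<in> L" for x
      proof -
        obtain t where t: "r x = [t]" using True x by (auto simp: length_Suc_conv)
        then show ?thesis using r[OF x]
          by (cases x; cases t) (auto simp: var_def index_map_def i_def good_word_def odd_word_def)
      qed
      then have "subst_alg (\<lambda>x. mono_of (r x)) f = rename (index_map (\<lambda>j. i (Y j)) (\<lambda>j. i (Z j))) f"
        unfolding rename_def using m by (intro subst_alg_cong) (auto simp: mlin_def ml_words_def)
      then show ?thesis using h True by simp
    next
      case False
      have sum: "(\<Sum>x\<in>L. length (r x)) \<ge> d"
        using sum_mono[of L "\<lambda>_. 1" "\<lambda>x. length (r x)"] pos L(2) by simp
      have "d < length u + length v + (\<Sum>x\<in>L. length (r x))"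
      proof (cases "u = [] \<and> v = []")
        case True
        then obtain x where x: "x \<in> L" "length (r x) \<noteq> 1" using False by blast
        have "1 < length (r x)" using pos[OF x(1)] x(2) by linarith
        then have "(\<Sum>x\<in>L. 1) < (\<Sum>x\<in>L. length (r x))"
          using L(1) pos x(1) by (intro sum_strict_mono_ex1) auto
        then show ?thesis using L(2) by simp
      next
        case False
        then have "0 < length u + length v" by simp
        then show ?thesis using sum by linarith
      qed
      then show ?thesis using m L(1) supp by (intro functional_long_words[where L = L and d = d]) auto
    qed
  qed
qed

lemma rename_simps: "rename p (f + g) = rename p f + rename p g" "rename p (f - g) = rename p f - rename p g"
  "rename p (scale c f) = scale c (rename p f)" "rename p 0 = 0"
  by (simp_all add: rename_def subst_alg_simps)

lemma core_ideal_basis: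
  fixes c :: "nat \<Rightarrow> 'k::field_char_0"
  assumes "(r, s) \<in> small_types" "r + s = 3"
  shows "lin_comb (proper_basis r s) c \<in> core_ideal (atom_functional q) \<longleftrightarrow>
    (\<forall>a b. functional (atom_functional q) (rename (index_map a b) (lin_comb (proper_basis r s) c)) = 0)"
proof (rule core_ideal_top_degree[where L = "std_letters r s" and d = 3])
  show "lin_comb (proper_basis r s) c \<in> proper (std_letters r s)"
    using proper_basis_in_proper[OF assms(1)] subspace_proper by (intro lin_comb_in_subspace)
qed (use assms(2) atom_functional_length in \<open>auto simp: card_std_letters\<close>)

lemmas eval_basis = lin_comb_nth mono_normal ring_distribs rename_simps rename_mono functional_add functional_diff
  functional_scale functional_mono index_map_def

text \<open>
  Written as products, the values of the functionals at the permuted words cancel by ring arithmetic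
  alone, without a distinction of cases by coinciding indices.
\<close>

lemma ind_triple:
  "ind [u, v, w] [p, q, r] = of_bool (p = u) * of_bool (q = v) * of_bool (r = w)"
  "ind [u, v] [p, q, r] = 0" "ind [u] [p, q, r] = 0"
  by (simp_all add: ind_def of_bool_def)

lemma core_ideal_30:
  fixes c :: "nat \<Rightarrow> 'k::field_char_0"
  shows "lin_comb (proper_basis 3 0) c \<in> core_ideal (atom_functional q) \<longleftrightarrow> (q = Lie_yyy \<longrightarrow> c 0 = 0 \<and> c 1 = 0)"
proof -
  define E where "E a b = functional (atom_functional q) (rename (index_map a b) (lin_comb (proper_basis 3 0) c))" for a b
  note E = E_def[unfolded proper_basis_simps(6)]
  have "E (\<lambda>i. i) (\<lambda>i. i) = c 0" if "q = Lie_yyy"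
    by (simp add: E that eval_basis ind_def)
  moreover have "E (\<lambda>i. if i = 1 then 2 else if i = 2 then 1 else 0) (\<lambda>i. i) = c 1" if "q = Lie_yyy"
    by (simp add: E that eval_basis ind_def)
  moreover have "E a b = 0" if "q = Lie_yyy \<longrightarrow> c 0 = 0 \<and> c 1 = 0" for a b
    using that by (cases q) (simp_all add: E eval_basis ind_triple, (simp_all add: algebra_simps)?)
  ultimately have "(\<forall>a b. E a b = 0) \<longleftrightarrow> (q = Lie_yyy \<longrightarrow> c 0 = 0 \<and> c 1 = 0)"
    by metis
  then show ?thesis by (simp add: core_ideal_basis E_def)
qed

lemma core_ideal_21:
  fixes c :: "nat \<Rightarrow> 'k::field_char_0"
  shows "lin_comb (proper_basis 2 1) c \<in> core_ideal (atom_functional q) \<longleftrightarrow>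
    (q = Sym_yyz \<longrightarrow> c 0 = 0) \<and> (q = Alt_yyz \<longrightarrow> c 1 = 0) \<and> (q = Alt_zyy \<longrightarrow> c 2 = 0)"
proof -
  define E where "E a b = functional (atom_functional q) (rename (index_map a b) (lin_comb (proper_basis 2 1) c))" for a b
  note E = E_def[unfolded proper_basis_simps(7)]
  have "E (\<lambda>i. 0) (\<lambda>i. 0) = 2 * c 0" if "q = Sym_yyz"
    by (simp add: E that eval_basis ind_def)
  moreover have "E (\<lambda>i. i) (\<lambda>i. 0) = 2 * c 1" if "q = Alt_yyz"
    by (simp add: E that eval_basis ind_def)
  moreover have "E (\<lambda>i. i) (\<lambda>i. 0) = 2 * c 2" if "q = Alt_zyy"
    by (simp add: E that eval_basis ind_def)
  moreover have "E a b = 0" if "(q = Sym_yyz \<longrightarrow> c 0 = 0) \<and> (q = Alt_yyz \<longrightarrow> c 1 = 0) \<and> (q = Alt_zyy \<longrightarrow> c 2 = 0)" for a b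
    using that by (cases q) (simp_all add: E eval_basis ind_triple, (simp_all add: algebra_simps)?)
  ultimately have "(\<forall>a b. E a b = 0) \<longleftrightarrow>
      (q = Sym_yyz \<longrightarrow> c 0 = 0) \<and> (q = Alt_yyz \<longrightarrow> c 1 = 0) \<and> (q = Alt_zyy \<longrightarrow> c 2 = 0)"
    by (metis mult_eq_0_iff zero_neq_numeral)
  then show ?thesis by (simp add: core_ideal_basis E_def)
qed

lemma core_ideal_12:
  fixes c :: "nat \<Rightarrow> 'k::field_char_0"
  shows "lin_comb (proper_basis 1 2) c \<in> core_ideal (atom_functional q) \<longleftrightarrow>
    (q = Sym_zyz \<longrightarrow> c 0 = 0) \<and> (q = Alt_zyz \<longrightarrow> c 1 = 0) \<and> (q = Sym_yzz \<longrightarrow> c 2 = 0) \<and> (q = Alt_yzz \<longrightarrow> c 3 = 0)"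
proof -
  define E where "E a b = functional (atom_functional q) (rename (index_map a b) (lin_comb (proper_basis 1 2) c))" for a b
  note E = E_def[unfolded proper_basis_simps(8)]
  have "E (\<lambda>i. 0) (\<lambda>i. 0) = 2 * c 0" if "q = Sym_zyz"
    by (simp add: E that eval_basis ind_def)
  moreover have "E (\<lambda>i. 0) (\<lambda>i. i) = 2 * c 1" if "q = Alt_zyz"
    by (simp add: E that eval_basis ind_def)
  moreover have "E (\<lambda>i. 0) (\<lambda>i. 0) = 2 * c 2" if "q = Sym_yzz"
    by (simp add: E that eval_basis ind_def)
  moreover have "E (\<lambda>i. 0) (\<lambda>i. i) = 2 * c 3" if "q = Alt_yzz"
    by (simp add: E that eval_basis ind_def)
  moreover have "E a b = 0" if "(q = Sym_zyz \<longrightarrow> c 0 = 0) \<and> (q = Alt_zyz \<longrightarrow> c 1 = 0) \<and> (q = Sym_yzz \<longrightarrow> c 2 = 0) \<and> (q = Alt_yzz \<longrightarrow> c 3 = 0)" for a b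
    using that by (cases q) (simp_all add: E eval_basis ind_triple, (simp_all add: algebra_simps)?)
  ultimately have "(\<forall>a b. E a b = 0) \<longleftrightarrow>
    (q = Sym_zyz \<longrightarrow> c 0 = 0) \<and> (q = Alt_zyz \<longrightarrow> c 1 = 0) \<and> (q = Sym_yzz \<longrightarrow> c 2 = 0) \<and> (q = Alt_yzz \<longrightarrow> c 3 = 0)"
    by (metis mult_eq_0_iff zero_neq_numeral)
  then show ?thesis by (simp add: core_ideal_basis E_def)
qed

lemma core_ideal_03:
  fixes c :: "nat \<Rightarrow> 'k::field_char_0"
  shows "lin_comb (proper_basis 0 3) c \<in> core_ideal (atom_functional q) \<longleftrightarrow>
    (q = Sym_zzz \<longrightarrow> c 0 = 0) \<and> (q = Alt_zzz \<longrightarrow> c 1 = 0) \<and> (q = Std_zzz1 \<longrightarrow> c 2 = 0 \<and> c 3 = 0)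
    \<and> (q = Std_zzz2 \<longrightarrow> c 4 = 0 \<and> c 5 = 0)"
proof -
  define E where "E a b = functional (atom_functional q) (rename (index_map a b) (lin_comb (proper_basis 0 3) c))" for a b
  note E = E_def[unfolded proper_basis_simps(9)]
  have "E (\<lambda>i. 0) (\<lambda>i. 0) = 6 * c 0" if "q = Sym_zzz"
    by (simp add: E that eval_basis ind_def)
  moreover have "E (\<lambda>i. 0) (\<lambda>i. i) = 6 * c 1" if "q = Alt_zzz"
    by (simp add: E that eval_basis ind_def)
  moreover have "E (\<lambda>i. 0) (\<lambda>i. of_bool (i = 1)) = 3 * c 2" "E (\<lambda>i. 0) (\<lambda>i. of_bool (i = 2)) = 3 * c 3" if "q = Std_zzz1"
    by (simp_all add: E that eval_basis ind_def)
  moreover have "E (\<lambda>i. 0) (\<lambda>i. of_bool (i = 1)) = - 3 * c 4" "E (\<lambda>i. 0) (\<lambda>i. of_bool (i = 2)) = - 3 * c 5" if "q = Std_zzz2"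
    by (simp_all add: E that eval_basis ind_def)
  moreover have "E a b = 0" if "(q = Sym_zzz \<longrightarrow> c 0 = 0) \<and> (q = Alt_zzz \<longrightarrow> c 1 = 0) \<and> (q = Std_zzz1 \<longrightarrow> c 2 = 0 \<and> c 3 = 0)
    \<and> (q = Std_zzz2 \<longrightarrow> c 4 = 0 \<and> c 5 = 0)" for a b
    using that by (cases q) (simp_all add: E eval_basis ind_triple, (simp_all add: algebra_simps)?)
  ultimately have "(\<forall>a b. E a b = 0) \<longleftrightarrow>
    (q = Sym_zzz \<longrightarrow> c 0 = 0) \<and> (q = Alt_zzz \<longrightarrow> c 1 = 0) \<and> (q = Std_zzz1 \<longrightarrow> c 2 = 0 \<and> c 3 = 0)
    \<and> (q = Std_zzz2 \<longrightarrow> c 4 = 0 \<and> c 5 = 0)"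
    by (metis mult_eq_0_iff neg_equal_0_iff_equal zero_neq_numeral)
  then show ?thesis by (simp add: core_ideal_basis E_def)
qed

lemma gamma_expand:
  "gamma I 0 = proper_codim I 0 0"
  "gamma I 1 = proper_codim I 1 0 + proper_codim I 0 1"
  "gamma I 2 = proper_codim I 2 0 + 2 * proper_codim I 1 1 + proper_codim I 0 2"
  "gamma I 3 = proper_codim I 3 0 + 3 * proper_codim I 2 1 + 3 * proper_codim I 1 2 + proper_codim I 0 3"
  by (simp_all add: gamma_def numeral_2_eq_2 numeral_3_eq_3)

lemma proper_codim_00:
  assumes I: "T2_ideal I" and "1 \<notin> (I :: 'k::field_char_0 free_alg set)"
  shows "proper_codim I 0 0 = 1"
proof -
  have L: "std_letters 0 0 = {}" by (simp add: std_letters_def)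
  have sc: "\<exists>c. f = scale c 1" if "f \<in> proper {}" for f :: "'k free_alg"
  proof -
    have "ml_words {} = {Word []}" by (auto simp: ml_words_def)
    then have "f = scale (lookup f (Word [])) 1"
      using mlin_expand[of f "{}"] that by (simp add: proper_iff)
    then show ?thesis by blast
  qed
  have one: "(1 :: 'k free_alg) \<in> proper {}"
    using mono_of_in_mlin[of "[]" "{}"] by (simp add: proper_iff)
  have "codim (proper {}) I = card {0::nat}"
  proof (rule codim_by_coordinates[where T = "{0::nat}" and b = "\<lambda>_. 1"])
    show "fin_space (proper {} :: 'k free_alg set)" by (rule fin_space_proper) simp
    show "free_alg.subspace I" by (rule T2_subspace[OF I])
    show "\<exists>c. v = (\<Sum>k\<in>{0}. scale (c k) 1)" if v: "v \<in> proper {}" for v :: "'k free_alg"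
    proof -
      obtain c where "v = scale c 1" using sc[OF v] by blast
      then show ?thesis by (intro exI[of _ "\<lambda>_. c"]) simp
    qed
    show "((\<Sum>k\<in>{0}. scale (c k) 1) \<in> I) = (\<forall>k\<in>{0}. c k = 0)" for c
      using assms(2) T2_scale_cancel[OF I, of "c 0" 1] T2_zero[OF I] by auto
  qed (use one in auto)
  then show ?thesis by (simp add: proper_codim_def L)
qed

text \<open>
  The atoms of degree three, grouped by their contribution to the third proper codimension: a
  one-dimensional module in types \<open>(2, 1)\<close> and \<open>(1, 2)\<close> counts three times, once for each choice of the
  index of the exceptional variable.
\<close>

definition atoms3 :: "atom set"
  where "atoms3 = {Sym_yyz, Alt_yyz, Alt_zyy, Sym_zyz, Alt_zyz, Sym_yzz, Alt_yzz}"
definition atoms2 :: "atom set"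
  where "atoms2 = {Lie_yyy, Std_zzz1, Std_zzz2}"
definition atoms1 :: "atom set"
  where "atoms1 = {Sym_zzz, Alt_zzz}"

context
  fixes Q :: "atom set" and I :: "'k::field_char_0 free_alg set"
  defines "I \<equiv> atom_ideal Q"
begin

lemma T2_ideal_I: "T2_ideal I"
  unfolding I_def by (rule T2_ideal_atom_ideal)

lemma in_atom_ideal: "f \<in> I \<longleftrightarrow> (\<forall>q\<in>Q. f \<in> core_ideal (atom_functional q))"
  by (simp add: I_def atom_ideal_def)

lemma atom_codim_30: "proper_codim I 3 0 = 2 * of_bool (Lie_yyy \<in> Q)"
proof -
  have "proper_codim I 3 0 = card (if Lie_yyy \<in> Q then {0, 1::nat} else {})"
  proof (rule codim_by_proper_basis[OF _ T2_ideal_I])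
    fix c :: "nat \<Rightarrow> 'k"
    show "(lin_comb (proper_basis 3 0) c \<in> I) = (\<forall>k\<in>if Lie_yyy \<in> Q then {0, 1::nat} else {}. c k = 0)"
      unfolding in_atom_ideal core_ideal_30 by auto
  qed (auto simp: proper_basis_simps(6)[simplified])
  then show ?thesis by simp
qed

lemma atom_codim_21:
  "proper_codim I 2 1 = of_bool (Sym_yyz \<in> Q) + of_bool (Alt_yyz \<in> Q) + of_bool (Alt_zyy \<in> Q)"
proof -
  have "proper_codim I 2 1 = card ((if Sym_yyz \<in> Q then {0::nat} else {}) \<union> (if Alt_yyz \<in> Q then {1} else {})
      \<union> (if Alt_zyy \<in> Q then {2} else {}))"
  proof (rule codim_by_proper_basis[OF _ T2_ideal_I])
    fix c :: "nat \<Rightarrow> 'k"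
    show "(lin_comb (proper_basis 2 1) c \<in> I) = (\<forall>k\<in>(if Sym_yyz \<in> Q then {0::nat} else {})
        \<union> (if Alt_yyz \<in> Q then {1} else {}) \<union> (if Alt_zyy \<in> Q then {2} else {}). c k = 0)"
      unfolding in_atom_ideal core_ideal_21 by auto
  qed (auto simp: proper_basis_simps(7)[simplified])
  then show ?thesis by simp
qed

lemma atom_codim_12:
  "proper_codim I 1 2 = of_bool (Sym_zyz \<in> Q) + of_bool (Alt_zyz \<in> Q) + of_bool (Sym_yzz \<in> Q) + of_bool (Alt_yzz \<in> Q)"
proof -
  have "proper_codim I 1 2 = card ((if Sym_zyz \<in> Q then {0::nat} else {}) \<union> (if Alt_zyz \<in> Q then {1} else {})
      \<union> (if Sym_yzz \<in> Q then {2} else {}) \<union> (if Alt_yzz \<in> Q then {3} else {}))"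
  proof (rule codim_by_proper_basis[OF _ T2_ideal_I])
    fix c :: "nat \<Rightarrow> 'k"
    show "(lin_comb (proper_basis 1 2) c \<in> I) = (\<forall>k\<in>(if Sym_zyz \<in> Q then {0::nat} else {})
        \<union> (if Alt_zyz \<in> Q then {1} else {}) \<union> (if Sym_yzz \<in> Q then {2} else {}) \<union> (if Alt_yzz \<in> Q then {3} else {}). c k = 0)"
      unfolding in_atom_ideal core_ideal_12 by auto
  qed (auto simp: proper_basis_simps(8)[simplified])
  then show ?thesis by simp
qed

lemma atom_codim_03:
  "proper_codim I 0 3 = of_bool (Sym_zzz \<in> Q) + of_bool (Alt_zzz \<in> Q) + 2 * of_bool (Std_zzz1 \<in> Q) + 2 * of_bool (Std_zzz2 \<in> Q)"
proof -
  have "proper_codim I 0 3 = card ((if Sym_zzz \<in> Q then {0::nat} else {}) \<union> (if Alt_zzz \<in> Q then {1} else {})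
      \<union> (if Std_zzz1 \<in> Q then {2, 3} else {}) \<union> (if Std_zzz2 \<in> Q then {4, 5} else {}))"
  proof (rule codim_by_proper_basis[OF _ T2_ideal_I])
    fix c :: "nat \<Rightarrow> 'k"
    show "(lin_comb (proper_basis 0 3) c \<in> I) = (\<forall>k\<in>(if Sym_zzz \<in> Q then {0::nat} else {})
        \<union> (if Alt_zzz \<in> Q then {1} else {}) \<union> (if Std_zzz1 \<in> Q then {2, 3} else {}) \<union> (if Std_zzz2 \<in> Q then {4, 5} else {}). c k = 0)"
      unfolding in_atom_ideal core_ideal_03 by auto
  qed (auto simp: proper_basis_simps(9)[simplified])
  then show ?thesis by simp
qed

lemma gamma_atom_ideal_3: "gamma I 3 = 3 * card (Q \<inter> atoms3) + 2 * card (Q \<inter> atoms2) + card (Q \<inter> atoms1)"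
proof -
  have card: "card (Q \<inter> insert a S) = of_bool (a \<in> Q) + card (Q \<inter> S)" if "a \<notin> S" "finite S" for a S
    using that by (simp add: Int_insert_right)
  show ?thesis
    unfolding gamma_expand atom_codim_30 atom_codim_21 atom_codim_12 atom_codim_03
    unfolding atoms3_def atoms2_def atoms1_def by (simp add: card)
qed

end

subsection \<open>Degree two\<close>

lemma good_word_simps:
  "good_word (Y i) [p] \<longleftrightarrow> (\<exists>j. p = Y j)" "good_word (Z i) [p] \<longleftrightarrow> (\<exists>j. p = Z j)"
  "good_word (Y i) [p, q] \<longleftrightarrow> (\<exists>j k. p = Y j \<and> q = Y k) \<or> (\<exists>j k. p = Z j \<and> q = Z k)"
  "good_word (Z i) [p, q] \<longleftrightarrow> (\<exists>j k. p = Y j \<and> q = Z k) \<or> (\<exists>j k. p = Z j \<and> q = Y k)"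
  by (cases p; cases q; simp add: good_word_def odd_word_def)+

text \<open>
  The functional vanishes on all polynomials of degree at most three that arise from \<open>x x' + e x' x\<close> by
  substituting nonempty words of the right parity and multiplying with words on both sides.
\<close>

definition two_letter_check :: "(letter list \<Rightarrow> 'k::field) \<Rightarrow> letter \<Rightarrow> letter \<Rightarrow> 'k \<Rightarrow> bool"
  where "two_letter_check l x x' e \<longleftrightarrow>
    (\<forall>p q. good_word x [p] \<longrightarrow> good_word x' [q] \<longrightarrow> l [p, q] + e * l [q, p] = 0 \<and>
      (\<forall>t. l [t, p, q] + e * l [t, q, p] = 0 \<and> l [p, q, t] + e * l [q, p, t] = 0)) \<and>
    (\<forall>p p' q. good_word x [p, p'] \<longrightarrow> good_word x' [q] \<longrightarrow> l [p, p', q] + e * l [q, p, p'] = 0) \<and>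
    (\<forall>p q q'. good_word x [p] \<longrightarrow> good_word x' [q, q'] \<longrightarrow> l [p, q, q'] + e * l [q, q', p] = 0)"

lemma core_ideal_two_letters:
  fixes e :: "'k::field_char_0"
  assumes f: "mono_of [x, x'] + scale e (mono_of [x', x]) \<in> proper {x, x'}" (is "?f \<in> _")
    and supp: "\<And>xs. l xs \<noteq> 0 \<Longrightarrow> length xs \<le> 3" and check: "two_letter_check l x x' e"
  shows "?f \<in> core_ideal l"
proof (rule core_idealI[OF f])
  fix r and u v :: "letter list" assume r: "\<And>t. t \<in> {x, x'} \<Longrightarrow> good_word t (r t) \<and> r t \<noteq> []"
  obtain p ps where p: "r x = p # ps" using r[of x] by (cases "r x") auto
  obtain q qs where q: "r x' = q # qs" using r[of x'] by (cases "r x'") auto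
  have "functional l (mono_of u * subst_alg (\<lambda>x. mono_of (r x)) ?f * mono_of v)
      = l (u @ r x @ r x' @ v) + e * l (u @ r x' @ r x @ v)"
    by (simp add: subst_alg_simps subst_alg_mono distrib_left distrib_right mono_of_append[symmetric]
        functional_add functional_scale)
  also have "\<dots> = 0"
  proof (cases "length u + length v + length ps + length qs \<le> 1")
    case True
    then consider "u = [] \<and> v = [] \<and> ps = [] \<and> qs = []" | t where "u = [t] \<and> v = [] \<and> ps = [] \<and> qs = []"
      | t where "u = [] \<and> v = [t] \<and> ps = [] \<and> qs = []" | t where "u = [] \<and> v = [] \<and> ps = [t] \<and> qs = []"
      | t where "u = [] \<and> v = [] \<and> ps = [] \<and> qs = [t]"
      by (cases u; cases v; cases ps; cases qs) auto
    then show ?thesis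
      using r[of x] r[of x'] p q check unfolding two_letter_check_def by cases auto
  next
    case False
    then have "l (u @ r x @ r x' @ v) = 0" "l (u @ r x' @ r x @ v) = 0"
      using supp[of "u @ r x @ r x' @ v"] supp[of "u @ r x' @ r x @ v"] p q by auto
    then show ?thesis by simp
  qed
  finally show "functional l (mono_of u * subst_alg (\<lambda>x. mono_of (r x)) ?f * mono_of v) = 0" .
qed simp

lemma ind_pair: "ind [u, v] [p, q] = of_bool (p = u) * of_bool (q = v)"
  "ind [u, v, w] [p, q] = 0" "ind [u] [p, q] = 0"
  by (simp_all add: ind_def of_bool_def)

lemmas atom_check = good_word_simps ind_pair ind_triple algebra_simps

lemma comm_conv: "comm (var a) (var b) = mono_of [a, b] + scale (- 1) (mono_of [b, a])"
  by (simp add: mono_normal)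

lemma anticomm_conv: "var a * var b + var b * var a = mono_of [a, b] + scale 1 (mono_of [b, a])"
  by (simp add: mono_normal)

lemma basis_proper_2:
  "comm (y 0) (y 1) \<in> proper {Y 0, Y 1}" "comm (y 0) (z 0) \<in> proper {Y 0, Z 0}"
  "comm (z 0) (z 1) \<in> proper {Z 0, Z 1}" "z 0 * z 1 + z 1 * z 0 \<in> proper {Z 0, Z 1}"
  using proper_basis_in_proper[of 2 0 "comm (y 0) (y 1)"] proper_basis_in_proper[of 1 1 "comm (y 0) (z 0)"]
    proper_basis_in_proper[of 0 2 "comm (z 0) (z 1)"] proper_basis_in_proper[of 0 2 "z 0 * z 1 + z 1 * z 0"]
  by (simp_all add: proper_basis_simps std_letters_small del: One_nat_def)

lemma all_letter: "(\<forall>x. P x) \<longleftrightarrow> (\<forall>i. P (Y i)) \<and> (\<forall>i. P (Z i))"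
  by (metis letter.exhaust)

lemmas core_check = core_ideal_two_letters[OF _ atom_functional_length]

text \<open>
  None of these functionals takes different values on words that differ by exchanging two neighbouring
  even factors.
\<close>

lemma comm_yy_core:
  assumes "q \<in> {Deg_z, Comm_yz, Sym_zz, Alt_zz, Sym_zzz, Alt_zzz, Sym_yyz, Std_zzz1, Std_zzz2, Sym_zyz, Alt_zyz}"
  shows "comm (y 0) (y 1) \<in> core_ideal (atom_functional q :: _ \<Rightarrow> 'k::field_char_0)"
  unfolding comm_conv
  by (rule core_check[OF basis_proper_2(1)[unfolded comm_conv]])
    (use assms in \<open>auto simp: two_letter_check_def all_letter atom_check\<close>)

text \<open>
  The words in the supports of these functionals do not have a nonempty even factor next to an odd one,
  except for \<open>z\<^sub>0 z\<^sub>0 z\<^sub>0\<close>, where exchanging the factors does not change the word.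
\<close>

lemma comm_yz_core:
  assumes "q \<in> {Deg_z, Comm_yy, Sym_zz, Sym_zzz, Lie_yyy}"
  shows "comm (y 0) (z 0) \<in> core_ideal (atom_functional q :: _ \<Rightarrow> 'k::field_char_0)"
  unfolding comm_conv
  by (rule core_check[OF basis_proper_2(2)[unfolded comm_conv]])
    (use assms in \<open>auto simp: two_letter_check_def all_letter atom_check\<close>)

lemma comm_zz_core:
  assumes "q \<in> {Deg_z, Comm_yy, Comm_yz, Sym_zz, Sym_zzz, Lie_yyy, Sym_yyz, Alt_yyz, Alt_zyy}"
  shows "comm (z 0) (z 1) \<in> core_ideal (atom_functional q :: _ \<Rightarrow> 'k::field_char_0)"
  unfolding comm_conv
  by (rule core_check[OF basis_proper_2(3)[unfolded comm_conv]])
    (use assms in \<open>auto simp: two_letter_check_def all_letter atom_check\<close>)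

lemma anticomm_zz_core:
  assumes "q \<in> {Deg_z, Comm_yy, Comm_yz, Lie_yyy, Sym_yyz, Alt_yyz, Alt_zyy}"
  shows "z 0 * z 1 + z 1 * z 0 \<in> core_ideal (atom_functional q :: _ \<Rightarrow> 'k::field_char_0)"
  unfolding anticomm_conv
  by (rule core_check[OF basis_proper_2(4)[unfolded anticomm_conv]])
    (use assms in \<open>auto simp: two_letter_check_def all_letter atom_check\<close>)

lemma z_core:
  assumes "q \<in> {Comm_yy, Lie_yyy}"
  shows "z 0 \<in> core_ideal (atom_functional q :: _ \<Rightarrow> 'k::field_char_0)"
proof (rule core_idealI[where L = "{Z 0}"])
  show "z 0 \<in> proper {Z 0}"
    using mono_of_in_mlin[of "[Z 0]"] by (simp add: proper_iff var_def)
  fix r and u v :: "letter list" assume r: "\<And>x. x \<in> {Z 0} \<Longrightarrow> good_word x (r x) \<and> r x \<noteq> []"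
  have "\<exists>i. Z i \<in> set (r (Z 0))"
  proof (rule ccontr)
    assume "\<nexists>i. Z i \<in> set (r (Z 0))"
    then have "filter (\<lambda>x. \<exists>i. x = Z i) (r (Z 0)) = []" by (auto simp: filter_empty_conv)
    then show False using r[of "Z 0"] by (simp add: good_word_def odd_word_def)
  qed
  then obtain i where "Z i \<in> set (u @ r (Z 0) @ v)" by auto
  moreover have "atom_functional q ws = (0::'k)" if "Z i \<in> set ws" for ws
    using assms that by (auto simp: ind_def of_bool_def)
  ultimately have "atom_functional q (u @ r (Z 0) @ v) = (0::'k)" by blast
  then show "functional (atom_functional q) (mono_of u * subst_alg (\<lambda>x. mono_of (r x)) (z 0) * mono_of v) = (0::'k)"
    by (simp add: mono_of_append[symmetric])
qed simp

lemma core_ideal_functional: "f \<in> core_ideal l \<Longrightarrow> functional l f = 0"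
proof -
  assume f: "f \<in> core_ideal l"
  have "graded_subst (var :: letter \<Rightarrow> 'a free_alg)" by (simp add: graded_subst_def)
  then have "functional l (1 * subst_alg var f * 1) = 0" using f unfolding core_ideal_def by blast
  then show ?thesis by (simp add: subst_alg_id)
qed

lemma core_ideal_witnesses:
  "z 0 \<notin> core_ideal (atom_functional Deg_z :: letter list \<Rightarrow> 'k::field_char_0)"
    "comm (y 0) (y 1) \<notin> core_ideal (atom_functional Comm_yy :: letter list \<Rightarrow> 'k::field_char_0)"
    "comm (y 0) (z 0) \<notin> core_ideal (atom_functional Comm_yz :: letter list \<Rightarrow> 'k::field_char_0)"
    "z 0 * z 1 + z 1 * z 0 \<notin> core_ideal (atom_functional Sym_zz :: letter list \<Rightarrow> 'k::field_char_0)"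
    "comm (z 0) (z 1) \<notin> core_ideal (atom_functional Alt_zz :: letter list \<Rightarrow> 'k::field_char_0)"
  by (auto dest!: core_ideal_functional simp: mono_normal functional_add functional_diff ind_def)

subsection \<open>The families\<close>

lemma atom_ideal_low:
  fixes Q :: "atom set"
  defines "I \<equiv> atom_ideal Q :: 'k::field_char_0 free_alg set"
  shows "Deg_z \<in> Q \<Longrightarrow> gamma I 1 = 1"
    and "Comm_yy \<in> Q \<Longrightarrow> proper_codim I 2 0 = 1"
    and "Comm_yz \<in> Q \<Longrightarrow> proper_codim I 1 1 = 1"
    and "Q \<subseteq> {Deg_z, Comm_yz, Sym_zz, Alt_zz, Sym_zzz, Alt_zzz, Sym_yyz, Std_zzz1, Std_zzz2, Sym_zyz, Alt_zyz}
      \<Longrightarrow> proper_codim I 2 0 = 0"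
    and "Q \<subseteq> {Deg_z, Comm_yy, Sym_zz, Sym_zzz, Lie_yyy} \<Longrightarrow> proper_codim I 1 1 = 0"
    and "Sym_zz \<in> Q \<Longrightarrow> Alt_zz \<in> Q \<Longrightarrow> proper_codim I 0 2 = 2"
    and "Sym_zz \<in> Q \<Longrightarrow> Q \<subseteq> {Deg_z, Comm_yy, Comm_yz, Sym_zz, Sym_zzz, Lie_yyy, Sym_yyz, Alt_yyz, Alt_zyy}
      \<Longrightarrow> proper_codim I 0 2 = 1"
    and "Q \<subseteq> {Deg_z, Comm_yy, Comm_yz, Lie_yyy, Sym_yyz, Alt_yyz, Alt_zyy} \<Longrightarrow> proper_codim I 0 2 = 0"
    and "Q \<subseteq> {Comm_yy, Lie_yyy} \<Longrightarrow> gamma I 1 = 0"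
proof -
  have T2: "T2_ideal I" unfolding I_def by (rule T2_ideal_atom_ideal)
  note low = gamma_expand proper_codim_10[OF T2] proper_codim_01[OF T2] proper_codim_20[OF T2] proper_codim_11[OF T2]
    proper_codim_02[OF T2]
  have mem: "f \<in> I \<longleftrightarrow> (\<forall>q\<in>Q. f \<in> core_ideal (atom_functional q))" for f
    unfolding I_def by (rule in_atom_ideal)
  have out: "Deg_z \<in> Q \<Longrightarrow> z 0 \<notin> I" "Comm_yy \<in> Q \<Longrightarrow> comm (y 0) (y 1) \<notin> I"
    "Comm_yz \<in> Q \<Longrightarrow> comm (y 0) (z 0) \<notin> I" "Sym_zz \<in> Q \<Longrightarrow> z 0 * z 1 + z 1 * z 0 \<notin> I"
    "Alt_zz \<in> Q \<Longrightarrow> comm (z 0) (z 1) \<notin> I"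
    unfolding mem using core_ideal_witnesses by blast+
  show "Deg_z \<in> Q \<Longrightarrow> gamma I 1 = 1" "Comm_yy \<in> Q \<Longrightarrow> proper_codim I 2 0 = 1"
    "Comm_yz \<in> Q \<Longrightarrow> proper_codim I 1 1 = 1" "Sym_zz \<in> Q \<Longrightarrow> Alt_zz \<in> Q \<Longrightarrow> proper_codim I 0 2 = 2"
    using out unfolding low by auto
  have sub: "comm (y 0) (y 1) \<in> I" if "Q \<subseteq> {Deg_z, Comm_yz, Sym_zz, Alt_zz, Sym_zzz, Alt_zzz, Sym_yyz, Std_zzz1, Std_zzz2, Sym_zyz, Alt_zyz}"
    unfolding mem using that comm_yy_core by blast
  then show "Q \<subseteq> {Deg_z, Comm_yz, Sym_zz, Alt_zz, Sym_zzz, Alt_zzz, Sym_yyz, Std_zzz1, Std_zzz2, Sym_zyz, Alt_zyz}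
      \<Longrightarrow> proper_codim I 2 0 = 0" unfolding low by simp
  have "comm (y 0) (z 0) \<in> I" if "Q \<subseteq> {Deg_z, Comm_yy, Sym_zz, Sym_zzz, Lie_yyy}"
    unfolding mem using that comm_yz_core by blast
  then show "Q \<subseteq> {Deg_z, Comm_yy, Sym_zz, Sym_zzz, Lie_yyy} \<Longrightarrow> proper_codim I 1 1 = 0"
    unfolding low by simp
  have zz: "comm (z 0) (z 1) \<in> I" if "Q \<subseteq> {Deg_z, Comm_yy, Comm_yz, Sym_zz, Sym_zzz, Lie_yyy, Sym_yyz, Alt_yyz, Alt_zyy}"
    unfolding mem using that comm_zz_core by blast
  show "proper_codim I 0 2 = 1" if "Sym_zz \<in> Q"
    "Q \<subseteq> {Deg_z, Comm_yy, Comm_yz, Sym_zz, Sym_zzz, Lie_yyy, Sym_yyz, Alt_yyz, Alt_zyy}"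
    using zz[OF that(2)] out(4)[OF that(1)] unfolding low by simp
  show "proper_codim I 0 2 = 0" if "Q \<subseteq> {Deg_z, Comm_yy, Comm_yz, Lie_yyy, Sym_yyz, Alt_yyz, Alt_zyy}"
  proof -
    have "z 0 * z 1 + z 1 * z 0 \<in> I" unfolding mem using that anticomm_zz_core by blast
    moreover have "comm (z 0) (z 1) \<in> I" using that by (intro zz) blast
    ultimately show ?thesis unfolding low by simp
  qed
  have "z 0 \<in> I" if "Q \<subseteq> {Comm_yy, Lie_yyy}"
    unfolding mem using that z_core by blast
  then show "Q \<subseteq> {Comm_yy, Lie_yyy} \<Longrightarrow> gamma I 1 = 0"
    unfolding low by simp
qed

section \<open>Growth of binomial sequences\<close>

lemma sum_binomial_truncate:
  fixes g :: "nat \<Rightarrow> nat"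
  assumes "\<And>k. 3 < k \<Longrightarrow> g k = 0"
  shows "(\<Sum>k\<le>n. (n choose k) * g k) = g 0 + g 1 * (n choose 1) + g 2 * (n choose 2) + g 3 * (n choose 3)"
proof -
  have "(\<Sum>k\<le>n. (n choose k) * g k) = (\<Sum>k\<le>n + 3. (n choose k) * g k)"
    by (rule sum.mono_neutral_left) auto
  also have "\<dots> = (\<Sum>k\<le>3. (n choose k) * g k)"
    using assms by (intro sum.mono_neutral_right) auto
  also have "\<dots> = g 0 + g 1 * (n choose 1) + g 2 * (n choose 2) + g 3 * (n choose 3)"
    by (simp add: numeral_3_eq_3 numeral_2_eq_2)
  finally show ?thesis .
qed

lemma poly_growth_bounds:
  assumes "poly_growth c 3"
  obtains q M :: real where "q > 0" "M > 0"
    "eventually (\<lambda>n. \<bar>real (c n) - q * real n ^ 3\<bar> \<le> M * real n ^ 2) at_top"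
proof -
  obtain q where q: "q > 0" "(\<lambda>n. real (c n) - q * real n ^ 3) \<in> O(\<lambda>n. real n powi (int 3 - 1))"
    using assms unfolding poly_growth_def by blast
  obtain M where "M > 0" "eventually (\<lambda>n. norm (real (c n) - q * real n ^ 3) \<le> M * norm (real n powi (int 3 - 1))) at_top"
    using q(2) by (elim landau_o.bigE)
  then show thesis using q(1) by (intro that[of q M]) (simp_all add: power_int_def)
qed

text \<open>
  All summands are nonnegative and \<open>n choose k\<close> grows like the \<open>k\<close>-th power of \<open>n\<close>.
\<close>

lemma cubic_growth_coefficients:
  fixes g :: "nat \<Rightarrow> nat"
  assumes growth: "poly_growth c 3" and c: "\<And>n. 1 \<le> n \<Longrightarrow> c n = (\<Sum>k\<le>n. (n choose k) * g k)"
  shows "3 < k \<Longrightarrow> g k = 0" and "g 3 \<noteq> 0"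
proof -
  obtain q M :: real where qM: "q > 0" "M > 0"
    and ev: "eventually (\<lambda>n. \<bar>real (c n) - q * real n ^ 3\<bar> \<le> M * real n ^ 2) at_top"
    using poly_growth_bounds[OF growth] .
  obtain N where N: "\<And>n. N \<le> n \<Longrightarrow> \<bar>real (c n) - q * real n ^ 3\<bar> \<le> M * real n ^ 2"
    using ev unfolding eventually_at_top_linorder by blast
  show high: "g k = 0" if k: "3 < k" for k
  proof (rule ccontr)
    assume gk: "g k \<noteq> 0"
    \<comment> \<open>Such an \<open>n\<close> is too large for \<open>n\<^sup>4 / k\<^sup>4 \<le> (q + M) n\<^sup>3\<close>, which the growth bound would imply.\<close>
    obtain n where n: "real n > (q + M) * real k ^ 4" "n \<ge> N" "n \<ge> k" "n \<ge> 1"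
    proof -
      obtain m where "real m > (q + M) * real k ^ 4" using reals_Archimedean2 by blast
      then show thesis by (intro that[of "m + N + k + 1"]) auto
    qed
    have "(real n / real k) ^ 4 \<le> (real n / real k) ^ k"
      using k n by (intro power_increasing) auto
    also have "\<dots> \<le> real (n choose k)" using n by (intro binomial_ge_n_over_k_pow_k) auto
    also have "\<dots> \<le> real (c n)"
    proof -
      have "(n choose k) \<le> (n choose k) * g k" using gk by simp
      also have "\<dots> \<le> (\<Sum>k\<le>n. (n choose k) * g k)" using n by (intro member_le_sum) auto
      finally have "(n choose k) \<le> c n" using c[OF n(4)] by simp
      then show ?thesis by simp
    qed
    also have "\<dots> \<le> q * real n ^ 3 + M * real n ^ 2" using N[OF n(2)] by linarith
    also have "\<dots> \<le> (q + M) * real n ^ 3"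
    proof -
      have "real n ^ 2 \<le> real n ^ 3" using n by (intro power_increasing) auto
      then have "M * real n ^ 2 \<le> M * real n ^ 3" using qM by simp
      then show ?thesis by (simp add: distrib_right)
    qed
    finally have "real n ^ 4 \<le> (q + M) * real n ^ 3 * real k ^ 4"
      using k by (simp add: power_divide divide_le_eq)
    then have "real n ^ 3 * real n \<le> real n ^ 3 * ((q + M) * real k ^ 4)"
      by (simp add: power_numeral_reduce algebra_simps)
    then have "real n \<le> (q + M) * real k ^ 4" using n by simp
    then show False using n by simp
  qed
  show "g 3 \<noteq> 0"
  proof
    assume g3: "g 3 = 0"
    define K where "K = real (g 0 + g 1 + g 2) + M"
    obtain n where n: "real n * q > K" "n \<ge> N" "n \<ge> 1"
    proof -
      obtain m where m: "real m > K / q" using reals_Archimedean2 by blast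
      have "real m * q > K" using m qM by (simp add: divide_less_eq)
      moreover have "real (m + N + 1) * q \<ge> real m * q" using qM by simp
      ultimately show thesis by (intro that[of "m + N + 1"]) linarith+
    qed
    have "n choose 2 \<le> n ^ 2"
      by (cases "2 \<le> n") (auto intro: binomial_le_pow simp: binomial_eq_0)
    with n have le: "n choose 1 \<le> n ^ 2" "n choose 2 \<le> n ^ 2" "1 \<le> n ^ 2"
      by (auto simp: power2_eq_square)
    have "c n = g 0 + g 1 * (n choose 1) + g 2 * (n choose 2)"
      using c[OF n(3)] sum_binomial_truncate[of g n] high g3 by simp
    also have "\<dots> \<le> g 0 * n ^ 2 + g 1 * n ^ 2 + g 2 * n ^ 2"
      using le by (intro add_mono mult_le_mono2) auto
    finally have "real (c n) \<le> real ((g 0 + g 1 + g 2) * n ^ 2)"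
      by (simp only: of_nat_le_iff distrib_right)
    then have "real (c n) \<le> real (g 0 + g 1 + g 2) * real n ^ 2" by simp
    moreover have "q * real n ^ 3 \<le> real (c n) + M * real n ^ 2" using N[OF n(2)] by linarith
    ultimately have "q * real n ^ 3 \<le> K * real n ^ 2" by (simp add: K_def distrib_right)
    then have "real n ^ 2 * (real n * q) \<le> real n ^ 2 * K"
      by (simp add: power_numeral_reduce algebra_simps)
    then have "real n * q \<le> K" using n by simp
    then show False using n by simp
  qed
qed

lemma poly_growth_binom_seq:
  assumes r: "r \<noteq> 0"
  shows "poly_growth (binom_seq p q r) 3"
  unfolding poly_growth_def
proof (intro exI conjI)
  show "real r / 6 > 0" using r by simp
  have ch: "real (n choose 2) = real n * (real n - 1) / 2" "real (n choose 3) = real n * (real n - 1) * (real n - 2) / 6" for n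
    by (simp_all add: binomial_gbinomial gbinomial_prod_rev numeral_2_eq_2 numeral_3_eq_3 fact_numeral)
  have "\<bar>real (binom_seq p q r n) - real r / 6 * real n ^ 3\<bar> \<le> (1 + real p + real q + real r) * real n ^ 2"
    if n: "n \<ge> 1" for n
  proof -
    have sq: "1 \<le> real n ^ 2" "real n \<le> real n ^ 2"
      using n power_increasing[of 0 2 "real n"] power_increasing[of 1 2 "real n"] by simp_all
    have "real (binom_seq p q r n) - real r / 6 * real n ^ 3
        = 1 + real p * real n + real q * ((real n ^ 2 - real n) / 2) + real r * ((2 * real n - 3 * real n ^ 2) / 6)"
      using n by (simp add: binom_seq_def ch power_numeral_reduce field_simps)
    also have "\<bar>\<dots>\<bar> \<le> 1 + real p * real n ^ 2 + real q * real n ^ 2 + real r * real n ^ 2"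
    proof -
      have b: "\<bar>(t - x) / 2\<bar> \<le> t" "\<bar>(2 * x - 3 * t) / 6\<bar> \<le> t" if "0 \<le> x" "x \<le> t" for x t :: real
        using that by (auto simp: abs_if field_simps)
      note b = b[OF of_nat_0_le_iff sq(2)]
      have "\<bar>real p * real n\<bar> \<le> real p * real n ^ 2" using sq by (simp add: mult_left_mono)
      moreover have "\<bar>real q * ((real n ^ 2 - real n) / 2)\<bar> \<le> real q * real n ^ 2"
        unfolding abs_mult using b by (intro mult_mono) auto
      moreover have "\<bar>real r * ((2 * real n - 3 * real n ^ 2) / 6)\<bar> \<le> real r * real n ^ 2"
        unfolding abs_mult using b by (intro mult_mono) auto
      ultimately show ?thesis by linarith
    qed
    also have "\<dots> \<le> (1 + real p + real q + real r) * real n ^ 2" using sq by (simp add: distrib_right)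
    finally show ?thesis .
  qed
  then show "(\<lambda>n. real (binom_seq p q r n) - real r / 6 * real n ^ 3) \<in> O(\<lambda>n. real n powi (int 3 - 1))"
    by (intro bigoI[where c = "1 + real p + real q + real r"] eventually_at_top_linorderI[of 1])
      (simp add: power_int_def)
qed

lemma binom_seq_inject: "binom_seq p q r = binom_seq p' q' r' \<longleftrightarrow> p = p' \<and> q = q' \<and> r = r'"
proof
  assume h: "binom_seq p q r = binom_seq p' q' r'"
  have "binom_seq p q r 1 = 1 + p" "binom_seq p q r 2 = 1 + 2 * p + q" "binom_seq p q r 3 = 1 + 3 * p + 3 * q + r" for p q r
    by (simp_all add: binom_seq_def numeral_3_eq_3 numeral_2_eq_2)
  then show "p = p' \<and> q = q' \<and> r = r'"
    using h by (metis add_left_cancel)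
qed simp

section \<open>Codimension sequences of cubic growth\<close>

lemma unit_ideal_gamma:
  assumes I: "T2_ideal I" and "1 \<in> (I :: 'k::field_char_0 free_alg set)"
  shows "gamma I k = 0"
proof -
  have "f \<in> I" for f using T2_mult(1)[OF I assms(2), of f] by simp
  then show ?thesis by (subst gamma_eq_0_iff[OF I]) blast
qed

lemma graded_codim_gamma:
  assumes I: "T2_ideal (graded_ids A \<phi>)" and "1 \<le> n"
  shows "graded_codim A \<phi> n = (\<Sum>k\<le>n. (n choose k) * gamma (graded_ids A \<phi>) k)"
  using codim_multilin_gamma[OF I, of n] assms(2) by (simp add: graded_codim_def codim_def)

lemma graded_codim_binom_seq:
  fixes A :: "('k::field_char_0, 'a) module"
  assumes I: "T2_ideal (graded_ids A \<phi>)" and high: "\<And>k. 3 < k \<Longrightarrow> gamma (graded_ids A \<phi>) k = 0"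
    and g3: "gamma (graded_ids A \<phi>) 3 \<noteq> 0"
  shows "graded_codim A \<phi> = binom_seq (gamma (graded_ids A \<phi>) 1) (gamma (graded_ids A \<phi>) 2) (gamma (graded_ids A \<phi>) 3)"
proof
  fix n
  have "1 \<notin> graded_ids A \<phi>" using unit_ideal_gamma[OF I, of 3] g3 by auto
  then have g0: "gamma (graded_ids A \<phi>) 0 = 1" using proper_codim_00[OF I] by (simp add: gamma_expand)
  show "graded_codim A \<phi> n = binom_seq (gamma (graded_ids A \<phi>) 1) (gamma (graded_ids A \<phi>) 2) (gamma (graded_ids A \<phi>) 3) n"
  proof (cases "1 \<le> n")
    case True
    then show ?thesis
      using graded_codim_gamma[OF I True] sum_binomial_truncate[of "gamma (graded_ids A \<phi>)" n] high g0
      by (simp add: binom_seq_def)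
  next
    case False
    then show ?thesis by (simp add: graded_codim_def binom_seq_def)
  qed
qed

lemma realize_codimensions:
  fixes I :: "'k::field_char_0 free_alg set"
  assumes I: "T2_ideal I" and high: "\<And>k. 3 < k \<Longrightarrow> gamma I k = 0" and g3: "gamma I 3 \<noteq> 0"
  shows "binom_seq (gamma I 1) (gamma I 2) (gamma I 3)
    \<in> {graded_codim A \<phi> | (A :: ('k, 'k free_alg set) module) \<phi>. cubic_superalgebra A \<phi>}"
proof -
  have ids: "graded_ids (rel_free I) (rel_free_aut I) = I" by (rule rel_free_graded_ids[OF I])
  have "graded_codim (rel_free I) (rel_free_aut I) = binom_seq (gamma I 1) (gamma I 2) (gamma I 3)"
    using graded_codim_binom_seq[of "rel_free I" "rel_free_aut I"] I high g3 unfolding ids by blast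
  moreover from this have "cubic_superalgebra (rel_free I) (rel_free_aut I)"
    unfolding cubic_superalgebra_def using rel_free_superalgebra[OF I] poly_growth_binom_seq[OF g3] by simp
  ultimately show ?thesis by (metis (mono_tags, lifting) mem_Collect_eq)
qed

lemma proper_codim_full:
  fixes I :: "'k::field_char_0 free_alg set"
  assumes rs: "(r, s) \<in> small_types" and I: "T2_ideal I"
    and full: "proper_codim I r s = length (proper_basis r s :: 'k free_alg list)"
  shows "proper (std_letters r s) \<inter> I \<subseteq> {0}"
proof -
  let ?V = "proper (std_letters r s) :: 'k free_alg set"
  have V: "fin_space ?V" by (rule fin_space_proper[OF finite_std_letters])
  have "?V \<subseteq> free_alg.span (set (proper_basis r s))"
    using proper_lin_comb[OF rs] lin_comb_in_subspace[OF free_alg.subspace_span] free_alg.span_base by blast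
  then have "free_alg.dim ?V \<le> card (set (proper_basis r s :: 'k free_alg list))" by (rule free_alg.dim_le_card) simp
  also have "\<dots> \<le> length (proper_basis r s :: 'k free_alg list)" by (rule card_length)
  finally have "free_alg.dim (?V \<inter> I) = 0"
    using codim_dim[OF V T2_subspace[OF I]] full by (simp add: proper_codim_def)
  moreover obtain C where "?V \<inter> I \<subseteq> free_alg.span C" "finite C" "card C = free_alg.dim (?V \<inter> I)"
    by (rule fin_space_basis[OF fin_space_Int[OF V T2_subspace[OF I]]])
  ultimately show ?thesis by simp
qed

lemma Gam_1_trivial_iff:
  fixes I :: "'k::field_char_0 free_alg set"
  assumes I: "T2_ideal I"
  shows "Gam 1 \<inter> I = {0} \<longleftrightarrow> z 0 \<notin> I"
proof
  assume h: "Gam 1 \<inter> I = {0}"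
  have "z 0 \<in> mlin (multideg 1 {0})" unfolding var_def by (rule mono_of_in_mlin) (auto simp: multideg_def)
  then have "z 0 \<in> Gam 1"
    using mlin_subset_multilin[of "{0}" 1] Y_proper_Z[of 0] by (auto simp: Gam_def)
  moreover have "z 0 \<noteq> (0 :: 'k free_alg)"
    using core_ideal_witnesses(1) T2_zero[OF T2_ideal_core_ideal] by metis
  ultimately show "z 0 \<notin> I" using h by blast
next
  assume h: "z 0 \<notin> I"
  show "Gam 1 \<inter> I = {0}"
  proof (rule Gam_Int_trivial[OF I])
    fix r :: nat assume "r \<le> 1"
    then consider "r = 0" | "r = 1" by linarith
    then show "proper (std_letters (1 - r) r) \<inter> I \<subseteq> {0}"
    proof cases
      case 1
      then show ?thesis using proper_10 by auto
    next
      case 2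
      then show ?thesis
        using proper_codim_full[of 0 1 I] I h proper_codim_01[OF I] by (simp add: proper_basis_simps[simplified])
    qed
  qed
qed

lemma Gam_2_trivial_iff:
  fixes I :: "'k::field_char_0 free_alg set"
  assumes I: "T2_ideal I"
  shows "Gam 2 \<inter> I = {0} \<longleftrightarrow> gamma I 2 = 5"
proof
  assume h: "Gam 2 \<inter> I = {0}"
  have nz: "comm (y 0) (y 1) \<noteq> (0 :: 'k free_alg)" "comm (y 0) (z 0) \<noteq> (0 :: 'k free_alg)"
    "z 0 * z 1 + z 1 * z 0 \<noteq> (0 :: 'k free_alg)" "comm (z 0) (z 1) \<noteq> (0 :: 'k free_alg)"
    using core_ideal_witnesses(2-) T2_zero[OF T2_ideal_core_ideal] by metis+
  have "comm (y 0) (z 1) \<noteq> (0 :: 'k free_alg)"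
  proof
    assume "comm (y 0) (z 1) = (0 :: 'k free_alg)"
    then have "rename (index_map (\<lambda>i. i) (\<lambda>i. 0)) (comm (y 0) (z 1)) = (0 :: 'k free_alg)"
      by (simp add: rename_simps)
    then show False using nz(2) by (simp add: rename_def subst_alg_simps index_map_def)
  qed
  note nz = nz this
  have sub: "free_alg.subspace (multilin 2 :: 'k free_alg set)"
    unfolding multilin_def by (rule free_alg.subspace_span)
  have M: "mono_of xs \<in> (multilin 2 :: 'k free_alg set)" if "distinct xs" "set xs = multideg 2 T" "T \<subseteq> {..<2}" for xs T
    using mono_of_in_mlin[OF that(1,2)] mlin_subset_multilin[OF that(3)] by blast
  have md: "multideg 2 {} = {Y 0, Y 1}" "multideg 2 {1} = {Y 0, Z 1}" "multideg 2 {0, 1} = {Z 0, Z 1}"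
    by (auto simp: multideg_def less_2_cases_iff)
  have m1: "mono_of [Y 0, Y 1] \<in> (multilin 2 :: 'k free_alg set)" "mono_of [Y 1, Y 0] \<in> (multilin 2 :: 'k free_alg set)"
    by (rule M[of _ "{}"]; auto simp: md)+
  have m2: "mono_of [Y 0, Z 1] \<in> (multilin 2 :: 'k free_alg set)" "mono_of [Z 1, Y 0] \<in> (multilin 2 :: 'k free_alg set)"
    by (rule M[of _ "{1}"]; auto simp: md[simplified])+
  have m3: "mono_of [Z 0, Z 1] \<in> (multilin 2 :: 'k free_alg set)" "mono_of [Z 1, Z 0] \<in> (multilin 2 :: 'k free_alg set)"
    by (rule M[of _ "{0, 1}"]; auto simp: md[simplified])+
  have "comm (y 0) (y 1) \<in> (multilin 2 :: 'k free_alg set)" "comm (y 0) (z 1) \<in> (multilin 2 :: 'k free_alg set)"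
    "z 0 * z 1 + z 1 * z 0 \<in> (multilin 2 :: 'k free_alg set)" "comm (z 0) (z 1) \<in> (multilin 2 :: 'k free_alg set)"
    using m1 m2 m3 by (simp_all add: mono_normal free_alg.subspace_add[OF sub] free_alg.subspace_diff[OF sub])
  moreover have "comm (y 0) (y 1) \<in> (Y_proper :: 'k free_alg set)" "comm (y 0) (z 1) \<in> (Y_proper :: 'k free_alg set)"
    "z 0 * z 1 + z 1 * z 0 \<in> (Y_proper :: 'k free_alg set)" "comm (z 0) (z 1) \<in> (Y_proper :: 'k free_alg set)"
    by (intro Y_proper_comm brackets.letter Y_proper_add Y_proper_mult Y_proper_Z)+
  ultimately have G: "comm (y 0) (y 1) \<in> (Gam 2 :: 'k free_alg set)" "comm (y 0) (z 1) \<in> (Gam 2 :: 'k free_alg set)"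
    "z 0 * z 1 + z 1 * z 0 \<in> (Gam 2 :: 'k free_alg set)" "comm (z 0) (z 1) \<in> (Gam 2 :: 'k free_alg set)"
    unfolding Gam_def by blast+
  have "comm (y 0) (z 0) \<notin> I"
  proof
    assume "comm (y 0) (z 0) \<in> I"
    then have "comm (y 0) (z 1) \<in> I" by (rule commuting_even_odd[OF I]) simp_all
    then show False using h G(2) nz by blast
  qed
  moreover have "comm (y 0) (y 1) \<notin> I" "z 0 * z 1 + z 1 * z 0 \<notin> I" "comm (z 0) (z 1) \<notin> I"
    using h G nz by blast+
  ultimately show "gamma I 2 = 5"
    unfolding gamma_expand by (simp only: proper_codim_20[OF I] proper_codim_11[OF I] proper_codim_02[OF I]) simp
next
  assume g: "gamma I 2 = 5"
  have le: "proper_codim I 2 0 \<le> 1" "proper_codim I 1 1 \<le> 1" "proper_codim I 0 2 \<le> 2"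
    by (simp_all only: proper_codim_20[OF I] proper_codim_11[OF I] proper_codim_02[OF I]) simp_all
  then have full: "proper_codim I 2 0 = 1" "proper_codim I 1 1 = 1" "proper_codim I 0 2 = 2"
    using g unfolding gamma_expand by linarith+
  show "Gam 2 \<inter> I = {0}"
  proof (rule Gam_Int_trivial[OF I])
    fix r :: nat assume "r \<le> 2"
    then consider "r = 0" | "r = 1" | "r = 2" by linarith
    then show "proper (std_letters (2 - r) r) \<inter> I \<subseteq> {0}"
      using proper_codim_full[of 2 0 I] proper_codim_full[of 1 1 I] proper_codim_full[of 0 2 I] I full
      by cases (simp_all add: proper_basis_simps[simplified])
  qed
qed

text \<open>
  With \<open>a\<close>, \<open>b\<close>, \<open>d\<close> for the proper codimensions in degree two and \<open>e\<close>, \<open>f\<close>, \<open>g\<close>, \<open>h\<close> for those in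
  degree three, the consequences of the identities of degree two are linear constraints between
  these numbers, and the assertion follows by running through the values of \<open>a\<close>, \<open>b\<close>, \<open>d\<close>.
\<close>

lemma possible_gammas:
  fixes I :: "'k::field_char_0 free_alg set"
  assumes I: "T2_ideal I" and g3: "gamma I 3 \<noteq> 0"
  shows "z 0 \<in> I \<Longrightarrow> gamma I 1 = 0 \<and> gamma I 2 = 1 \<and> gamma I 3 = 2"
    and "z 0 \<notin> I \<Longrightarrow> gamma I 1 = 1"
    and "gamma I 2 = 5 \<Longrightarrow> gamma I 3 \<in> {1..29}"
    and "gamma I 2 \<noteq> 5 \<Longrightarrow> z 0 \<notin> I \<Longrightarrow>
      (gamma I 2 = 4 \<and> gamma I 3 \<in> {1..15}) \<or> (gamma I 2 = 3 \<and> gamma I 3 \<in> {1..11} - {7, 10}) \<or>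
      (gamma I 2 = 2 \<and> gamma I 3 \<in> {1..3}) \<or> (gamma I 2 = 1 \<and> gamma I 3 \<in> {1..2})"
proof -
  define a b d e f g h where
    "a = proper_codim I 2 0" and "b = proper_codim I 1 1" and "d = proper_codim I 0 2" and
    "e = proper_codim I 3 0" and "f = proper_codim I 2 1" and "g = proper_codim I 1 2" and "h = proper_codim I 0 3"
  note defs = a_def b_def d_def e_def f_def g_def h_def
  have gam: "gamma I 1 = proper_codim I 0 1" "gamma I 2 = a + 2 * b + d" "gamma I 3 = e + 3 * f + 3 * g + h"
    unfolding gamma_expand defs proper_codim_10[OF I] by simp_all
  have le: "a \<le> 1" "b \<le> 1" "d \<le> 2"
    unfolding defs by (simp_all only: proper_codim_20[OF I] proper_codim_11[OF I] proper_codim_02[OF I]) simp_all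
  have le3: "f \<le> 3" "g \<le> 4" "h \<le> 6" and e: "e = 0 \<or> e = 2"
    unfolding defs using proper_codim_bounds[OF I] proper_codim_30[OF I] by auto
  have a0: "e = 0 \<and> f \<le> 1 \<and> g \<le> 2" if "a = 0"
  proof -
    have "comm (y 0) (y 1) \<in> I" using that unfolding a_def proper_codim_20[OF I] by (simp split: if_splits)
    from evens_commute_consequences[OF I this] show ?thesis unfolding defs by simp
  qed
  have b0: "f = 0 \<and> g = 0 \<and> h \<le> 2" if "b = 0"
  proof -
    have "comm (y 0) (z 0) \<in> I" using that unfolding b_def proper_codim_11[OF I] by (simp split: if_splits)
    from even_odd_commute_consequences[OF I this] show ?thesis unfolding defs by simp
  qed
  have d1: "g = 0 \<and> h \<le> 1" if "d \<le> 1"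
  proof -
    have "z 0 * z 1 + z 1 * z 0 \<in> I \<or> comm (z 0) (z 1) \<in> I"
      using that unfolding d_def proper_codim_02[OF I] by (simp split: if_splits)
    from odds_signed_commute_consequences[OF I this] show ?thesis unfolding defs by simp
  qed
  have d0: "h = 0" if "d = 0"
  proof -
    have "z 0 * z 1 + z 1 * z 0 \<in> I" "comm (z 0) (z 1) \<in> I"
      using that unfolding d_def proper_codim_02[OF I] by (simp_all split: if_splits)
    from odds_square_zero_consequences[OF I this] show ?thesis unfolding defs .
  qed
  show "z 0 \<notin> I \<Longrightarrow> gamma I 1 = 1" unfolding gam proper_codim_01[OF I] by simp
  show "gamma I 1 = 0 \<and> gamma I 2 = 1 \<and> gamma I 3 = 2" if z: "z 0 \<in> I"
  proof -
    have "b = 0" "d = 0" "f = 0" "g = 0" "h = 0"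
      unfolding defs by (rule trivial_grading_consequences[OF I z]; simp)+
    moreover have "proper_codim I 0 1 = 0" using z unfolding proper_codim_01[OF I] by simp
    moreover have "a \<noteq> 0" using a0 g3 unfolding gam by (auto simp: calculation)
    ultimately show ?thesis using g3 e le unfolding gam by auto
  qed
  show "gamma I 2 = 5 \<Longrightarrow> gamma I 3 \<in> {1..29}"
    using g3 e le3 unfolding gam by auto
  assume g2: "gamma I 2 \<noteq> 5"
  have cases: "(a = 0 \<or> a = 1) \<and> (b = 0 \<or> b = 1) \<and> (d = 0 \<or> d = 1 \<or> d = 2)" using le by auto
  have fcases: "f = 0 \<or> f = 1 \<or> f = 2 \<or> f = 3" using le3 by auto
  show "(gamma I 2 = 4 \<and> gamma I 3 \<in> {1..15}) \<or> (gamma I 2 = 3 \<and> gamma I 3 \<in> {1..11} - {7, 10}) \<or>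
      (gamma I 2 = 2 \<and> gamma I 3 \<in> {1..3}) \<or> (gamma I 2 = 1 \<and> gamma I 3 \<in> {1..2})"
    using g3 g2 cases e a0 b0 d0 d1 le3 fcases unfolding gam by (elim conjE disjE) auto
qed

lemma classify_cubic:
  fixes A :: "('k::field_char_0, 'a) module"
  assumes A: "cubic_superalgebra A \<phi>"
  defines "I \<equiv> graded_ids A \<phi>"
  shows "T2_ideal I" and "\<And>k. 3 < k \<Longrightarrow> gamma I k = 0" and "gamma I 3 \<noteq> 0"
    and "graded_codim A \<phi> = binom_seq (gamma I 1) (gamma I 2) (gamma I 3)"
proof -
  interpret superalgebra A \<phi> using A unfolding cubic_superalgebra_def by blast
  show I: "T2_ideal I" unfolding I_def by (rule T2_ideal_graded_ids)
  have growth: "poly_growth (graded_codim A \<phi>) 3" using A unfolding cubic_superalgebra_def by blast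
  have c: "graded_codim A \<phi> n = (\<Sum>k\<le>n. (n choose k) * gamma I k)" if "1 \<le> n" for n
    using graded_codim_gamma[of A \<phi> n] I that unfolding I_def by blast
  show high: "gamma I k = 0" if "3 < k" for k using cubic_growth_coefficients(1)[OF growth c that] .
  show g3: "gamma I 3 \<noteq> 0" using cubic_growth_coefficients(2)[OF growth c] .
  show "graded_codim A \<phi> = binom_seq (gamma I 1) (gamma I 2) (gamma I 3)"
    using graded_codim_binom_seq[of A \<phi>] I high g3 unfolding I_def by blast
qed

text \<open>
  The sequence consists of the intersections of the graded identities with the spaces of proper
  polynomials, starting at the first nonzero one and at degree three if there is none before.
\<close>

lemma associated_sequence_exists:
  fixes A :: "('k::field_char_0, 'a) module"
  assumes A: "cubic_superalgebra A \<phi>"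
  shows "\<exists>s M. k_admissible s 3 M \<and> associated_with A \<phi> s 3 M"
proof -
  let ?I = "graded_ids A \<phi>"
  note cl = classify_cubic[OF A]
  note I = cl(1)
  define s :: nat where "s = (if Gam 1 \<inter> ?I \<noteq> {0} then 1 else if Gam 2 \<inter> ?I \<noteq> {0} then 2 else 3)"
  define M where "M i = Gam i \<inter> ?I" for i
  have s: "1 \<le> s" "s \<le> 3" "s < 3 \<longrightarrow> M s \<noteq> {0}" "\<And>i. 1 \<le> i \<Longrightarrow> i < s \<Longrightarrow> M i = {0}"
    by (auto simp: s_def M_def less_Suc_eq numeral_3_eq_3 numeral_2_eq_2 split: if_splits)
  have "hyperoct_submodule i (M i)" for i
    unfolding hyperoct_submodule_def
  proof (intro conjI allI impI)
    show "free_alg.subspace (M i)"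
      unfolding M_def by (rule free_alg.subspace_inter[OF subspace_Gam T2_subspace[OF I]])
    show "M i \<subseteq> Gam i" unfolding M_def by blast
    fix a \<pi> assume \<pi>: "(\<forall>j<i. a j \<in> {1, -1 :: 'k}) \<and> \<pi> permutes {..<i}"
    have "hyperoct_act a \<pi> f \<in> ?I" if "f \<in> ?I" for f
      unfolding hyperoct_act_def
      by (rule T2_subst[OF I that]) (simp add: graded_subst_def parity_scale)
    then show "hyperoct_act a \<pi> ` M i \<subseteq> M i" unfolding M_def using hyperoct_act_Gam \<pi> by blast
  qed
  moreover have "free_aut ` M i \<subseteq> M i" for i
    unfolding M_def using free_aut_Gam T2_free_aut[OF I] by blast
  moreover have "M 3 \<noteq> Gam 3" unfolding M_def using Gam_subset_iff(2)[OF I, of 3] cl(3) by blast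
  moreover have "{\<Sum>i=s..<j. f i | f. \<forall>i\<in>{s..<j}. f i \<in> T2_gen (M i)} \<inter> Gam j \<subseteq> M j" for j
  proof -
    have "T2_gen (M i) \<subseteq> ?I" for i by (rule T2_gen_subset[OF I]) (simp add: M_def)
    then have "(\<Sum>i=s..<j. f i) \<in> ?I" if "\<forall>i\<in>{s..<j}. f i \<in> T2_gen (M i)" for f
      using that by (intro T2_sum[OF I]) blast
    then show ?thesis unfolding M_def by blast
  qed
  ultimately have "k_admissible s 3 M" unfolding k_admissible_def using s by blast
  moreover have "associated_with A \<phi> s 3 M"
    unfolding associated_with_def using s(4) Gam_subset_iff(1)[OF I] cl(2) unfolding M_def by blast
  ultimately show ?thesis by blast
qed

lemma cubic_codimensions:
  fixes A :: "('k::field_char_0, 'a) module"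
  assumes A: "cubic_superalgebra A \<phi>" and M: "k_admissible s 3 M" "associated_with A \<phi> s 3 M"
  shows "(s = 3 \<longrightarrow> (\<exists>u\<in>{1..29}. graded_codim A \<phi> = binom_seq 1 5 u)) \<and>
        (s = 2 \<longrightarrow>
          (\<exists>a\<in>{1..15}. graded_codim A \<phi> = binom_seq 1 4 a) \<or>
          (\<exists>b\<in>{1..11} - {7, 10}. graded_codim A \<phi> = binom_seq 1 3 b) \<or>
          (\<exists>c\<in>{1..3}. graded_codim A \<phi> = binom_seq 1 2 c) \<or>
          (\<exists>d\<in>{1..2}. graded_codim A \<phi> = binom_seq 1 1 d)) \<and>
        (s = 1 \<longrightarrow> graded_codim A \<phi> = binom_seq 0 1 2)"
proof -
  let ?I = "graded_ids A \<phi>"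
  note cl = classify_cubic[OF A]
  note I = cl(1)
  note poss = possible_gammas[OF I cl(3)]
  have low: "Gam i \<inter> ?I = {0}" if "1 \<le> i" "i < s" for i using M(2) that unfolding associated_with_def by blast
  have here: "Gam s \<inter> ?I = M s" if "s \<le> 3" using M(2) that unfolding associated_with_def by auto
  have nz: "M s \<noteq> {0}" if "s < 3" using M(1) that unfolding k_admissible_def by blast
  have "\<exists>u\<in>{1..29}. graded_codim A \<phi> = binom_seq 1 5 u" if "s = 3"
  proof -
    have "z 0 \<notin> ?I" "gamma ?I 2 = 5"
      using low[of 1] low[of 2] that Gam_1_trivial_iff[OF I] Gam_2_trivial_iff[OF I] by simp_all
    then show ?thesis using poss(2,3) cl(4) by auto
  qed
  moreover have "(\<exists>a\<in>{1..15}. graded_codim A \<phi> = binom_seq 1 4 a) \<or>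
          (\<exists>b\<in>{1..11} - {7, 10}. graded_codim A \<phi> = binom_seq 1 3 b) \<or>
          (\<exists>c\<in>{1..3}. graded_codim A \<phi> = binom_seq 1 2 c) \<or>
          (\<exists>d\<in>{1..2}. graded_codim A \<phi> = binom_seq 1 1 d)" if s: "s = 2"
  proof -
    have z: "z 0 \<notin> ?I" using low[of 1] s Gam_1_trivial_iff[OF I] by simp
    have "gamma ?I 2 \<noteq> 5" using here nz s Gam_2_trivial_iff[OF I] by simp
    from poss(4)[OF this z] show ?thesis using poss(2)[OF z] cl(4) by (elim disjE conjE) metis+
  qed
  moreover have "graded_codim A \<phi> = binom_seq 0 1 2" if "s = 1"
  proof -
    have "z 0 \<in> ?I" using here nz that Gam_1_trivial_iff[OF I] by auto
    then show ?thesis using poss(1) cl(4) by simp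
  qed
  ultimately show ?thesis by blast
qed

text \<open>
  The atoms in \<open>F\<close> serve to fix the proper codimensions in degree one and two; the third one only depends on
  how many atoms of each weight are taken from \<open>S\<close>.
\<close>

lemma choose_atoms:
  fixes F S :: "atom set"
  assumes F: "F \<inter> (atoms1 \<union> atoms2 \<union> atoms3) = {}" and S: "S \<subseteq> atoms1 \<union> atoms2 \<union> atoms3"
    and le: "a \<le> card (S \<inter> atoms3)" "b \<le> card (S \<inter> atoms2)" "d \<le> card (S \<inter> atoms1)"
  obtains Q where "F \<subseteq> Q" "Q \<subseteq> F \<union> S"
    "gamma (atom_ideal Q :: 'k::field_char_0 free_alg set) 3 = 3 * a + 2 * b + d"
proof -
  obtain A where A: "A \<subseteq> S \<inter> atoms3" "card A = a" using obtain_subset_with_card_n[OF le(1)] by metis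
  obtain B where B: "B \<subseteq> S \<inter> atoms2" "card B = b" using obtain_subset_with_card_n[OF le(2)] by metis
  obtain D where D: "D \<subseteq> S \<inter> atoms1" "card D = d" using obtain_subset_with_card_n[OF le(3)] by metis
  have disj: "atoms1 \<inter> atoms2 = {}" "atoms1 \<inter> atoms3 = {}" "atoms2 \<inter> atoms3 = {}"
    by (auto simp: atoms1_def atoms2_def atoms3_def)
  have "(F \<union> A \<union> B \<union> D) \<inter> atoms3 = A" "(F \<union> A \<union> B \<union> D) \<inter> atoms2 = B" "(F \<union> A \<union> B \<union> D) \<inter> atoms1 = D"
    using A B D F disj by blast+
  then have "gamma (atom_ideal (F \<union> A \<union> B \<union> D) :: 'k free_alg set) 3 = 3 * a + 2 * b + d"
    unfolding gamma_atom_ideal_3 using A B D by simp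
  then show thesis using A B D by (intro that[of "F \<union> A \<union> B \<union> D"]) auto
qed

abbreviation cubic_codims :: "'k::field_char_0 itself \<Rightarrow> (nat \<Rightarrow> nat) set"
  where "cubic_codims _ \<equiv> {graded_codim A \<phi> | (A :: ('k, 'k free_alg set) module) \<phi>. cubic_superalgebra A \<phi>}"

lemma realize_family:
  fixes F S :: "atom set"
  assumes low: "\<And>Q. F \<subseteq> Q \<Longrightarrow> Q \<subseteq> F \<union> S \<Longrightarrow>
      gamma (atom_ideal Q :: 'k::field_char_0 free_alg set) 1 = p \<and> gamma (atom_ideal Q :: 'k free_alg set) 2 = q"
    and F: "F \<inter> (atoms1 \<union> atoms2 \<union> atoms3) = {}" and S: "S \<subseteq> atoms1 \<union> atoms2 \<union> atoms3"
    and u: "u \<noteq> 0"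
      "\<exists>a b d. a \<le> card (S \<inter> atoms3) \<and> b \<le> card (S \<inter> atoms2) \<and> d \<le> card (S \<inter> atoms1) \<and> u = 3 * a + 2 * b + d"
  shows "binom_seq p q u \<in> cubic_codims TYPE('k)"
proof -
  obtain a b d where abd: "a \<le> card (S \<inter> atoms3)" "b \<le> card (S \<inter> atoms2)" "d \<le> card (S \<inter> atoms1)"
    "u = 3 * a + 2 * b + d" using u(2) by blast
  obtain Q where Q: "F \<subseteq> Q" "Q \<subseteq> F \<union> S" "gamma (atom_ideal Q :: 'k free_alg set) 3 = u"
    using choose_atoms[OF F S abd(1-3), where 'k = 'k] abd(4) by metis
  then show ?thesis
    using realize_codimensions[OF T2_ideal_atom_ideal[of Q, where 'a = 'k] gamma_atom_ideal_high] low[OF Q(1,2)] u(1)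
    by simp
qed

lemmas atoms_defs = atoms1_def atoms2_def atoms3_def

lemma codims_family_5:
  assumes "u \<in> {1..29}"
  shows "binom_seq 1 5 u \<in> cubic_codims TYPE('k::field_char_0)"
proof (rule realize_family[of "{Deg_z, Comm_yy, Comm_yz, Sym_zz, Alt_zz}" "atoms1 \<union> atoms2 \<union> atoms3"])
  fix Q :: "atom set" assume "{Deg_z, Comm_yy, Comm_yz, Sym_zz, Alt_zz} \<subseteq> Q"
  then show "gamma (atom_ideal Q :: 'k free_alg set) 1 = 1 \<and> gamma (atom_ideal Q :: 'k free_alg set) 2 = 5"
    using atom_ideal_low(1,2,3,6)[of Q, where 'k = 'k] by (simp add: gamma_expand(3))
qed (use assms in \<open>auto simp: atoms_defs\<close>, presburger)

lemma codims_family_4: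
  assumes "u \<in> {1..15}"
  shows "binom_seq 1 4 u \<in> cubic_codims TYPE('k::field_char_0)"
proof (rule realize_family[of "{Deg_z, Comm_yz, Sym_zz, Alt_zz}"
      "{Sym_zzz, Alt_zzz, Std_zzz1, Std_zzz2, Sym_yyz, Sym_zyz, Alt_zyz}"])
  fix Q assume Q: "{Deg_z, Comm_yz, Sym_zz, Alt_zz} \<subseteq> Q"
    "Q \<subseteq> {Deg_z, Comm_yz, Sym_zz, Alt_zz} \<union> {Sym_zzz, Alt_zzz, Std_zzz1, Std_zzz2, Sym_yyz, Sym_zyz, Alt_zyz}"
  have "proper_codim (atom_ideal Q :: 'k free_alg set) 2 0 = 0" using Q by (intro atom_ideal_low(4)) auto
  then show "gamma (atom_ideal Q :: 'k free_alg set) 1 = 1 \<and> gamma (atom_ideal Q :: 'k free_alg set) 2 = 4"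
    using Q atom_ideal_low(1,3,6)[of Q, where 'k = 'k] by (simp add: gamma_expand(3))
qed (use assms in \<open>auto simp: atoms_defs\<close>, presburger)

lemma codims_family_3:
  assumes "u \<in> {1..11} - {7, 10}"
  shows "binom_seq 1 3 u \<in> cubic_codims TYPE('k::field_char_0)"
proof (cases "u \<in> {1, 4}")
  case True
  show ?thesis
  proof (rule realize_family[of "{Deg_z, Comm_yz, Sym_zz}" "{Sym_zzz, Sym_yyz}"])
    fix Q assume Q: "{Deg_z, Comm_yz, Sym_zz} \<subseteq> Q" "Q \<subseteq> {Deg_z, Comm_yz, Sym_zz} \<union> {Sym_zzz, Sym_yyz}"
    have "proper_codim (atom_ideal Q :: 'k free_alg set) 2 0 = 0" using Q by (intro atom_ideal_low(4)) auto
    moreover have "proper_codim (atom_ideal Q :: 'k free_alg set) 0 2 = 1" using Q by (intro atom_ideal_low(7)) auto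
    ultimately show "gamma (atom_ideal Q :: 'k free_alg set) 1 = 1 \<and> gamma (atom_ideal Q :: 'k free_alg set) 2 = 3"
      using Q atom_ideal_low(1,3)[of Q, where 'k = 'k] by (simp add: gamma_expand(3))
  qed (use True in \<open>auto simp: atoms_defs\<close>, (presburger+)?)
next
  case False
  show ?thesis
  proof (rule realize_family[of "{Deg_z, Comm_yy, Comm_yz}" "{Sym_yyz, Alt_yyz, Alt_zyy, Lie_yyy}"])
    fix Q assume Q: "{Deg_z, Comm_yy, Comm_yz} \<subseteq> Q" "Q \<subseteq> {Deg_z, Comm_yy, Comm_yz} \<union> {Sym_yyz, Alt_yyz, Alt_zyy, Lie_yyy}"
    have "proper_codim (atom_ideal Q :: 'k free_alg set) 0 2 = 0" using Q by (intro atom_ideal_low(8)) auto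
    then show "gamma (atom_ideal Q :: 'k free_alg set) 1 = 1 \<and> gamma (atom_ideal Q :: 'k free_alg set) 2 = 3"
      using Q atom_ideal_low(1,2,3)[of Q, where 'k = 'k] by (simp add: gamma_expand(3))
  qed (use assms False in \<open>auto simp: atoms_defs\<close>, presburger)
qed

lemma codims_family_2:
  assumes "u \<in> {1..3}"
  shows "binom_seq 1 2 u \<in> cubic_codims TYPE('k::field_char_0)"
proof (rule realize_family[of "{Deg_z, Comm_yy, Sym_zz}" "{Sym_zzz, Lie_yyy}"])
  fix Q assume Q: "{Deg_z, Comm_yy, Sym_zz} \<subseteq> Q" "Q \<subseteq> {Deg_z, Comm_yy, Sym_zz} \<union> {Sym_zzz, Lie_yyy}"
  have "proper_codim (atom_ideal Q :: 'k free_alg set) 1 1 = 0" using Q by (intro atom_ideal_low(5)) auto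
  moreover have "proper_codim (atom_ideal Q :: 'k free_alg set) 0 2 = 1" using Q by (intro atom_ideal_low(7)) auto
  ultimately show "gamma (atom_ideal Q :: 'k free_alg set) 1 = 1 \<and> gamma (atom_ideal Q :: 'k free_alg set) 2 = 2"
    using Q atom_ideal_low(1,2)[of Q, where 'k = 'k] by (simp add: gamma_expand(3))
qed (use assms in \<open>auto simp: atoms_defs\<close>, presburger)

lemma codims_family_1: "binom_seq 1 1 1 \<in> cubic_codims TYPE('k::field_char_0)"
    "binom_seq 1 1 2 \<in> cubic_codims TYPE('k::field_char_0)"
proof -
  show "binom_seq 1 1 1 \<in> cubic_codims TYPE('k)"
  proof (rule realize_family[of "{Deg_z, Sym_zz}" "{Sym_zzz}"])
    fix Q assume Q: "{Deg_z, Sym_zz} \<subseteq> Q" "Q \<subseteq> {Deg_z, Sym_zz} \<union> {Sym_zzz}"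
    have "proper_codim (atom_ideal Q :: 'k free_alg set) 2 0 = 0" using Q by (intro atom_ideal_low(4)) auto
    moreover have "proper_codim (atom_ideal Q :: 'k free_alg set) 1 1 = 0" using Q by (intro atom_ideal_low(5)) auto
    moreover have "proper_codim (atom_ideal Q :: 'k free_alg set) 0 2 = 1" using Q by (intro atom_ideal_low(7)) auto
    ultimately show "gamma (atom_ideal Q :: 'k free_alg set) 1 = 1 \<and> gamma (atom_ideal Q :: 'k free_alg set) 2 = 1"
      using Q atom_ideal_low(1)[of Q, where 'k = 'k] by (simp add: gamma_expand(3))
  qed (auto simp: atoms_defs)
  show "binom_seq 1 1 2 \<in> cubic_codims TYPE('k)"
  proof (rule realize_family[of "{Deg_z, Comm_yy}" "{Lie_yyy}"])
    fix Q assume Q: "{Deg_z, Comm_yy} \<subseteq> Q" "Q \<subseteq> {Deg_z, Comm_yy} \<union> {Lie_yyy}"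
    have "proper_codim (atom_ideal Q :: 'k free_alg set) 1 1 = 0" using Q by (intro atom_ideal_low(5)) auto
    moreover have "proper_codim (atom_ideal Q :: 'k free_alg set) 0 2 = 0" using Q by (intro atom_ideal_low(8)) auto
    ultimately show "gamma (atom_ideal Q :: 'k free_alg set) 1 = 1 \<and> gamma (atom_ideal Q :: 'k free_alg set) 2 = 1"
      using Q atom_ideal_low(1,2)[of Q, where 'k = 'k] by (simp add: gamma_expand(3))
  qed (auto simp: atoms_defs)
qed

lemma codims_family_0: "binom_seq 0 1 2 \<in> cubic_codims TYPE('k::field_char_0)"
proof (rule realize_family[of "{Comm_yy}" "{Lie_yyy}"])
  fix Q assume Q: "{Comm_yy} \<subseteq> Q" "Q \<subseteq> {Comm_yy} \<union> {Lie_yyy}"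
  have "proper_codim (atom_ideal Q :: 'k free_alg set) 1 1 = 0" using Q by (intro atom_ideal_low(5)) auto
  moreover have "proper_codim (atom_ideal Q :: 'k free_alg set) 0 2 = 0" using Q by (intro atom_ideal_low(8)) auto
  moreover have "gamma (atom_ideal Q :: 'k free_alg set) 1 = 0" using Q by (intro atom_ideal_low(9)) auto
  ultimately show "gamma (atom_ideal Q :: 'k free_alg set) 1 = 0 \<and> gamma (atom_ideal Q :: 'k free_alg set) 2 = 1"
    using Q atom_ideal_low(2)[of Q, where 'k = 'k] by (simp add: gamma_expand(3))
qed (auto simp: atoms_defs)

lemma card_listed_sequences:
  "card (binom_seq 1 5 ` {1..29} \<union> binom_seq 1 4 ` {1..15} \<union> binom_seq 1 3 ` ({1..11} - {7, 10}) \<union>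
      binom_seq 1 2 ` {1..3} \<union> binom_seq 1 1 ` {1..2} \<union> {binom_seq 0 1 2}) = 59"
proof -
  have inj: "inj_on (binom_seq p q) S" for p q S by (rule inj_onI) (simp add: binom_seq_inject)
  have c: "card (S \<union> T) = card S + card T" if "finite S" "finite T" "S \<inter> T = {}" for S T :: "(nat \<Rightarrow> nat) set"
    using that by (rule card_Un_disjoint)
  have eleven: "card ({1..11} - {7, 10 :: nat}) = 9" by (subst card_Diff_subset) auto
  have "binom_seq 1 5 ` {1..29} \<inter> binom_seq 1 4 ` {1..15} = {}"
    "(binom_seq 1 5 ` {1..29} \<union> binom_seq 1 4 ` {1..15}) \<inter> binom_seq 1 3 ` ({1..11} - {7, 10}) = {}"
    "(binom_seq 1 5 ` {1..29} \<union> binom_seq 1 4 ` {1..15} \<union> binom_seq 1 3 ` ({1..11} - {7, 10})) \<inter> binom_seq 1 2 ` {1..3} = {}"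
    "(binom_seq 1 5 ` {1..29} \<union> binom_seq 1 4 ` {1..15} \<union> binom_seq 1 3 ` ({1..11} - {7, 10}) \<union> binom_seq 1 2 ` {1..3})
      \<inter> binom_seq 1 1 ` {1..2} = {}"
    "(binom_seq 1 5 ` {1..29} \<union> binom_seq 1 4 ` {1..15} \<union> binom_seq 1 3 ` ({1..11} - {7, 10}) \<union> binom_seq 1 2 ` {1..3}
      \<union> binom_seq 1 1 ` {1..2}) \<inter> {binom_seq 0 1 2} = {}"
    by (auto simp: binom_seq_inject)
  then show ?thesis by (simp add: c card_image[OF inj] eleven del: One_nat_def)
qed

theorem theorem2p10:
  shows "(\<forall>(A :: ('k::field_char_0, 'a) module) \<phi>. cubic_superalgebra A \<phi> \<longrightarrow>
      (\<exists>s M. k_admissible s 3 M \<and> associated_with A \<phi> s 3 M) \<and>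
      (\<forall>s M. k_admissible s 3 M \<and> associated_with A \<phi> s 3 M \<longrightarrow>
        (s = 3 \<longrightarrow> (\<exists>u\<in>{1..29}. graded_codim A \<phi> = binom_seq 1 5 u)) \<and>
        (s = 2 \<longrightarrow>
          (\<exists>a\<in>{1..15}. graded_codim A \<phi> = binom_seq 1 4 a) \<or>
          (\<exists>b\<in>{1..11} - {7, 10}. graded_codim A \<phi> = binom_seq 1 3 b) \<or>
          (\<exists>c\<in>{1..3}. graded_codim A \<phi> = binom_seq 1 2 c) \<or>
          (\<exists>d\<in>{1..2}. graded_codim A \<phi> = binom_seq 1 1 d)) \<and>
        (s = 1 \<longrightarrow> graded_codim A \<phi> = binom_seq 0 1 2))) \<and>
    {graded_codim A \<phi> | (A :: ('k, 'k free_alg set) module) \<phi>. cubic_superalgebra A \<phi>} =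
      binom_seq 1 5 ` {1..29} \<union> binom_seq 1 4 ` {1..15} \<union> binom_seq 1 3 ` ({1..11} - {7, 10}) \<union>
      binom_seq 1 2 ` {1..3} \<union> binom_seq 1 1 ` {1..2} \<union> {binom_seq 0 1 2} \<and>
    card {graded_codim A \<phi> | (A :: ('k, 'k free_alg set) module) \<phi>. cubic_superalgebra A \<phi>} = 59"
proof -
  let ?L = "binom_seq 1 5 ` {1..29} \<union> binom_seq 1 4 ` {1..15} \<union> binom_seq 1 3 ` ({1..11} - {7, 10}) \<union>
      binom_seq 1 2 ` {1..3} \<union> binom_seq 1 1 ` {1..2} \<union> {binom_seq 0 1 2}"
  have "graded_codim A \<phi> \<in> ?L" if A: "cubic_superalgebra A \<phi>" for A :: "('k, 'k free_alg set) module" and \<phi>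
  proof -
    obtain s M where M: "k_admissible s 3 M" "associated_with A \<phi> s 3 M"
      using associated_sequence_exists[OF A] by blast
    have "s = 1 \<or> s = 2 \<or> s = 3" using M(1) unfolding k_admissible_def by linarith
    then show ?thesis using cubic_codimensions[OF A M] by blast
  qed
  moreover have "?L \<subseteq> cubic_codims TYPE('k)"
  proof -
    have "binom_seq 1 1 u \<in> cubic_codims TYPE('k)" if "u \<in> {1..2}" for u
    proof -
      have "u = 1 \<or> u = 2" using that by auto
      then show ?thesis using codims_family_1 by blast
    qed
    then show ?thesis using codims_family_5 codims_family_4 codims_family_3 codims_family_2 codims_family_0 by blast
  qed
  ultimately have eq: "cubic_codims TYPE('k) = ?L" by blast
  show ?thesis
    unfolding eq using card_listed_sequences associated_sequence_exists cubic_codimensions by blast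
qed

end
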